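(* Let $C_1=0.2301$, $C_3=0.3322$, $C_2=C_5=1-C_1-C_3$, $C_4=1-C_2$, $C_6=1-C_3$, and let $e:[0,1]\to[0,1]$ be the piecewise linear function whose graph connects $(0,0),(C_1,C_2),(C_3,C_4),(C_5,C_6),(1,1)$. Then for every sufficiently large even $N$ there exists a bipartite graph $E_N$ with left vertices $a_1,\dots,a_N$, right vertices $b_1,\dots,b_N$, edges directed from left to right, and average degree $5.325$ (at most $5.325N$ edges), such that: (a) for every nonempty set $S$ of left vertices, $|\Gamma(S)|\ge\lceil e(|S|/N)\,N\rceil$; (b) $E_N$ is an $(N,\alpha,1)$-pair-expander for every $\alpha\in[0,C_3]$, with respect to the pairs $\{b_i,b_{i+N/2}\}$, $i=1,\dots,N/2$.
   Context: $\Gamma(S)$ denotes the set of right vertices adjacent to some vertex of $S$. With the right vertices partitioned into pairs, a set $U$ of left vertices is adjacent to a pair if some vertex of $U$ is adjacent to some vertex of the pair; $E_N$ is an $(N,\alpha,\gamma)$-pair-expander if every set $U$ of left vertices with $|U|=k=\lfloor\alpha N\rfloor$ is adjacent to at least $\lfloor\gamma k\rfloor$ pairs. *)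

theory Defs
  imports Complex_Main
begin

(* A bipartite graph with left vertices a_1..a_N and right vertices b_1..b_N, edges directed from
   left to right, is a relation E \<subseteq> {1..N} \<times> {1..N}, where (i, j) \<in> E means a_i \<rightarrow> b_j.
   Left and right vertices are thus kept apart by the position in the pair, and the set \<Gamma>(S) of
   right neighbours of a set S of left vertices is the relational image E `` S. *)

definition adjacent_pairs :: "('a \<times> 'b) set \<Rightarrow> 'b set set \<Rightarrow> 'a set \<Rightarrow> 'b set set" where
  "adjacent_pairs E P U = {p \<in> P. \<exists>u\<in>U. \<exists>v\<in>p. (u, v) \<in> E}"

(* P is the given partition of the right vertices into pairs. *)
definition pair_expander ::
  "nat \<Rightarrow> real \<Rightarrow> real \<Rightarrow> nat set set \<Rightarrow> (nat \<times> nat) set \<Rightarrow> bool" where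
  "pair_expander N \<alpha> \<gamma> P E \<longleftrightarrow>
     (\<forall>U \<subseteq> {1..N}. int (card U) = \<lfloor>\<alpha> * real N\<rfloor> \<longrightarrow>
        \<lfloor>\<gamma> * real (card U)\<rfloor> \<le> int (card (adjacent_pairs E P U)))"

definition half_shift_pairs :: "nat \<Rightarrow> nat set set" where
  "half_shift_pairs N = (\<lambda>i. {i, i + N div 2}) ` {1..N div 2}"

definition C1 :: real where "C1 = 0.2301"
definition C3 :: real where "C3 = 0.3322"
definition C2 :: real where "C2 = 1 - C1 - C3"
definition C5 :: real where "C5 = 1 - C1 - C3"
definition C4 :: real where "C4 = 1 - C2"
definition C6 :: real where "C6 = 1 - C3"

definition line_through :: "real \<times> real \<Rightarrow> real \<times> real \<Rightarrow> real \<Rightarrow> real" where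
  "line_through p q x = snd p + (snd q - snd p) / (fst q - fst p) * (x - fst p)"

(* Only the values on [0, 1] are meaningful. *)
definition e :: "real \<Rightarrow> real" where
  "e x = (if x \<le> C1 then line_through (0, 0) (C1, C2) x
          else if x \<le> C3 then line_through (C1, C2) (C3, C4) x
          else if x \<le> C5 then line_through (C3, C4) (C5, C6) x
          else line_through (C5, C6) (1, 1) x)"

lemma e_breakpoints: "e 0 = 0" "e C1 = C2" "e C3 = C4" "e C5 = C6" "e 1 = 1"
  by (simp_all add: e_def line_through_def C1_def C2_def C3_def C4_def C5_def C6_def)

lemma e_range: "x \<in> {0..1} \<Longrightarrow> e x \<in> {0..1}"
  by (auto simp: e_def line_through_def C1_def C2_def C3_def C4_def C5_def C6_def field_simps)

end

theory Submission
  imports Defs "HOL-Combinatorics.Permutations" "HOL-Analysis.Analysis" "HOL-Real_Asymp.Real_Asymp"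
begin

text \<open>Put $N = 2n$ and let the graph be the configuration model of a 5-regular bipartite graph, that is a
  permutation \<open>p\<close> of $10n$ edge slots, together with the edges $(a_i, b_i)$ for \<open>i\<close> in the first
  32.5 per cent of the indices. Both properties hold for some \<open>p\<close> by counting the bad permutations.

  For (a), the union bound over \<open>S\<close> and a set covering its image is small: its exponential rate, as a
  function of $|S|/N$ along the graph of \<open>e\<close>, is convex on every linear piece, so that only the
  breakpoints need numerical estimates, and the two ends of the range are summed by a geometric series.

  For (b), the same bound fails near \<open>C3\<close>. Instead take the smallest number \<open>m\<close> of pairs that confine
  more than \<open>m\<close> left vertices, that is, contain all their neighbours. Among the confining sets of \<open>m\<close>
  pairs choose an extremal one. Since exchanging one pair for another brings no gain, every pair inside
  receives at least \<open>c\<close> edges of confined vertices, and all but at most eleven pairs outside receive fewer than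
  \<open>c\<close> edges that are the only edge of their left vertex leaving the set, where \<open>c\<close> is 2 or 3 on either
  side of an index threshold, or \<open>c\<close> is 3 inside and there is no condition outside. The permutations
  with such a set are counted by generating functions with explicit numerical weights.\<close>

section \<open>Counting subsets and permutations\<close>

text \<open>The rate of the plain union bound for (b), \<open>crowd_exponent\<close>, is still
  negative at 0.305 but positive at \<open>C3\<close>: it counts every violating pair set, and one
  such set can often be turned into many others by exchanging pairs. Counting only extremal sets
  removes this multiplicity. Extremality is a condition on the load of each single pair, so it
  multiplies the count by one tail of a binomial distribution with 10 trials per pair; this gains
  the missing exponential factor. The number eleven is the largest number of edges at a pair: ten
  slots and at most one additional edge. The additional edges decide (a): for the 5-regular part
  alone the rate would be positive at (C1,C2), (C3,C4) and (C5,C6). All constrained counts are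
  bounded by generating functions at fixed positive weights. Every choice of weights gives a valid
  bound, so the optimality of the chosen rationals never has to be proved.\<close>

lemma sum_Pow_Un_disjoint:
  fixes f g :: "'a set \<Rightarrow> 'b::comm_semiring_0"
  assumes "A \<inter> B = {}"
  shows "(\<Sum>S\<in>Pow (A \<union> B). f (S \<inter> A) * g (S \<inter> B)) = (\<Sum>S\<in>Pow A. f S) * (\<Sum>S\<in>Pow B. g S)"
proof -
  have "(\<Sum>S\<in>Pow A. f S) * (\<Sum>S\<in>Pow B. g S) = (\<Sum>(S,T)\<in>Pow A \<times> Pow B. f S * g T)"
    by (simp add: sum_product sum.cartesian_product)
  also have "\<dots> = (\<Sum>S\<in>Pow (A \<union> B). f (S \<inter> A) * g (S \<inter> B))"
  proof (rule sum.reindex_bij_witness[where i = "\<lambda>S. (S \<inter> A, S \<inter> B)" and j = "\<lambda>(S,T). S \<union> T"])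
    fix a assume "a \<in> Pow A \<times> Pow B"
    then obtain S T where a: "a = (S,T)" "S \<subseteq> A" "T \<subseteq> B" by auto
    then have *: "(S \<union> T) \<inter> A = S" "(S \<union> T) \<inter> B = T" using assms by auto
    show "((case a of (S, T) \<Rightarrow> S \<union> T) \<inter> A, (case a of (S, T) \<Rightarrow> S \<union> T) \<inter> B) = a" using a * by simp
    show "(case a of (S, T) \<Rightarrow> S \<union> T) \<in> Pow (A \<union> B)" using a by auto
    show "f ((case a of (S, T) \<Rightarrow> S \<union> T) \<inter> A) * g ((case a of (S, T) \<Rightarrow> S \<union> T) \<inter> B) = (case a of (S, T) \<Rightarrow> f S * g T)"
      using a * by simp
  qed (use assms in auto)
  finally show ?thesis by simp
qed

lemma sum_Pow_blocks:
  fixes F :: "'i \<Rightarrow> 'a set \<Rightarrow> 'b::comm_semiring_1"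
  assumes "finite I" "disjoint_family_on B I"
  shows "(\<Sum>S\<in>Pow (\<Union>i\<in>I. B i). \<Prod>i\<in>I. F i (S \<inter> B i)) = (\<Prod>i\<in>I. \<Sum>S\<in>Pow (B i). F i S)"
  using assms
proof (induction I rule: finite_induct)
  case empty
  then show ?case by simp
next
  case (insert k I)
  let ?U = "\<Union>i\<in>I. B i"
  have d: "B k \<inter> ?U = {}"
    using insert.prems insert.hyps by (auto simp: disjoint_family_on_def)
  have "(\<Sum>S\<in>Pow (\<Union>i\<in>insert k I. B i). \<Prod>i\<in>insert k I. F i (S \<inter> B i))
      = (\<Sum>S\<in>Pow (B k \<union> ?U). F k (S \<inter> B k) * (\<Prod>i\<in>I. F i ((S \<inter> ?U) \<inter> B i)))"
  proof (rule sum.cong)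
    fix S
    have "S \<inter> ?U \<inter> B i = S \<inter> B i" if "i \<in> I" for i using that by auto
    then show "(\<Prod>i\<in>insert k I. F i (S \<inter> B i)) = F k (S \<inter> B k) * (\<Prod>i\<in>I. F i ((S \<inter> ?U) \<inter> B i))"
      using insert.hyps by simp
  qed simp
  also have "\<dots> = (\<Sum>S\<in>Pow (B k). F k S) * (\<Sum>S\<in>Pow ?U. \<Prod>i\<in>I. F i (S \<inter> B i))"
    by (rule sum_Pow_Un_disjoint[OF d])
  also have "(\<Sum>S\<in>Pow ?U. \<Prod>i\<in>I. F i (S \<inter> B i)) = (\<Prod>i\<in>I. \<Sum>S\<in>Pow (B i). F i S)"
    using insert.prems by (intro insert.IH) (auto simp: disjoint_family_on_def)
  finally show ?case using insert.hyps by simp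
qed

lemma sum_Pow_card:
  fixes f :: "nat \<Rightarrow> 'b::comm_semiring_1"
  assumes "finite A"
  shows "(\<Sum>S\<in>Pow A. f (card S)) = (\<Sum>j\<le>card A. of_nat (card A choose j) * f j)"
proof -
  have "(\<Sum>S\<in>Pow A. f (card S)) = (\<Sum>j\<le>card A. \<Sum>S | S \<in> Pow A \<and> card S = j. f (card S))"
    using assms by (intro sum.group[symmetric]) (auto intro: card_mono)
  also have "\<dots> = (\<Sum>j\<le>card A. of_nat (card A choose j) * f j)"
    using assms by (intro sum.cong) (auto simp: n_subsets)
  finally show ?thesis .
qed

text \<open>A weight that sees each block only through the number of chosen elements turns a sum
  over exponentially many sets into a product of one-block polynomials. The counts of slot
  configurations rest on this, with the fibers of vertices or of pairs as blocks.\<close>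

lemma sum_Pow_blocks_card:
  fixes F :: "'i \<Rightarrow> nat \<Rightarrow> 'b::comm_semiring_1"
  assumes "finite I" "disjoint_family_on B I" "\<And>i. i \<in> I \<Longrightarrow> finite (B i) \<and> card (B i) = k"
  shows "(\<Sum>S\<in>Pow (\<Union>i\<in>I. B i). \<Prod>i\<in>I. F i (card (S \<inter> B i))) = (\<Prod>i\<in>I. \<Sum>j\<le>k. of_nat (k choose j) * F i j)"
proof -
  have "(\<Sum>S\<in>Pow (\<Union>i\<in>I. B i). \<Prod>i\<in>I. F i (card (S \<inter> B i))) = (\<Prod>i\<in>I. \<Sum>S\<in>Pow (B i). F i (card S))"
    using sum_Pow_blocks[OF assms(1,2), of "\<lambda>i S. F i (card S)"] by simp
  also have "\<dots> = (\<Prod>i\<in>I. \<Sum>j\<le>k. of_nat (k choose j) * F i j)"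
    using assms(3) by (intro prod.cong) (auto simp: sum_Pow_card)
  finally show ?thesis .
qed

lemma sum_Pow_prod_if:
  fixes f g :: "'a \<Rightarrow> 'b::comm_semiring_1"
  assumes "finite A"
  shows "(\<Sum>P\<in>Pow A. \<Prod>i\<in>A. if i \<in> P then f i else g i) = (\<Prod>i\<in>A. f i + g i)"
  using assms
proof (induction A rule: finite_induct)
  case (insert a A)
  have inj: "inj_on (insert a) (Pow A)" using insert.hyps by (auto simp: inj_on_def)
  have "(\<Sum>P\<in>Pow (insert a A). \<Prod>i\<in>insert a A. if i \<in> P then f i else g i)
     = (\<Sum>P\<in>Pow A. \<Prod>i\<in>insert a A. if i \<in> P then f i else g i) + (\<Sum>P\<in>insert a ` Pow A. \<Prod>i\<in>insert a A. if i \<in> P then f i else g i)"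
    unfolding Pow_insert using insert.hyps by (intro sum.union_disjoint) auto
  also have "(\<Sum>P\<in>Pow A. \<Prod>i\<in>insert a A. if i \<in> P then f i else g i) = g a * (\<Sum>P\<in>Pow A. \<Prod>i\<in>A. if i \<in> P then f i else g i)"
    using insert.hyps unfolding sum_distrib_left by (intro sum.cong refl) auto
  also have "(\<Sum>P\<in>insert a ` Pow A. \<Prod>i\<in>insert a A. if i \<in> P then f i else g i) = f a * (\<Sum>P\<in>Pow A. \<Prod>i\<in>A. if i \<in> P then f i else g i)"
    using insert.hyps unfolding sum_distrib_left sum.reindex[OF inj]
    by (intro sum.cong refl) (auto simp: insert.hyps intro!: arg_cong[where f = "\<lambda>t. f a * t"] prod.cong)
  finally show ?case using insert by (simp add: algebra_simps)
qed simp

text \<open>Two permutations with the same colour pattern differ by a permutation that preserves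
  \<open>col\<close>. Composition with the inverse of one fixed solution \<open>p0\<close> therefore
  embeds the set into the product of the symmetric groups of the colour classes.\<close>

lemma card_permutes_colouring_le:
  assumes "finite X" "finite C" "\<And>x. x \<in> X \<Longrightarrow> col x \<in> C"
  shows "card {p. p permutes X \<and> (\<forall>x\<in>X. col' (p x) = col x)} \<le> (\<Prod>c\<in>C. fact (card {x\<in>X. col x = c}))"
proof (cases "{p. p permutes X \<and> (\<forall>x\<in>X. col' (p x) = col x)} = {}")
  case False
  then obtain p0 where p0: "p0 permutes X" "\<And>x. x \<in> X \<Longrightarrow> col' (p0 x) = col x" by auto
  let ?X = "\<lambda>c. {x\<in>X. col x = c}"
  let ?Q = "{r. r permutes X \<and> (\<forall>x\<in>X. col (r x) = col x)}"
  let ?\<Phi> = "\<lambda>r. restrict (\<lambda>c x. if x \<in> ?X c then r x else x) C"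
  have fin: "finite (Pi\<^sub>E C (\<lambda>c. {s. s permutes ?X c}))"
    using assms by (intro finite_PiE) (auto intro: finite_permutations)
  have finQ: "finite ?Q"
    by (rule finite_subset[OF _ finite_permutations[OF assms(1)]]) auto
  have "card {p. p permutes X \<and> (\<forall>x\<in>X. col' (p x) = col x)} \<le> card ?Q"
  proof (rule card_inj_on_le[where f = "\<lambda>p. inv p0 \<circ> p"])
    show "inj_on (\<lambda>p. inv p0 \<circ> p) {p. p permutes X \<and> (\<forall>x\<in>X. col' (p x) = col x)}"
    proof (rule inj_onI)
      fix p q assume "inv p0 \<circ> p = inv p0 \<circ> q"
      then have "p0 \<circ> (inv p0 \<circ> p) = p0 \<circ> (inv p0 \<circ> q)" by simp
      then show "p = q" using permutes_inv_o(1)[OF p0(1)] by (simp add: o_assoc)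
    qed
    show "(\<lambda>p. inv p0 \<circ> p) ` {p. p permutes X \<and> (\<forall>x\<in>X. col' (p x) = col x)} \<subseteq> ?Q"
    proof (clarify)
      fix p assume p: "p permutes X" "\<forall>x\<in>X. col' (p x) = col x"
      have "col ((inv p0 \<circ> p) x) = col x" if "x \<in> X" for x
      proof -
        have "(inv p0 \<circ> p) x \<in> X"
          using permutes_compose[OF p(1) permutes_inv[OF p0(1)]] that by (simp only: permutes_in_image)
        from p0(2)[OF this] have "col ((inv p0 \<circ> p) x) = col' (p0 ((inv p0 \<circ> p) x))" by simp
        also have "p0 ((inv p0 \<circ> p) x) = p x" using permutes_inverses(1)[OF p0(1)] by simp
        finally show ?thesis using p that by simp
      qed
      then show "inv p0 \<circ> p permutes X \<and> (\<forall>x\<in>X. col ((inv p0 \<circ> p) x) = col x)"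
        using permutes_compose[OF p(1) permutes_inv[OF p0(1)]] by blast
    qed
  qed (fact finQ)
  also have "card ?Q \<le> card (Pi\<^sub>E C (\<lambda>c. {s. s permutes ?X c}))"
  proof (rule card_inj_on_le[where f = ?\<Phi>])
    show "inj_on ?\<Phi> ?Q"
    proof (rule inj_onI)
      fix r s assume rs: "r \<in> ?Q" "s \<in> ?Q" "?\<Phi> r = ?\<Phi> s"
      show "r = s"
      proof
        fix x
        show "r x = s x"
        proof (cases "x \<in> X")
          case True
          then have "?\<Phi> r (col x) x = ?\<Phi> s (col x) x" using rs(3) by metis
          then show ?thesis using True assms(3) by simp
        next
          case False
          then show ?thesis using rs(1,2) by (simp add: permutes_def)
        qed
      qed
    qed
    show "?\<Phi> ` ?Q \<subseteq> Pi\<^sub>E C (\<lambda>c. {s. s permutes ?X c})"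
    proof (rule image_subsetI)
      fix r assume r: "r \<in> ?Q"
      have "(\<lambda>x. if x \<in> ?X c then r x else x) permutes ?X c" for c
      proof (rule bij_imp_permutes)
        have inj: "inj_on (\<lambda>x. if x \<in> ?X c then r x else x) (?X c)"
          using r by (auto simp: inj_on_def dest: permutes_inj injD)
        have "(\<lambda>x. if x \<in> ?X c then r x else x) ` ?X c \<subseteq> ?X c"
          using r by (auto simp: permutes_in_image)
        then have "(\<lambda>x. if x \<in> ?X c then r x else x) ` ?X c = ?X c"
          using assms(1) inj by (intro endo_inj_surj) auto
        then show "bij_betw (\<lambda>x. if x \<in> ?X c then r x else x) (?X c) (?X c)"
          using inj by (simp add: bij_betw_def)
      qed auto
      then show "?\<Phi> r \<in> Pi\<^sub>E C (\<lambda>c. {s. s permutes ?X c})" by simp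
    qed
  qed (fact fin)
  also have "\<dots> = (\<Prod>c\<in>C. fact (card (?X c)))"
    using assms by (simp add: card_PiE card_permutations[OF refl])
  finally show ?thesis .
next
  case True
  show ?thesis unfolding True by simp
qed

section \<open>Estimates for binomial coefficients\<close>

lemma binomial_le_genfun:
  fixes t :: real
  assumes "t > 0"
  shows "real (n choose k) \<le> (1 + t) ^ n / t ^ k"
proof (cases "k \<le> n")
  case True
  have "real (n choose k) * t ^ k \<le> (\<Sum>j\<le>n. real (n choose j) * t ^ j)"
    using True assms by (intro member_le_sum) auto
  also have "\<dots> = (1 + t) ^ n" using binomial_ring[of t 1 n] by (simp add: add.commute)
  finally show ?thesis using assms by (simp add: field_simps)
next
  case False
  then show ?thesis using assms by (simp add: binomial_eq_0)
qed

text \<open>The binomial distribution with \<open>n\<close> trials and success probability \<open>k/n\<close> has its mode at \<open>k\<close>.\<close>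

lemma binomial_mode:
  assumes "k \<le> n" "n > 0"
  shows "1 \<le> (real n + 1) * (real (n choose k) * (real k / n) ^ k * (1 - real k / n) ^ (n - k))"
proof -
  define q where "q = real k / n"
  define T where "T j = real (n choose j) * q ^ j * (1 - q) ^ (n - j)" for j
  have q: "0 \<le> q" "q \<le> 1" using assms by (auto simp: q_def)
  have Tnn: "T j \<ge> 0" for j using q by (simp add: T_def)
  have rec: "real (Suc j) * (1 - q) * T (Suc j) = real (n - j) * q * T j" if "j < n" for j
  proof -
    have "real (Suc j) * real (n choose Suc j) = real (n - j) * real (n choose j)"
      using binomial_absorb_comp[of n j] Suc_times_binomial[of j "n - 1"] that
      by (metis of_nat_mult binomial_absorption diff_Suc_1 mult.commute binomial_absorb_comp)
    moreover have "(1 - q) ^ (n - j) = (1 - q) * (1 - q) ^ (n - Suc j)"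
      using that by (metis Suc_diff_Suc power_Suc)
    ultimately show ?thesis unfolding T_def by (simp add: mult_ac)
  qed
  have up: "T j \<le> T (Suc j)" if "j < k" for j
  proof (cases "q = 1")
    case True
    then show ?thesis using that assms by (auto simp: T_def q_def power_0_left)
  next
    case False
    then have q1: "1 - q > 0" using q by simp
    have jn: "j < n" using that assms by simp
    have "real (Suc j) * (1 - q) \<le> real (n - j) * q"
    proof -
      have "real (Suc j) * (real n - real k) \<le> (real n - real j) * real k"
      proof -
        have "real (Suc j) \<le> real k" using that by simp
        then have "real (Suc j) * real n \<le> real k * real n" by (intro mult_right_mono) auto
        moreover have "real (Suc j) * real k \<ge> real j * real k" by (intro mult_right_mono) auto
        ultimately show ?thesis by (simp add: algebra_simps)
      qed
      then have "real (Suc j) * (real n - real k) / n \<le> (real n - real j) * real k / n"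
        by (intro divide_right_mono) auto
      moreover have "real (Suc j) * (1 - q) = real (Suc j) * (real n - real k) / n"
        using assms(2) by (simp add: q_def field_simps)
      moreover have "real (n - j) * q = (real n - real j) * real k / n"
        using jn by (simp add: q_def of_nat_diff)
      ultimately show ?thesis by simp
    qed
    then have "real (Suc j) * (1 - q) * T j \<le> real (n - j) * q * T j"
      by (intro mult_right_mono Tnn)
    also have "\<dots> = real (Suc j) * (1 - q) * T (Suc j)" using rec[OF jn] by simp
    finally show ?thesis using q1 by (simp add: mult_le_cancel_left)
  qed
  have down: "T (Suc j) \<le> T j" if "k \<le> j" "j < n" for j
  proof -
    have q1: "1 - q > 0" using that assms by (simp add: q_def)
    have "real (n - j) * q \<le> real (Suc j) * (1 - q)"
    proof -
      have "(real n - real j) * real k \<le> real (Suc j) * (real n - real k)"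
      proof -
        have "real k * real n \<le> real j * real n" using that by (intro mult_right_mono) auto
        moreover have "real k \<le> real n" using assms by simp
        ultimately show ?thesis by (simp add: algebra_simps)
      qed
      then show ?thesis using assms that by (simp add: q_def field_simps of_nat_diff)
    qed
    then have "real (n - j) * q * T j \<le> real (Suc j) * (1 - q) * T j"
      by (intro mult_right_mono Tnn)
    then have "real (Suc j) * (1 - q) * T (Suc j) \<le> real (Suc j) * (1 - q) * T j"
      using rec[OF that(2)] by simp
    then show ?thesis using q1 by (simp add: mult_le_cancel_left)
  qed
  have le_k: "T j \<le> T k" if "j \<le> n" for j
  proof (cases "j \<le> k")
    case True
    then show ?thesis
    proof (induction rule: inc_induct)
      case (step i)
      then show ?case using up[of i] by simp
    qed simp
  next
    case False
    then have "k \<le> j" by simp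
    then show ?thesis using that
    proof (induction j rule: dec_induct)
      case (step i)
      then show ?case using down[of i] by simp
    qed simp
  qed
  have "1 = (q + (1 - q)) ^ n" by simp
  also have "\<dots> = (\<Sum>j\<le>n. T j)" unfolding T_def by (rule binomial_ring)
  also have "\<dots> \<le> (\<Sum>j\<le>n. T k)" using le_k by (intro sum_mono) auto
  also have "\<dots> = (real n + 1) * T k" by simp
  finally show ?thesis by (simp add: T_def q_def)
qed

text \<open>The quotient of the two coefficients is the product of the factors (a - i) / (b - i) for
  i < k, each of which is at most a / b.\<close>

lemma binomial_ratio_le_power:
  assumes "a \<le> b" "k \<le> b" "b > 0"
  shows "real (a choose k) \<le> (real a / real b) ^ k * real (b choose k)"
  using assms(2)
proof (induction k)
  case (Suc k)
  show ?case
  proof (cases "Suc k \<le> a")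
    case False
    then show ?thesis by (simp add: binomial_eq_0)
  next
    case True
    have ra: "real (Suc k) * real (a choose Suc k) = real (a - k) * real (a choose k)" for a
      by (metis of_nat_mult binomial_absorption binomial_absorb_comp)
    have "real (Suc k) * real (a choose Suc k) = real (a - k) * real (a choose k)" by (rule ra)
    also have "\<dots> \<le> (real a / real b * real (b - k)) * ((real a / real b) ^ k * real (b choose k))"
    proof (intro mult_mono)
      have "real a * real k \<le> real b * real k" using assms(1) by (intro mult_right_mono) auto
      then show "real (a - k) \<le> real a / real b * real (b - k)"
        using True Suc.prems assms by (simp add: field_simps of_nat_diff)
      show "real (a choose k) \<le> (real a / real b) ^ k * real (b choose k)" using Suc by simp
    qed auto
    also have "\<dots> = (real a / real b) ^ Suc k * (real (b - k) * real (b choose k))" by simp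
    also have "\<dots> = (real a / real b) ^ Suc k * (real (Suc k) * real (b choose Suc k))" by (simp only: ra)
    finally have "real (Suc k) * real (a choose Suc k) \<le> real (Suc k) * ((real a / real b) ^ Suc k * real (b choose Suc k))"
      by (simp only: mult_ac)
    then show ?thesis by (simp only: mult_le_cancel_left_pos of_nat_0_less_iff zero_less_Suc)
  qed
qed simp

section \<open>Slots and tight configurations\<close>

text \<open>Residues let one slot set \<open>{..<10 * n}\<close> carry every partition at once:
  \<open>fiber 5 (2 * n)\<close> gives the vertices and \<open>fiber 10 n\<close> the pairs, because
  \<open>i\<close> and \<open>i + n\<close> agree modulo \<open>n\<close>.\<close>

definition fiber :: "nat \<Rightarrow> nat \<Rightarrow> nat \<Rightarrow> nat set" where
  "fiber k m i = {s. s < k * m \<and> s mod m = i}"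

lemma finite_fiber [simp]: "finite (fiber k m i)"
  by (rule finite_subset[of _ "{..<k * m}"]) (auto simp: fiber_def)

lemma card_fiber [simp]:
  assumes "i < m"
  shows "card (fiber k m i) = k"
proof -
  have "bij_betw (\<lambda>j. i + j * m) {..<k} (fiber k m i)"
  proof (rule bij_betwI[where g = "\<lambda>s. s div m"])
    show "(\<lambda>j. i + j * m) \<in> {..<k} \<rightarrow> fiber k m i"
    proof
      fix j assume "j \<in> {..<k}"
      then have "Suc j * m \<le> k * m" by (intro mult_right_mono) auto
      then show "i + j * m \<in> fiber k m i" using assms by (simp add: fiber_def)
    qed
    show "(\<lambda>s. s div m) \<in> fiber k m i \<rightarrow> {..<k}"
      using assms by (auto simp: fiber_def less_mult_imp_div_less)
  qed (use assms in \<open>auto simp: fiber_def mult.commute\<close>)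
  then show ?thesis using bij_betw_same_card by fastforce
qed

lemma disjoint_fiber: "disjoint_family_on (fiber k m) I"
  by (auto simp: disjoint_family_on_def fiber_def)

lemma UN_fiber: "m > 0 \<Longrightarrow> (\<Union>i\<in>{..<m}. fiber k m i) = {..<k * m}"
  by (auto simp: fiber_def)

lemma card_UN_fiber:
  assumes "A \<subseteq> {..<m}"
  shows "card (\<Union>i\<in>A. fiber k m i) = k * card A"
proof -
  have fin: "finite A" using assms finite_subset by auto
  have "card (\<Union>i\<in>A. fiber k m i) = (\<Sum>i\<in>A. card (fiber k m i))"
    using fin by (intro card_UN_disjoint) (auto simp: fiber_def)
  also have "\<dots> = (\<Sum>i\<in>A. k)" using assms by (intro sum.cong) auto
  finally show ?thesis by simp
qed

lemma slots_over_eq: "A \<subseteq> {..<m} \<Longrightarrow> {s. s < k * m \<and> s mod m \<in> A} = (\<Union>i\<in>A. fiber k m i)"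
  by (auto simp: fiber_def)

lemma card_slots_over:
  assumes "A \<subseteq> {..<m}"
  shows "card {s. s < k * m \<and> s mod m \<in> A} = k * card A"
  using card_UN_fiber[OF assms, of k] slots_over_eq[OF assms, of k] by simp

lemma card_Int_fibers:
  assumes "S \<subseteq> {..<k * m}" "A \<subseteq> {..<m}"
  shows "card {s\<in>S. s mod m \<in> A} = (\<Sum>i\<in>A. card (S \<inter> fiber k m i))"
proof -
  have fin: "finite A" using assms finite_subset by auto
  have "{s\<in>S. s mod m \<in> A} = (\<Union>i\<in>A. S \<inter> fiber k m i)" using assms by (auto simp: fiber_def)
  also have "card \<dots> = (\<Sum>i\<in>A. card (S \<inter> fiber k m i))"
    using fin by (intro card_UN_disjoint) (auto simp: fiber_def)
  finally show ?thesis .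
qed

text \<open>Slot \<open>s\<close> belongs to the left vertex \<open>s mod (2 * n)\<close> and is matched to slot \<open>p s\<close>, which belongs to the
  right vertex \<open>p s mod (2 * n)\<close> and to the pair \<open>p s mod n\<close>.
  A slot set \<open>Z\<close> stands for the slots of the left vertices that are matched to slots of the pairs
  in \<open>P\<close>. The left vertex \<open>i < K\<close> has one additional edge, to the pair \<open>i\<close>.\<close>

definition closed_by :: "nat \<Rightarrow> nat \<Rightarrow> nat set \<Rightarrow> nat set \<Rightarrow> nat set" where
  "closed_by n K P Z = {i. i < 2 * n \<and> fiber 5 (2 * n) i \<subseteq> Z \<and> (i < K \<longrightarrow> i \<in> P)}"

text \<open>A slot is critical if it is the only slot of its left vertex that is not in \<open>Z\<close>.\<close>

definition critical_slots :: "nat \<Rightarrow> nat \<Rightarrow> nat set \<Rightarrow> nat set \<Rightarrow> nat set" where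
  "critical_slots n K P Z = {s. s < 10 * n \<and> s \<notin> Z \<and> card (Z \<inter> fiber 5 (2 * n) (s mod (2 * n))) = 4
      \<and> (s mod (2 * n) < K \<longrightarrow> s mod (2 * n) \<in> P)}"

definition marked :: "nat \<Rightarrow> nat \<Rightarrow> nat set \<Rightarrow> nat set \<Rightarrow> nat set" where
  "marked n K P Z = {s. s < 10 * n \<and> s mod (2 * n) \<in> closed_by n K P Z} \<union> critical_slots n K P Z"

definition matched_to :: "nat \<Rightarrow> nat set \<Rightarrow> (nat \<Rightarrow> nat) \<Rightarrow> nat set" where
  "matched_to n P p = {s. s < 10 * n \<and> p s mod n \<in> P}"

text \<open>The pairs in \<open>P\<close> absorb at least \<open>cP\<close> edges of confined vertices, and all but at most eleven other pairs
  fewer than \<open>cQ\<close> critical edges; \<open>B\<close> restricts the density of the critical edges outside \<open>P\<close>.\<close>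

definition tight :: "nat \<Rightarrow> nat \<Rightarrow> (nat \<Rightarrow> nat) \<Rightarrow> (nat \<Rightarrow> nat) \<Rightarrow> nat \<Rightarrow> real set \<Rightarrow> nat set \<Rightarrow> (nat \<Rightarrow> nat) \<Rightarrow> bool" where
  "tight n K cP cQ u B P p \<longleftrightarrow>
     (let Z = matched_to n P p; S = p ` marked n K P Z in
        card (closed_by n K P Z) = u \<and>
        (\<forall>i\<in>P. cP i \<le> card (S \<inter> fiber 10 n i) + (if i < K \<and> i \<in> closed_by n K P Z then 1 else 0)) \<and>
        card {i. i < n \<and> i \<notin> P \<and> cQ i \<le> card (S \<inter> fiber 10 n i)} \<le> 11 \<and>
        real (card (critical_slots n K P Z)) / (10 * (real n - card P)) \<in> B)"

text \<open>The possible images of the marked slots under a permutation for which \<open>P\<close>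
  is tight, with the permutation itself forgotten. \<open>U\<close> is the set of confined vertices,
  \<open>a\<close> counts the edges that end inside \<open>P\<close> and \<open>d\<close> the
  critical ones, which end outside.\<close>

definition right_configs :: "nat \<Rightarrow> nat \<Rightarrow> (nat \<Rightarrow> nat) \<Rightarrow> (nat \<Rightarrow> nat) \<Rightarrow> nat set \<Rightarrow> nat set \<Rightarrow> nat \<Rightarrow> nat \<Rightarrow> nat set set" where
  "right_configs n K cP cQ P U a d = {S. S \<subseteq> {..<10 * n} \<and> card {t\<in>S. t mod n \<in> P} = a \<and> card {t\<in>S. t mod n \<notin> P} = d
      \<and> (\<forall>i\<in>P. cP i \<le> card (S \<inter> fiber 10 n i) + (if i < K \<and> i \<in> U then 1 else 0))
      \<and> card {i. i < n \<and> i \<notin> P \<and> cQ i \<le> card (S \<inter> fiber 10 n i)} \<le> 11}"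

text \<open>The probability that a binomial variable with 10 trials and success probability
  \<open>q\<close> is at least \<open>c\<close>.\<close>

definition upper_tail :: "real \<Rightarrow> nat \<Rightarrow> real" where
  "upper_tail q c = (\<Sum>j\<le>10. real (10 choose j) * (if c \<le> j then q ^ j * (1 - q) ^ (10 - j) else 0))"

text \<open>A generating function for the number of critical edges at one outside pair; for
  \<open>eps = 0\<close> and \<open>b = 1 - a\<close> it is the probability of fewer than
  \<open>c\<close> successes in 10 trials. A positive \<open>eps\<close> leaves room for the
  exceptional pairs: eleven of them cost only the constant factor \<open>eps ^ 11\<close>.\<close>

definition lower_tail :: "real \<Rightarrow> real \<Rightarrow> real \<Rightarrow> nat \<Rightarrow> real" where
  "lower_tail eps a b c = (\<Sum>j\<le>10. real (10 choose j) * ((if c \<le> j then eps else 1) * a ^ j * b ^ (10 - j)))"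

lemma upper_tail_nonneg: "0 \<le> q \<Longrightarrow> q \<le> 1 \<Longrightarrow> upper_tail q c \<ge> 0"
  unfolding upper_tail_def by (intro sum_nonneg) auto

lemma lower_tail_nonneg: "0 \<le> a \<Longrightarrow> 0 \<le> b \<Longrightarrow> 0 \<le> eps \<Longrightarrow> lower_tail eps a b c \<ge> 0"
  unfolding lower_tail_def by (intro sum_nonneg) auto

text \<open>Every configuration has product weight at least the bracket on the left, and the total
  weight of all slot sets factors over the pairs into the right side.\<close>

lemma card_right_configs:
  fixes q eps a b :: real
  assumes n: "n > 0" and P: "P \<subseteq> {..<n}" and q: "0 \<le> q" "q \<le> 1" and eps: "0 < eps" "eps \<le> 1" and ab: "0 \<le> a" "0 \<le> b"
    and k: "k \<le> 10 * card P" and d: "d \<le> 10 * (n - card P)"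
  shows "card (right_configs n K cP cQ P U k d) * (q ^ k * (1 - q) ^ (10 * card P - k) * eps ^ 11 * a ^ d * b ^ (10 * (n - card P) - d))
     \<le> (\<Prod>i\<in>P. upper_tail q (cP i - (if i < K \<and> i \<in> U then 1 else 0))) * (\<Prod>i\<in>{..<n} - P. lower_tail eps a b (cQ i))"
proof -
  let ?R = "right_configs n K cP cQ P U k d"
  \<comment> \<open>The additional edge of a confined vertex \<open>i\<close> counts towards the
    load of pair \<open>i\<close>, so only the remaining demand must be met by slots.\<close>
  let ?c = "\<lambda>i. cP i - (if i < K \<and> i \<in> U then 1 else 0)"
  \<comment> \<open>Inside \<open>P\<close> the weight 0 enforces the demanded load; outside, a load
    of \<open>cQ i\<close> or more is merely penalised, as it may occur at up to eleven
    pairs.\<close>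
  define F where "F i j = (if i \<in> P then (if ?c i \<le> j then q ^ j * (1 - q) ^ (10 - j) else 0)
       else (if cQ i \<le> j then eps else 1) * a ^ j * b ^ (10 - j))" for i j
  have Fnn: "F i j \<ge> 0" for i j using q eps ab by (auto simp: F_def)
  have finP: "finite P" using P finite_subset by auto
  have each: "q ^ k * (1 - q) ^ (10 * card P - k) * eps ^ 11 * a ^ d * b ^ (10 * (n - card P) - d)
      \<le> (\<Prod>i\<in>{..<n}. F i (card (S \<inter> fiber 10 n i)))" if "S \<in> ?R" for S
  proof -
    let ?j = "\<lambda>i. card (S \<inter> fiber 10 n i)"
    have S: "S \<subseteq> {..<10 * n}" using that by (simp add: right_configs_def)
    have j10: "?j i \<le> 10" if "i < n" for i
      using card_mono[OF finite_fiber, of "S \<inter> fiber 10 n i" 10 n i] that by simp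
    have sk: "(\<Sum>i\<in>P. ?j i) = k"
      using card_Int_fibers[OF S P] that by (simp add: right_configs_def)
    have "{t\<in>S. t mod n \<notin> P} = {t\<in>S. t mod n \<in> {..<n} - P}" using n by auto
    then have sd: "(\<Sum>i\<in>{..<n} - P. ?j i) = d"
      using card_Int_fibers[OF S, of "{..<n} - P"] that by (simp add: right_configs_def)
    have cardQ: "card ({..<n} - P) = n - card P" using P finP by (simp add: card_Diff_subset)
    have sk': "(\<Sum>i\<in>P. 10 - ?j i) = 10 * card P - k"
      using sk j10 P by (subst sum_subtractf_nat) (auto)
    have sd': "(\<Sum>i\<in>{..<n} - P. 10 - ?j i) = 10 * (n - card P) - d"
      using sd j10 P cardQ by (subst sum_subtractf_nat) (auto)
    have "(\<Prod>i\<in>P. F i (?j i)) = (\<Prod>i\<in>P. q ^ ?j i * (1 - q) ^ (10 - ?j i))"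
      using that by (intro prod.cong) (auto simp: F_def right_configs_def)
    also have "\<dots> = q ^ k * (1 - q) ^ (10 * card P - k)"
      by (simp add: prod.distrib power_sum[symmetric] sk sk')
    finally have p1: "(\<Prod>i\<in>P. F i (?j i)) = q ^ k * (1 - q) ^ (10 * card P - k)" .
    let ?V = "{i. i < n \<and> i \<notin> P \<and> cQ i \<le> ?j i}"
    have ite: "(\<Prod>i\<in>{..<n} - P. (if i \<in> ?V then eps else 1)) = eps ^ card ?V"
    proof -
      have "({..<n} - P) \<inter> {i. i \<in> ?V} = ?V" by auto
      then show ?thesis by (simp only: prod.If_cases finite_Diff finite_lessThan prod_constant power_one mult_1_right)
    qed
    have "(\<Prod>i\<in>{..<n} - P. F i (?j i)) = (\<Prod>i\<in>{..<n} - P. (if i \<in> ?V then eps else 1) * (a ^ ?j i * b ^ (10 - ?j i)))"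
      by (intro prod.cong) (auto simp: F_def)
    then have p2: "(\<Prod>i\<in>{..<n} - P. F i (?j i)) = eps ^ card ?V * (a ^ d * b ^ (10 * (n - card P) - d))"
      by (simp only: prod.distrib power_sum[symmetric] sd sd' ite)
    have "eps ^ 11 \<le> eps ^ card ?V"
      using that eps by (intro power_decreasing) (auto simp: right_configs_def)
    then have "eps ^ 11 * (a ^ d * b ^ (10 * (n - card P) - d)) \<le> (\<Prod>i\<in>{..<n} - P. F i (?j i))"
      unfolding p2 using ab by (intro mult_right_mono) auto
    then have "(q ^ k * (1 - q) ^ (10 * card P - k)) * (eps ^ 11 * (a ^ d * b ^ (10 * (n - card P) - d)))
       \<le> (\<Prod>i\<in>P. F i (?j i)) * (\<Prod>i\<in>{..<n} - P. F i (?j i))"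
      unfolding p1 using q by (intro mult_left_mono) auto
    also have "\<dots> = (\<Prod>i\<in>{..<n}. F i (?j i))"
      using prod.subset_diff[of P "{..<n}" "\<lambda>i. F i (?j i)"] P by (simp add: mult.commute)
    finally show ?thesis by (simp add: mult_ac)
  qed
  have "card ?R * (q ^ k * (1 - q) ^ (10 * card P - k) * eps ^ 11 * a ^ d * b ^ (10 * (n - card P) - d))
     \<le> (\<Sum>S\<in>?R. \<Prod>i\<in>{..<n}. F i (card (S \<inter> fiber 10 n i)))"
    using sum_mono[OF each] by simp
  also have "\<dots> \<le> (\<Sum>S\<in>Pow {..<10 * n}. \<Prod>i\<in>{..<n}. F i (card (S \<inter> fiber 10 n i)))"
    by (intro sum_mono2) (auto simp: right_configs_def intro!: prod_nonneg Fnn)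
  also have "\<dots> = (\<Prod>i\<in>{..<n}. \<Sum>j\<le>10. of_nat (10 choose j) * F i j)"
    using sum_Pow_blocks_card[of "{..<n}" "fiber 10 n" 10 F] disjoint_fiber UN_fiber[OF n, of 10] by simp
  also have "\<dots> = (\<Prod>i\<in>P. \<Sum>j\<le>10. of_nat (10 choose j) * F i j) * (\<Prod>i\<in>{..<n} - P. \<Sum>j\<le>10. of_nat (10 choose j) * F i j)"
    using prod.subset_diff[of P "{..<n}"] P by (simp add: mult.commute)
  also have "(\<Prod>i\<in>P. \<Sum>j\<le>10. of_nat (10 choose j) * F i j) = (\<Prod>i\<in>P. upper_tail q (?c i))"
    by (intro prod.cong refl) (auto simp: F_def upper_tail_def intro!: sum.cong)
  also have "(\<Prod>i\<in>{..<n} - P. \<Sum>j\<le>10. of_nat (10 choose j) * F i j) = (\<Prod>i\<in>{..<n} - P. lower_tail eps a b (cQ i))"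
    by (intro prod.cong refl) (auto simp: F_def lower_tail_def intro!: sum.cong)
  finally show ?thesis .
qed

text \<open>Here \<open>j\<close> counts the slots of a left vertex that are matched into \<open>P\<close>: the value 5 stands for a
  confined and the value 4 for a critical left vertex.\<close>

definition left_weight :: "real \<Rightarrow> real \<Rightarrow> real \<Rightarrow> nat \<Rightarrow> real" where
  "left_weight z th Y j = (if j = 5 then Y * z ^ 5 else if j = 4 then th * z ^ 4 else z ^ j)"

abbreviation left_total :: "real \<Rightarrow> real \<Rightarrow> real \<Rightarrow> real" where
  "left_total z th Y \<equiv> \<Sum>j\<le>5. real (5 choose j) * left_weight z th Y j"

lemma critical_slots_card:
  assumes n: "n > 0" and Z: "Z \<subseteq> {..<10 * n}"
  shows "card (critical_slots n K P Z) = card {i. i < 2 * n \<and> card (Z \<inter> fiber 5 (2 * n) i) = 4 \<and> (i < K \<longrightarrow> i \<in> P)}"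
proof -
  let ?D = "critical_slots n K P Z"
  let ?A = "{i. i < 2 * n \<and> card (Z \<inter> fiber 5 (2 * n) i) = 4 \<and> (i < K \<longrightarrow> i \<in> P)}"
  have D: "?D = (\<Union>i\<in>?A. fiber 5 (2 * n) i - Z)"
    using n by (auto simp: critical_slots_def fiber_def)
  have "card ?D = (\<Sum>i\<in>?A. card (fiber 5 (2 * n) i - Z))"
    unfolding D by (intro card_UN_disjoint) (auto simp: fiber_def)
  also have "\<dots> = (\<Sum>i\<in>?A. 1)"
  proof (intro sum.cong refl)
    fix i assume i: "i \<in> ?A"
    have "card (fiber 5 (2 * n) i - Z) = card (fiber 5 (2 * n) i) - card (fiber 5 (2 * n) i \<inter> Z)"
      by (rule card_Diff_subset_Int) simp
    then show "card (fiber 5 (2 * n) i - Z) = 1" using i by (simp add: Int_commute)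
  qed
  finally show ?thesis by simp
qed

text \<open>The variable \<open>z\<close> marks the slots in \<open>Z\<close>, \<open>y\<close> the
  confined vertices, \<open>th\<close> the critical ones, and \<open>om\<close> the confined
  vertices that have an additional edge. A vertex below \<open>K\<close> whose own pair is outside
  \<open>P\<close> can be neither confined nor critical, so it contributes just
  \<open>(1 + z) ^ 5\<close>.\<close>

lemma sum_left_configs:
  fixes y z th om :: real
  assumes n: "n > 0" and K: "K \<le> n" and P: "P \<subseteq> {..<n}" and pos: "y > 0" "z > 0" "th > 0" "om > 0"
  shows "(\<Sum>Z | Z \<subseteq> {..<10 * n} \<and> card Z = 10 * m \<and> card (closed_by n K P Z) = u.
            th ^ card (critical_slots n K P Z) * om ^ card {i\<in>P. i < K \<and> i \<in> closed_by n K P Z}) * (z ^ (10 * m) * y ^ u)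
     \<le> (\<Prod>i<K. if i \<in> P then left_total z th (y * om) else (1 + z) ^ 5)
       * left_total z th y ^ (2 * n - K)"
proof -
  let ?Zs = "{Z. Z \<subseteq> {..<10 * n} \<and> card Z = 10 * m \<and> card (closed_by n K P Z) = u}"
  let ?w = "\<lambda>Z. th ^ card (critical_slots n K P Z) * om ^ card {i\<in>P. i < K \<and> i \<in> closed_by n K P Z}"
  define F where "F i j = (if i < K then (if i \<in> P then left_weight z th (y * om) j else z ^ j) else left_weight z th y j)" for i j
  have Fnn: "F i j \<ge> 0" for i j using pos by (auto simp: F_def left_weight_def)
  have each: "?w Z * (z ^ (10 * m) * y ^ u) = (\<Prod>i\<in>{..<2 * n}. F i (card (Z \<inter> fiber 5 (2 * n) i)))" if "Z \<in> ?Zs" for Z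
  proof -
    let ?j = "\<lambda>i. card (Z \<inter> fiber 5 (2 * n) i)"
    let ?C = "closed_by n K P Z" and ?D = "{i. i < 2 * n \<and> ?j i = 4 \<and> (i < K \<longrightarrow> i \<in> P)}"
    let ?O = "{i\<in>P. i < K \<and> i \<in> ?C}"
    have Z: "Z \<subseteq> {..<5 * (2 * n)}" using that by auto
    have full: "fiber 5 (2 * n) i \<subseteq> Z \<longleftrightarrow> ?j i = 5" if "i < 2 * n" for i
    proof
      assume "?j i = 5"
      then have "Z \<inter> fiber 5 (2 * n) i = fiber 5 (2 * n) i"
        using that by (intro card_subset_eq) auto
      then show "fiber 5 (2 * n) i \<subseteq> Z" by auto
    qed (use that in \<open>simp add: Int_absorb1\<close>)
    have Ceq: "?C = {i. i < 2 * n \<and> ?j i = 5 \<and> (i < K \<longrightarrow> i \<in> P)}"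
      unfolding closed_by_def using full by blast
    have "{t\<in>Z. t mod (2 * n) \<in> {..<2 * n}} = Z" using n by auto
    then have sj: "(\<Sum>i\<in>{..<2 * n}. ?j i) = 10 * m"
      using card_Int_fibers[OF Z, of "{..<2 * n}"] that by simp
    have ite: "(\<Prod>i\<in>{..<2 * n}. if i \<in> A then c else 1) = c ^ card A" if "A \<subseteq> {..<2 * n}" for A and c :: real
    proof -
      have "{..<2 * n} \<inter> {i. i \<in> A} = A" using that by auto
      then show ?thesis by (simp add: prod.If_cases)
    qed
    have sub: "?C \<subseteq> {..<2 * n}" "?D \<subseteq> {..<2 * n}" "?O \<subseteq> {..<2 * n}" using Ceq P K by auto
    have "F i (?j i) = (if i \<in> ?D then th else 1) * (if i \<in> ?O then om else 1) * (if i \<in> ?C then y else 1) * z ^ ?j i"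
      if "i < 2 * n" for i
      using that by (auto simp: F_def left_weight_def Ceq)
    then have "(\<Prod>i\<in>{..<2 * n}. F i (?j i)) = (\<Prod>i\<in>{..<2 * n}. (if i \<in> ?D then th else 1) * (if i \<in> ?O then om else 1) * (if i \<in> ?C then y else 1) * z ^ ?j i)"
      by (intro prod.cong) auto
    also have "\<dots> = th ^ card ?D * om ^ card ?O * y ^ card ?C * z ^ (10 * m)"
      by (simp only: prod.distrib ite[OF sub(1)] ite[OF sub(2)] ite[OF sub(3)] power_sum[symmetric] sj)
    also have "card ?D = card (critical_slots n K P Z)" using critical_slots_card[OF n] Z by simp
    also have "card ?C = u" using that by simp
    finally show ?thesis by (simp add: mult_ac)
  qed
  have "(\<Sum>Z\<in>?Zs. ?w Z) * (z ^ (10 * m) * y ^ u) = (\<Sum>Z\<in>?Zs. \<Prod>i\<in>{..<2 * n}. F i (card (Z \<inter> fiber 5 (2 * n) i)))"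
    unfolding sum_distrib_right using each by (intro sum.cong) auto
  also have "\<dots> \<le> (\<Sum>Z\<in>Pow {..<5 * (2 * n)}. \<Prod>i\<in>{..<2 * n}. F i (card (Z \<inter> fiber 5 (2 * n) i)))"
    by (intro sum_mono2) (auto intro!: prod_nonneg Fnn)
  also have "\<dots> = (\<Prod>i\<in>{..<2 * n}. \<Sum>j\<le>5. of_nat (5 choose j) * F i j)"
    using sum_Pow_blocks_card[of "{..<2 * n}" "fiber 5 (2 * n)" 5 F] disjoint_fiber UN_fiber[of "2 * n" 5] n by simp
  also have "\<dots> = (\<Prod>i\<in>{..<K}. \<Sum>j\<le>5. of_nat (5 choose j) * F i j) * (\<Prod>i\<in>{K..<2 * n}. \<Sum>j\<le>5. of_nat (5 choose j) * F i j)"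
  proof -
    have "{..<2 * n} = {..<K} \<union> {K..<2 * n}" "{..<K} \<inter> {K..<2 * n} = {}" using K by auto
    then show ?thesis by (simp only: prod.union_disjoint finite_lessThan finite_atLeastLessThan)
  qed
  also have "(\<Prod>i\<in>{K..<2 * n}. \<Sum>j\<le>5. of_nat (5 choose j) * F i j) = left_total z th y ^ (2 * n - K)"
    by (simp add: F_def)
  also have "(\<Prod>i\<in>{..<K}. \<Sum>j\<le>5. of_nat (5 choose j) * F i j)
      = (\<Prod>i<K. if i \<in> P then left_total z th (y * om) else (1 + z) ^ 5)"
    using binomial_ring[of z 1 5] by (intro prod.cong refl) (auto simp: F_def add.commute)
  finally show ?thesis .
qed

section \<open>Counting the permutations with a tight pair set\<close>

lemma card_matched_to:
  assumes p: "p permutes {..<10 * n}" and n: "n > 0" and P: "P \<subseteq> {..<n}"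
  shows "card (matched_to n P p) = 10 * card P"
proof -
  have "p ` matched_to n P p = {t. t < 10 * n \<and> t mod n \<in> P}"
  proof (intro equalityI subsetI)
    fix t assume "t \<in> p ` matched_to n P p"
    then show "t \<in> {t. t < 10 * n \<and> t mod n \<in> P}"
      using permutes_in_image[OF p] by (auto simp: matched_to_def)
  next
    fix t assume t: "t \<in> {t. t < 10 * n \<and> t mod n \<in> P}"
    then have "inv p t \<in> matched_to n P p"
      using permutes_in_image[OF permutes_inv[OF p]] permutes_inverses[OF p] by (auto simp: matched_to_def)
    then show "t \<in> p ` matched_to n P p" using permutes_inverses(1)[OF p] by (metis image_eqI)
  qed
  then have "card (matched_to n P p) = card {t. t < 10 * n \<and> t mod n \<in> P}"
    using card_image[of p "matched_to n P p"] permutes_inj_on[OF p] by metis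
  then show ?thesis using card_slots_over[OF P, of 10] by simp
qed

lemma closed_slots_subset:
  assumes n: "n > 0"
  shows "{s. s < 10 * n \<and> s mod (2 * n) \<in> closed_by n K P Z} \<subseteq> Z"
  by (auto simp: closed_by_def fiber_def)

lemma card_closed_slots:
  shows "card {s. s < 10 * n \<and> s mod (2 * n) \<in> closed_by n K P Z} = 5 * card (closed_by n K P Z)"
  using card_slots_over[of "closed_by n K P Z" "2 * n" 5] by (auto simp: closed_by_def)

lemma tight_in_right_configs:
  assumes p: "p permutes {..<10 * n}" and n: "n > 0" and P: "P \<subseteq> {..<n}"
    and t: "tight n K cP cQ u B P p"
  defines "Z \<equiv> matched_to n P p"
  shows "p ` marked n K P Z \<in> right_configs n K cP cQ P (closed_by n K P Z) (5 * u) (card (critical_slots n K P Z))"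
proof -
  let ?S = "p ` marked n K P Z" and ?C = "{s. s < 10 * n \<and> s mod (2 * n) \<in> closed_by n K P Z}"
  have CZ: "?C \<subseteq> Z" by (rule closed_slots_subset[OF n])
  have sub: "marked n K P Z \<subseteq> {..<10 * n}" by (auto simp: marked_def critical_slots_def)
  have Sin: "?S \<subseteq> {..<10 * n}" using sub permutes_in_image[OF p] by auto
  have inZ: "p s mod n \<in> P \<longleftrightarrow> s \<in> Z" if "s < 10 * n" for s
    using that by (simp add: Z_def matched_to_def)
  have "{t\<in>?S. t mod n \<in> P} = p ` ?C"
    using inZ sub CZ by (auto simp: marked_def critical_slots_def)
  then have c1: "card {t\<in>?S. t mod n \<in> P} = 5 * u"
    using card_image[OF permutes_inj_on[OF p], of ?C] card_closed_slots[of n K P Z] t by (simp add: tight_def Let_def Z_def)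
  have "{t\<in>?S. t mod n \<notin> P} = p ` critical_slots n K P Z"
    using inZ sub CZ by (auto simp: marked_def critical_slots_def)
  then have c2: "card {t\<in>?S. t mod n \<notin> P} = card (critical_slots n K P Z)"
    using card_image[OF permutes_inj_on[OF p]] by simp
  show ?thesis
    using Sin c1 c2 t unfolding right_configs_def tight_def Let_def Z_def by blast
qed

text \<open>A permutation is encoded by the slot set \<open>Z\<close> matched into \<open>P\<close>
  and the image \<open>S\<close> of the marked slots. Given both, it respects a colouring with four
  classes, and the four factorials combine with binomial coefficients to (10 n)!. The two sides are
  coupled through the number d of critical slots: the factor \<open>th ^ d\<close> taken from the
  right weight \<open>rho / th\<close> is handed to the left generating function. Likewise
  \<open>om\<close> pays for demands lowered by an additional edge.\<close>

lemma card_tight: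
  fixes q eps y z th om :: real and kap :: "nat \<Rightarrow> real"
  assumes n: "n > 0" and K: "K \<le> n" and P: "P \<subseteq> {..<n}" and m: "card P < n" and u: "5 * u \<le> 10 * card P"
    and q: "0 \<le> q" "q \<le> 1" and eps: "0 < eps" "eps \<le> 1" and pos: "y > 0" "z > 0" "th > 0" "om > 0"
    and omega: "\<And>i. i \<in> P \<Longrightarrow> upper_tail q (cP i - 1) \<le> om * upper_tail q (cP i)"
    and kappa: "\<And>i rho. i < n \<Longrightarrow> 0 \<le> rho \<Longrightarrow> rho \<le> 1 \<Longrightarrow> rho \<in> B \<Longrightarrow> lower_tail eps (rho / th) (1 - rho) (cQ i) \<le> kap i"
    and kap: "\<And>i. i < n \<Longrightarrow> 0 \<le> kap i"
  shows "card {p. p permutes {..<10 * n} \<and> tight n K cP cQ u B P p}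
      * (real (10 * n choose (10 * card P)) * real (10 * card P choose (5 * u)) * (q ^ (5 * u) * (1 - q) ^ (10 * card P - 5 * u) * eps ^ 11)
          * (z ^ (10 * card P) * y ^ u))
    \<le> fact (10 * n) * (10 * real n + 1) * (\<Prod>i\<in>P. upper_tail q (cP i)) * (\<Prod>i\<in>{..<n} - P. kap i)
       * ((\<Prod>i<K. if i \<in> P then left_total z th (y * om) else (1 + z) ^ 5)
       * left_total z th y ^ (2 * n - K))"
proof -
  let ?X = "{..<10 * n}" and ?m = "card P"
  let ?T = "{p. p permutes ?X \<and> tight n K cP cQ u B P p}"
  let ?D = "\<lambda>Z. card (critical_slots n K P Z)" and ?C = "closed_by n K P"
  define M where "M = 10 * n - 10 * ?m"
  define Zs where "Zs = {Z. Z \<subseteq> ?X \<and> card Z = 10 * ?m \<and> card (?C Z) = u}"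
  define Zs' where "Zs' = {Z\<in>Zs. real (?D Z) / (10 * (real n - ?m)) \<in> B}"
  define RC where "RC Z = right_configs n K cP cQ P (?C Z) (5 * u) (?D Z)" for Z
  define G where "G Z S = {p. p permutes ?X \<and> (\<forall>s\<in>?X. (p s mod n \<in> P, p s \<in> S) = (s \<in> Z, s \<in> marked n K P Z))}" for Z S
  \<comment> \<open>The classes are inside or outside \<open>Z\<close>, and marked or not.\<close>
  define f4 where "f4 d = (fact (5 * u) * fact (10 * ?m - 5 * u) * (fact d * fact (M - d)) :: nat)" for d
  define UP where "UP = (\<Prod>i\<in>P. upper_tail q (cP i))"
  define LO where "LO = (\<Prod>i\<in>{..<n} - P. kap i)"
  define qq where "qq = q ^ (5 * u) * (1 - q) ^ (10 * ?m - 5 * u) * eps ^ 11"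
  define w where "w Z = th ^ ?D Z * om ^ card {i\<in>P. i < K \<and> i \<in> ?C Z}" for Z
  have finP: "finite P" using P finite_subset by auto
  have finZs: "finite Zs" "finite Zs'" unfolding Zs'_def Zs_def by auto
  have finRC: "finite (RC Z)" for Z
    by (rule finite_subset[of _ "Pow ?X"]) (auto simp: RC_def right_configs_def)
  have finG: "finite (G Z S)" for Z S
    unfolding G_def by (rule finite_subset[OF _ finite_permutations[of ?X]]) auto
  have M: "M = 10 * (n - ?m)" "M > 0" "real M = 10 * (real n - ?m)" "M \<le> 10 * n"
    using m by (auto simp: M_def of_nat_diff algebra_simps)
  have dM: "?D Z \<le> M" if "Z \<in> Zs" for Z
  proof -
    have "critical_slots n K P Z \<subseteq> ?X - Z" by (auto simp: critical_slots_def)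
    then have "?D Z \<le> card (?X - Z)" by (intro card_mono) auto
    also have "\<dots> = M" using that by (subst card_Diff_subset) (auto simp: Zs_def M_def intro: finite_subset)
    finally show ?thesis .
  qed
  have sub: "?T \<subseteq> (\<Union>Z\<in>Zs'. \<Union>S\<in>RC Z. G Z S)"
  proof
    fix p assume "p \<in> ?T"
    then have p: "p permutes ?X" and t: "tight n K cP cQ u B P p" by auto
    let ?Z = "matched_to n P p" and ?S = "p ` marked n K P (matched_to n P p)"
    have "?Z \<in> Zs'"
      using card_matched_to[OF p n P] t by (auto simp: Zs'_def Zs_def tight_def Let_def matched_to_def)
    moreover have "?S \<in> RC ?Z" unfolding RC_def by (rule tight_in_right_configs[OF p n P t])
    moreover have "p \<in> G ?Z ?S"
      using p by (auto simp: G_def matched_to_def inj_image_mem_iff[OF permutes_inj[OF p]])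
    ultimately show "p \<in> (\<Union>Z\<in>Zs'. \<Union>S\<in>RC Z. G Z S)" by blast
  qed
  have cardG: "card (G Z S) \<le> f4 (?D Z)" if Z: "Z \<in> Zs" for Z S
  proof -
    let ?col = "\<lambda>s. (s \<in> Z, s \<in> marked n K P Z)"
    let ?CS = "{s. s < 10 * n \<and> s mod (2 * n) \<in> ?C Z}"
    have CZ: "?CS \<subseteq> Z" by (rule closed_slots_subset[OF n])
    have ZX: "Z \<subseteq> ?X" "finite Z" using Z by (auto simp: Zs_def intro: finite_subset)
    have *: "card (G Z S) \<le> (\<Prod>c\<in>{(True,True),(True,False),(False,True),(False,False)}. fact (card {x\<in>?X. ?col x = c}))"
      unfolding G_def
      by (rule card_permutes_colouring_le[where col' = "\<lambda>t. (t mod n \<in> P, t \<in> S)"]) auto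
    have prod4: "(\<Prod>c\<in>{(True,True),(True,False),(False,True),(False,False)}. f c)
        = f (True,True) * (f (True,False) * (f (False,True) * f (False,False)))" for f :: "bool \<times> bool \<Rightarrow> nat"
      by simp
    have e1: "{x\<in>?X. ?col x = (True,True)} = ?CS"
      using CZ by (auto simp: marked_def critical_slots_def)
    have e2: "{x\<in>?X. ?col x = (True,False)} = Z - ?CS"
      using CZ ZX by (auto simp: marked_def critical_slots_def)
    have e3: "{x\<in>?X. ?col x = (False,True)} = critical_slots n K P Z"
      using CZ by (auto simp: marked_def critical_slots_def)
    have e4: "{x\<in>?X. ?col x = (False,False)} = (?X - Z) - critical_slots n K P Z"
      using CZ by (auto simp: marked_def)
    have c1: "card ?CS = 5 * u" using Z card_closed_slots[of n K P Z] by (simp add: Zs_def)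
    have c2: "card (Z - ?CS) = 10 * ?m - 5 * u"
      using Z c1 CZ ZX by (simp add: Zs_def card_Diff_subset finite_subset)
    have "critical_slots n K P Z \<subseteq> ?X - Z" by (auto simp: critical_slots_def)
    then have c4: "card ((?X - Z) - critical_slots n K P Z) = M - ?D Z"
      using Z ZX by (simp add: Zs_def M_def card_Diff_subset finite_subset)
    have "card (G Z S) \<le> fact (card ?CS) * (fact (card (Z - ?CS)) * (fact (?D Z) * fact (card ((?X - Z) - critical_slots n K P Z))))"
      using * unfolding prod4 e1 e2 e3 e4 .
    then show ?thesis by (simp only: c1 c2 c4 f4_def mult.assoc)
  qed
  have "card ?T \<le> card (\<Union>Z\<in>Zs'. \<Union>S\<in>RC Z. G Z S)"
    by (rule card_mono[OF _ sub]) (use finZs finRC finG in auto)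
  also have "\<dots> \<le> (\<Sum>Z\<in>Zs'. card (\<Union>S\<in>RC Z. G Z S))"
    by (rule card_UN_le[OF finZs(2)])
  also have "\<dots> \<le> (\<Sum>Z\<in>Zs'. \<Sum>S\<in>RC Z. card (G Z S))"
    by (intro sum_mono card_UN_le finRC)
  also have "\<dots> \<le> (\<Sum>Z\<in>Zs'. \<Sum>S\<in>RC Z. f4 (?D Z))"
    using cardG by (intro sum_mono) (auto simp: Zs'_def)
  finally have T: "real (card ?T) \<le> (\<Sum>Z\<in>Zs'. real (card (RC Z)) * real (f4 (?D Z)))"
    by (simp flip: of_nat_mult of_nat_sum)
  have UP0: "UP \<ge> 0" unfolding UP_def using q by (intro prod_nonneg) (auto intro: upper_tail_nonneg)
  have eachZ: "real (card (RC Z)) * real (f4 (?D Z)) * (real (10 * n choose (10 * ?m)) * real (10 * ?m choose (5 * u)) * qq)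
     \<le> fact (10 * n) * (10 * real n + 1) * UP * LO * w Z" if Z: "Z \<in> Zs'" for Z
  proof -
    define d where "d = ?D Z"
    \<comment> \<open>The number of critical slots is not prescribed, so the weight outside
      \<open>P\<close> uses their actual density. By \<open>binomial_mode\<close> the resulting
      factor then compensates the binomial coefficient \<open>M choose d\<close> up to
      \<open>M + 1\<close>; the price is that \<open>kappa\<close> must hold for every density in
      \<open>B\<close>.\<close>
    define rho where "rho = real d / real M"
    have ZZ: "Z \<in> Zs" using Z by (simp add: Zs'_def)
    have d: "d \<le> M" using dM[OF ZZ] by (simp add: d_def)
    have rho: "0 \<le> rho" "rho \<le> 1" "rho \<in> B"
      using Z d M by (auto simp: rho_def Zs'_def d_def)
    let ?e = "\<lambda>i. if i < K \<and> i \<in> ?C Z then 1 else 0 :: nat"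
    have "card (RC Z) * (q ^ (5 * u) * (1 - q) ^ (10 * ?m - 5 * u) * eps ^ 11 * (rho / th) ^ d * (1 - rho) ^ (10 * (n - ?m) - d))
       \<le> (\<Prod>i\<in>P. upper_tail q (cP i - ?e i)) * (\<Prod>i\<in>{..<n} - P. lower_tail eps (rho / th) (1 - rho) (cQ i))"
      unfolding RC_def d_def[symmetric] using n P q eps u rho pos d M by (intro card_right_configs) auto
    also have "\<dots> \<le> (om ^ card {i\<in>P. i < K \<and> i \<in> ?C Z} * UP) * LO"
    proof (rule mult_mono)
      have "(\<Prod>i\<in>P. upper_tail q (cP i - ?e i)) \<le> (\<Prod>i\<in>P. (if i < K \<and> i \<in> ?C Z then om else 1) * upper_tail q (cP i))"
        using omega q by (intro prod_mono) (auto intro: upper_tail_nonneg)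
      also have "\<dots> = (\<Prod>i\<in>P. if i < K \<and> i \<in> ?C Z then om else 1) * UP" by (simp only: prod.distrib UP_def)
      also have "(\<Prod>i\<in>P. if i < K \<and> i \<in> ?C Z then om else 1) = om ^ card {i\<in>P. i < K \<and> i \<in> ?C Z}"
        using finP by (simp add: prod.If_cases Int_def)
      finally show "(\<Prod>i\<in>P. upper_tail q (cP i - ?e i)) \<le> om ^ card {i\<in>P. i < K \<and> i \<in> ?C Z} * UP" .
      show "(\<Prod>i\<in>{..<n} - P. lower_tail eps (rho / th) (1 - rho) (cQ i)) \<le> LO"
        unfolding LO_def using rho eps pos kappa by (intro prod_mono) (auto intro!: lower_tail_nonneg)
      show "0 \<le> om ^ card {i\<in>P. i < K \<and> i \<in> ?C Z} * UP" using UP0 pos by simp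
      show "0 \<le> (\<Prod>i\<in>{..<n} - P. lower_tail eps (rho / th) (1 - rho) (cQ i))"
        using rho eps pos by (intro prod_nonneg) (auto intro!: lower_tail_nonneg)
    qed
    finally have A: "card (RC Z) * (qq * (rho / th) ^ d * (1 - rho) ^ (M - d)) \<le> om ^ card {i\<in>P. i < K \<and> i \<in> ?C Z} * UP * LO"
      by (simp add: qq_def M(1))
    have qq0: "qq \<ge> 0" using q eps by (simp add: qq_def)
    have mode: "1 \<le> (real M + 1) * (real (M choose d) * rho ^ d * (1 - rho) ^ (M - d))"
      unfolding rho_def by (rule binomial_mode[OF d M(2)])
    have b1: "fact (5 * u) * fact (10 * ?m - 5 * u) * (10 * ?m choose (5 * u)) = (fact (10 * ?m) :: nat)"
      by (rule binomial_fact_lemma[OF u])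
    have b2: "fact d * fact (M - d) * (M choose d) = (fact M :: nat)" by (rule binomial_fact_lemma[OF d])
    have b3: "fact (10 * ?m) * fact M * (10 * n choose (10 * ?m)) = (fact (10 * n) :: nat)"
      unfolding M_def by (rule binomial_fact_lemma) (use m in simp)
    have "f4 d * (10 * n choose (10 * ?m)) * (10 * ?m choose (5 * u)) * (M choose d)
       = (fact (5 * u) * fact (10 * ?m - 5 * u) * (10 * ?m choose (5 * u))) * (fact d * fact (M - d) * (M choose d)) * (10 * n choose (10 * ?m))"
      by (simp only: f4_def mult_ac)
    then have "f4 d * (10 * n choose (10 * ?m)) * (10 * ?m choose (5 * u)) * (M choose d) = fact (10 * n)"
      by (simp only: b1 b2 b3)
    from arg_cong[OF this, of real]
    have fct: "real (f4 d) * real (10 * n choose (10 * ?m)) * real (10 * ?m choose (5 * u)) * real (M choose d) = fact (10 * n)"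
      by (simp only: of_nat_mult of_nat_fact)
    let ?L = "real (card (RC Z)) * real (f4 d) * (real (10 * n choose (10 * ?m)) * real (10 * ?m choose (5 * u)) * qq)"
    have L0: "?L \<ge> 0" using qq0 by simp
    have "?L \<le> ?L * ((real M + 1) * (real (M choose d) * rho ^ d * (1 - rho) ^ (M - d)))"
      using mult_left_mono[OF mode L0] by simp
    also have "\<dots> = (real (f4 d) * real (10 * n choose (10 * ?m)) * real (10 * ?m choose (5 * u)) * real (M choose d)) * (real M + 1)
        * (th ^ d * (card (RC Z) * (qq * (rho / th) ^ d * (1 - rho) ^ (M - d))))"
      using pos by (simp add: power_divide)
    finally have "?L \<le> fact (10 * n) * (real M + 1) * (th ^ d * (card (RC Z) * (qq * (rho / th) ^ d * (1 - rho) ^ (M - d))))"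
      by (simp only: fct)
    also have "\<dots> \<le> fact (10 * n) * (10 * real n + 1) * (th ^ d * (om ^ card {i\<in>P. i < K \<and> i \<in> ?C Z} * UP * LO))"
    proof (rule mult_mono)
      have "real M + 1 \<le> 10 * real n + 1" using M by linarith
      then show "fact (10 * n) * (real M + 1) \<le> fact (10 * n) * (10 * real n + 1)" by (intro mult_left_mono) auto
      show "th ^ d * (card (RC Z) * (qq * (rho / th) ^ d * (1 - rho) ^ (M - d))) \<le> th ^ d * (om ^ card {i\<in>P. i < K \<and> i \<in> ?C Z} * UP * LO)"
        using A pos by (intro mult_left_mono) auto
      show "0 \<le> th ^ d * (card (RC Z) * (qq * (rho / th) ^ d * (1 - rho) ^ (M - d)))"
        using pos qq0 rho by (intro mult_nonneg_nonneg) auto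
    qed simp
    finally show ?thesis by (simp only: w_def d_def mult_ac)
  qed
  have LO0: "LO \<ge> 0" unfolding LO_def using kap by (intro prod_nonneg) auto
  let ?cc = "real (10 * n choose (10 * ?m)) * real (10 * ?m choose (5 * u)) * qq"
  let ?zy = "z ^ (10 * ?m) * y ^ u"
  have qq0: "qq \<ge> 0" using q eps by (simp add: qq_def)
  have w0: "w Z \<ge> 0" for Z using pos by (simp add: w_def)
  have "real (card ?T) * ?cc \<le> (\<Sum>Z\<in>Zs'. real (card (RC Z)) * real (f4 (?D Z))) * ?cc"
    using T qq0 by (intro mult_right_mono) auto
  also have "\<dots> \<le> (\<Sum>Z\<in>Zs'. fact (10 * n) * (10 * real n + 1) * UP * LO * w Z)"
    unfolding sum_distrib_right by (intro sum_mono eachZ)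
  finally have 1: "real (card ?T) * ?cc \<le> fact (10 * n) * (10 * real n + 1) * UP * LO * (\<Sum>Z\<in>Zs'. w Z)"
    by (simp only: sum_distrib_left)
  let ?F = "(\<Prod>i<K. if i \<in> P then left_total z th (y * om) else (1 + z) ^ 5)
       * left_total z th y ^ (2 * n - K)"
  have "(\<Sum>Z\<in>Zs'. w Z) * ?zy \<le> (\<Sum>Z\<in>Zs. w Z) * ?zy"
    using pos w0 finZs by (intro mult_right_mono sum_mono2) (auto simp: Zs'_def)
  also have "\<dots> \<le> ?F"
    using sum_left_configs[OF n K P pos, where m = ?m and u = u] unfolding w_def Zs_def .
  finally have 2: "(\<Sum>Z\<in>Zs'. w Z) * ?zy \<le> ?F" .
  have "real (card ?T) * ?cc * ?zy \<le> fact (10 * n) * (10 * real n + 1) * UP * LO * (\<Sum>Z\<in>Zs'. w Z) * ?zy"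
    using 1 pos by (intro mult_right_mono) auto
  also have "\<dots> \<le> fact (10 * n) * (10 * real n + 1) * UP * LO * ?F"
    using mult_left_mono[OF 2, of "fact (10 * n) * (10 * real n + 1) * UP * LO"] UP0 LO0 by (simp add: mult_ac)
  finally show ?thesis by (simp add: qq_def UP_def LO_def mult_ac)
qed

text \<open>With \<open>v\<close> marking the size of \<open>P\<close>, the sum over all pair sets
  factors over the pairs. A pair \<open>i < K\<close> also takes over the factor of left vertex
  \<open>i\<close>, since whether that vertex may be confined depends on \<open>i\<close> being in
  \<open>P\<close>; hence the two bases \<open>X\<close> and \<open>Y\<close>.\<close>

lemma sum_over_pair_sets:
  fixes f g :: "nat \<Rightarrow> real" and v FP F0 X Y :: real
  assumes K: "K \<le> n" and nn: "\<And>i. i < n \<Longrightarrow> f i \<ge> 0" "\<And>i. i < n \<Longrightarrow> g i \<ge> 0" "v \<ge> 0" "FP \<ge> 0" "F0 \<ge> 0"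
    and X: "\<And>i. i < n \<Longrightarrow> v * f i * FP + g i * F0 \<le> X" and Y: "\<And>i. i < n \<Longrightarrow> v * f i + g i \<le> Y"
  shows "(\<Sum>P | P \<subseteq> {..<n} \<and> card P = m. (\<Prod>i\<in>P. f i) * (\<Prod>i\<in>{..<n} - P. g i) * (\<Prod>i<K. if i \<in> P then FP else F0)) * v ^ m
    \<le> X ^ K * Y ^ (n - K)"
proof -
  let ?a = "\<lambda>i. v * f i * (if i < K then FP else 1)" and ?b = "\<lambda>i. g i * (if i < K then F0 else 1)"
  have eq: "(\<Prod>i\<in>P. f i) * (\<Prod>i\<in>{..<n} - P. g i) * (\<Prod>i<K. if i \<in> P then FP else F0) * v ^ m = (\<Prod>i\<in>{..<n}. if i \<in> P then ?a i else ?b i)"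
    if P: "P \<subseteq> {..<n}" "card P = m" for P
  proof -
    have K1: "(\<Prod>i<K. if i \<in> P then FP else F0) = (\<Prod>i\<in>{..<n}. if i < K then (if i \<in> P then FP else F0) else 1)"
      using K by (intro prod.mono_neutral_cong_left) auto
    have v1: "v ^ m = (\<Prod>i\<in>{..<n}. if i \<in> P then v else 1)"
    proof -
      have "{..<n} \<inter> {i. i \<in> P} = P" using P by auto
      then show ?thesis using P by (simp add: prod.If_cases)
    qed
    have f1: "(\<Prod>i\<in>P. f i) = (\<Prod>i\<in>{..<n}. if i \<in> P then f i else 1)"
      using P by (intro prod.mono_neutral_cong_left) auto
    have g1: "(\<Prod>i\<in>{..<n} - P. g i) = (\<Prod>i\<in>{..<n}. if i \<in> P then 1 else g i)"
      using P by (intro prod.mono_neutral_cong_left) auto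
    show ?thesis
      unfolding K1 v1 f1 g1 prod.distrib[symmetric] by (intro prod.cong) auto
  qed
  have "(\<Sum>P | P \<subseteq> {..<n} \<and> card P = m. (\<Prod>i\<in>P. f i) * (\<Prod>i\<in>{..<n} - P. g i) * (\<Prod>i<K. if i \<in> P then FP else F0)) * v ^ m
     = (\<Sum>P | P \<subseteq> {..<n} \<and> card P = m. \<Prod>i\<in>{..<n}. if i \<in> P then ?a i else ?b i)"
    unfolding sum_distrib_right by (intro sum.cong refl eq) auto
  also have "\<dots> \<le> (\<Sum>P\<in>Pow {..<n}. \<Prod>i\<in>{..<n}. if i \<in> P then ?a i else ?b i)"
    using nn by (intro sum_mono2) (auto intro!: prod_nonneg)
  also have "\<dots> = (\<Prod>i\<in>{..<n}. ?a i + ?b i)" by (rule sum_Pow_prod_if) simp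
  also have "\<dots> \<le> (\<Prod>i\<in>{..<n}. if i < K then X else Y)"
    using nn X Y by (intro prod_mono) (auto simp: add_nonneg_nonneg)
  also have "\<dots> = X ^ K * Y ^ (n - K)"
  proof -
    have "{..<n} \<inter> {i. i < K} = {..<K}" "{..<n} \<inter> - {i. i < K} = {K..<n}" using K by auto
    then show ?thesis by (simp add: prod.If_cases)
  qed
  finally show ?thesis .
qed

abbreviation tight_perms ::
  "nat \<Rightarrow> nat \<Rightarrow> (nat \<Rightarrow> nat) \<Rightarrow> (nat \<Rightarrow> nat) \<Rightarrow> nat \<Rightarrow> nat \<Rightarrow> real set \<Rightarrow> (nat \<Rightarrow> nat) set" where
  "tight_perms n K cP cQ m u B \<equiv> {p. p permutes {..<10 * n} \<and> (\<exists>P\<subseteq>{..<n}. card P = m \<and> tight n K cP cQ u B P p)}"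

lemma card_ex_tight:
  fixes q eps y z th om v X Y :: real and kap :: "nat \<Rightarrow> real"
  assumes n: "n > 0" and K: "K \<le> n" and m: "m < n" and u: "5 * u \<le> 10 * m"
    and q: "0 \<le> q" "q \<le> 1" and eps: "0 < eps" "eps \<le> 1" and pos: "y > 0" "z > 0" "th > 0" "om > 0" "v > 0"
    and omega: "\<And>i. i < n \<Longrightarrow> upper_tail q (cP i - 1) \<le> om * upper_tail q (cP i)"
    and kappa: "\<And>i rho. i < n \<Longrightarrow> 0 \<le> rho \<Longrightarrow> rho \<le> 1 \<Longrightarrow> rho \<in> B \<Longrightarrow> lower_tail eps (rho / th) (1 - rho) (cQ i) \<le> kap i"
    and kap: "\<And>i. i < n \<Longrightarrow> 0 \<le> kap i"
    and X: "\<And>i. i < n \<Longrightarrow> v * upper_tail q (cP i) * left_total z th (y * om) + kap i * (1 + z) ^ 5 \<le> X"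
    and Y: "\<And>i. i < n \<Longrightarrow> v * upper_tail q (cP i) + kap i \<le> Y"
  shows "card (tight_perms n K cP cQ m u B)
      * (real (10 * n choose (10 * m)) * real (10 * m choose (5 * u)) * (q ^ (5 * u) * (1 - q) ^ (10 * m - 5 * u) * eps ^ 11)
          * (z ^ (10 * m) * y ^ u) * v ^ m)
    \<le> fact (10 * n) * (10 * real n + 1) * (X ^ K * Y ^ (n - K) * left_total z th y ^ (2 * n - K))"
    (is "card ?T * (?c * v ^ m) \<le> _")
proof -
  let ?Ps = "{P. P \<subseteq> {..<n} \<and> card P = m}"
  let ?T' = "\<lambda>P. {p. p permutes {..<10 * n} \<and> tight n K cP cQ u B P p}"
  let ?FP = "left_total z th (y * om)"
  let ?F1 = "left_total z th y ^ (2 * n - K)"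
  let ?W = "\<lambda>P. (\<Prod>i\<in>P. upper_tail q (cP i)) * (\<Prod>i\<in>{..<n} - P. kap i) * (\<Prod>i<K. if i \<in> P then ?FP else (1 + z) ^ 5)"
  have FP: "?FP \<ge> 0" "?F1 \<ge> 0" using pos by (auto intro!: sum_nonneg zero_le_power simp: left_weight_def)
  have fin: "finite ?Ps" by (rule finite_subset[of _ "Pow {..<n}"]) auto
  have c0: "?c \<ge> 0" using q eps pos by auto
  have each: "card (?T' P) * ?c \<le> fact (10 * n) * (10 * real n + 1) * ?F1 * ?W P" if "P \<in> ?Ps" for P
  proof -
    have P: "P \<subseteq> {..<n}" "card P = m" using that by auto
    have "card (?T' P)
      * (real (10 * n choose (10 * card P)) * real (10 * card P choose (5 * u)) * (q ^ (5 * u) * (1 - q) ^ (10 * card P - 5 * u) * eps ^ 11)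
          * (z ^ (10 * card P) * y ^ u))
    \<le> fact (10 * n) * (10 * real n + 1) * (\<Prod>i\<in>P. upper_tail q (cP i)) * (\<Prod>i\<in>{..<n} - P. kap i)
       * ((\<Prod>i<K. if i \<in> P then ?FP else (1 + z) ^ 5) * ?F1)"
      by (rule card_tight[where B = B]) (use n K P m u q eps pos omega kappa kap in auto)
    then show ?thesis unfolding P(2) by (simp only: mult_ac)
  qed
  have "?T = (\<Union>P\<in>?Ps. ?T' P)" by blast
  then have "real (card ?T) \<le> (\<Sum>P\<in>?Ps. card (?T' P))"
    using card_UN_le[OF fin, of ?T'] by (simp flip: of_nat_sum)
  then have "card ?T * ?c \<le> (\<Sum>P\<in>?Ps. card (?T' P)) * ?c" using c0 by (intro mult_right_mono) auto
  also have "\<dots> = (\<Sum>P\<in>?Ps. card (?T' P) * ?c)" by (simp add: sum_distrib_right)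
  also have "\<dots> \<le> (\<Sum>P\<in>?Ps. fact (10 * n) * (10 * real n + 1) * ?F1 * ?W P)" by (intro sum_mono each)
  also have "\<dots> = fact (10 * n) * (10 * real n + 1) * ?F1 * (\<Sum>P\<in>?Ps. ?W P)" by (simp only: sum_distrib_left)
  finally have "card ?T * ?c * v ^ m \<le> fact (10 * n) * (10 * real n + 1) * ?F1 * (\<Sum>P\<in>?Ps. ?W P) * v ^ m"
    using pos by (intro mult_right_mono) auto
  also have "\<dots> = fact (10 * n) * (10 * real n + 1) * ?F1 * ((\<Sum>P\<in>?Ps. ?W P) * v ^ m)" by (simp only: mult_ac)
  also have "\<dots> \<le> fact (10 * n) * (10 * real n + 1) * ?F1 * (X ^ K * Y ^ (n - K))"
    by (intro mult_left_mono sum_over_pair_sets) (use K q kap pos FP X Y upper_tail_nonneg in auto)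
  finally show ?thesis by (simp only: mult_ac)
qed

section \<open>Extremal confining sets of pairs\<close>

definition nbr_pairs :: "nat \<Rightarrow> nat \<Rightarrow> (nat \<Rightarrow> nat) \<Rightarrow> nat \<Rightarrow> nat set" where
  "nbr_pairs n K p i = (\<lambda>s. p s mod n) ` fiber 5 (2 * n) i \<union> {r. r = i \<and> i < K}"

definition confined :: "nat \<Rightarrow> nat \<Rightarrow> (nat \<Rightarrow> nat) \<Rightarrow> nat set \<Rightarrow> nat set" where
  "confined n K p P = {i. i < 2 * n \<and> nbr_pairs n K p i \<subseteq> P}"

lemma closed_by_matched_to: "closed_by n K P (matched_to n P p) = confined n K p P"
  by (auto simp: closed_by_def matched_to_def confined_def nbr_pairs_def fiber_def)

lemma finite_confined [simp]: "finite (confined n K p P)"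
  by (rule finite_subset[of _ "{..<2 * n}"]) (auto simp: confined_def)

lemma confined_Diff: "confined n K p (P - {r}) = confined n K p P - {i. r \<in> nbr_pairs n K p i}"
  by (auto simp: confined_def)

lemma nbr_pairs_nonempty: "i < 2 * n \<Longrightarrow> nbr_pairs n K p i \<noteq> {}"
proof -
  assume i: "i < 2 * n"
  then have "fiber 5 (2 * n) i \<noteq> {}" using card_fiber[of i "2 * n" 5] by fastforce
  then show ?thesis by (auto simp: nbr_pairs_def)
qed

lemma critical_slot_unique:
  assumes "s \<in> critical_slots n K P Z" "s' \<in> critical_slots n K P Z" "s mod (2 * n) = s' mod (2 * n)" "n > 0"
  shows "s = s'"
proof -
  let ?F = "fiber 5 (2 * n) (s mod (2 * n))"
  have "card (?F - Z) = card ?F - card (?F \<inter> Z)" by (rule card_Diff_subset_Int) simp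
  then have "card (?F - Z) = 1" using assms by (simp add: critical_slots_def Int_commute)
  moreover have "s \<in> ?F - Z" "s' \<in> ?F - Z" using assms by (auto simp: critical_slots_def fiber_def)
  ultimately show ?thesis using card_1_singletonE by (metis singletonD)
qed

text \<open>Among the pair sets of the smallest size that confine more left vertices than they have pairs,
  take one that confines as many vertices as possible and, among these, has the largest index sum.
  Exchanging the pair \<open>r\<close> of this set that touches the fewest confined vertices for a pair outside
  it then yields no improvement, which bounds the gain of every outside pair by the loss at \<open>r\<close>; the
  at most eleven exceptions are the pairs whose gain involves a neighbour of \<open>r\<close>.\<close>

lemma extremal_violator_tight:
  assumes p: "p permutes {..<10 * n}" and n: "n > 0"
    and P0: "P0 \<subseteq> {..<n}" "card P0 = m" "m < card (confined n K p P0)"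
    and minimal: "\<And>P. P \<subseteq> {..<n} \<Longrightarrow> card P < m \<Longrightarrow> card (confined n K p P) \<le> card P"
  shows "\<exists>P g r u. P \<subseteq> {..<n} \<and> card P = m \<and> m < u \<and> u \<le> m + 10 \<and> 2 \<le> g \<and> r < n \<and>
     tight n K (\<lambda>i. if i < r then g + 1 else g) (\<lambda>i. if i < r then g + 1 else g) u UNIV P p"
proof -
  let ?cl = "confined n K p" and ?nb = "nbr_pairs n K p"
  let ?Ps = "{P. P \<subseteq> {..<n} \<and> card P = m}"
  \<comment> \<open>A lexicographic order in one number: first the number of confined vertices, then
    the index sum. The sum is at most \<open>n * n\<close>, so the factor \<open>n * n + 1\<close>
    lets the first entry dominate.\<close>
  define phi where "phi P = card (?cl P) * (n * n + 1) + \<Sum>P" for P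
  have sumle: "\<Sum>P \<le> n * n" if "P \<subseteq> {..<n}" for P
  proof -
    have "\<Sum>P \<le> \<Sum>{..<n}" using that by (intro sum_mono2) auto
    also have "\<dots> \<le> (\<Sum>i<n. n)" by (intro sum_mono) auto
    finally show ?thesis by simp
  qed
  have finPs: "finite ?Ps" by (rule finite_subset[of _ "Pow {..<n}"]) auto
  have finphi: "finite (phi ` ?Ps)" using finPs by simp
  have "phi ` ?Ps \<noteq> {}" using P0 by blast
  from Max_in[OF finphi this] obtain P where P: "P \<in> ?Ps" and Pmax: "phi P = Max (phi ` ?Ps)" by auto
  have max: "phi P' \<le> phi P" if "P' \<in> ?Ps" for P'
    unfolding Pmax using that finphi by (intro Max_ge) auto
  have PS: "P \<subseteq> {..<n}" "card P = m" "finite P" using P finite_subset by auto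
  have max1: "card (?cl P') \<le> card (?cl P)" if "P' \<in> ?Ps" for P'
  proof (rule ccontr)
    assume "\<not> ?thesis"
    then have "(card (?cl P) + 1) * (n * n + 1) \<le> card (?cl P') * (n * n + 1)" by (intro mult_right_mono) auto
    then show False using max[OF that] sumle[OF PS(1)] unfolding phi_def by (simp add: algebra_simps)
  qed
  have max2: "\<Sum>P' \<le> \<Sum>P" if "P' \<in> ?Ps" "card (?cl P') = card (?cl P)" for P'
    using max[OF that(1)] that(2) unfolding phi_def by simp
  define u where "u = card (?cl P)"
  have mu: "m < u" using max1[of P0] P0 by (simp add: u_def)
  have "P \<noteq> {}"
  proof
    assume "P = {}"
    then have "?cl P = {}" using nbr_pairs_nonempty[of _ n K p] by (auto simp: confined_def)
    then show False using mu by (simp add: u_def)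
  qed
  define N where "N r = {i. i < 2 * n \<and> r \<in> ?nb i}" for r
  define loss where "loss r = card (?cl P \<inter> N r)" for r
  have finN: "finite (N r)" for r by (rule finite_subset[of _ "{..<2 * n}"]) (auto simp: N_def)
  have loss_eq: "card (?cl (P - {r})) + loss r = u" for r
  proof -
    have "?cl (P - {r}) = ?cl P - N r" unfolding confined_Diff by (auto simp: N_def confined_def)
    moreover have "card (?cl P - N r) + card (?cl P \<inter> N r) = card (?cl P)"
      by (simp add: card_Int_Diff[of "?cl P" "N r"])
    ultimately show ?thesis by (simp add: loss_def u_def)
  qed
  \<comment> \<open>By minimality the m - 1 pairs without \<open>r\<close> confine at most m - 1
    vertices, while \<open>P\<close> confines u.\<close>
  have loss_ge: "u - m + 1 \<le> loss r" if "r \<in> P" for r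
  proof -
    have "card (P - {r}) = m - 1" "m > 0" using that PS by (auto simp: card_gt_0_iff)
    moreover from this have "card (?cl (P - {r})) \<le> m - 1"
      using minimal[of "P - {r}"] PS by auto
    ultimately show ?thesis using loss_eq[of r] mu by linarith
  qed
  let ?Z = "matched_to n P p"
  let ?S = "p ` marked n K P ?Z"
  let ?own = "\<lambda>t. inv p t mod (2 * n)"
  have inv: "inv p (p s) = s" "p (inv p s) = s" for s using permutes_inverses[OF p] by auto
  have slotN: "\<exists>s. s < 10 * n \<and> s mod (2 * n) = i \<and> p s \<in> fiber 10 n r" if "i \<in> N r" "\<not> (i = r \<and> r < K)" for i r
    using that n permutes_in_image[OF p] by (auto simp: N_def nbr_pairs_def fiber_def)
  \<comment> \<open>Ten slots lead to a pair, and the only additional edge at pair \<open>r\<close>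
    comes from left vertex \<open>r\<close>.\<close>
  have cardN: "card (N r) \<le> 11" if "r < n" for r
  proof -
    have "N r \<subseteq> ?own ` fiber 10 n r \<union> {r}"
    proof
      fix i assume i: "i \<in> N r"
      show "i \<in> ?own ` fiber 10 n r \<union> {r}"
      proof (cases "i = r \<and> r < K")
        case False
        then obtain s where "s mod (2 * n) = i" "p s \<in> fiber 10 n r" using slotN i by blast
        then have "i = ?own (p s)" using inv by simp
        then show ?thesis using \<open>p s \<in> fiber 10 n r\<close> by blast
      qed auto
    qed
    then have "card (N r) \<le> card (?own ` fiber 10 n r \<union> {r})" by (intro card_mono) auto
    also have "\<dots> \<le> card (?own ` fiber 10 n r) + card {r}" by (rule card_Un_le)
    also have "\<dots> \<le> 10 + 1" using card_image_le[of "fiber 10 n r" ?own] that by simp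
    finally show ?thesis by simp
  qed
  have loss_le: "loss r \<le> card (?S \<inter> fiber 10 n r) + (if r < K \<and> r \<in> closed_by n K P ?Z then 1 else 0)" for r
  proof -
    let ?E = "if r < K \<and> r \<in> ?cl P then {r} else {}"
    have "?cl P \<inter> N r \<subseteq> ?own ` (?S \<inter> fiber 10 n r) \<union> ?E"
    proof
      fix i assume i: "i \<in> ?cl P \<inter> N r"
      show "i \<in> ?own ` (?S \<inter> fiber 10 n r) \<union> ?E"
      proof (cases "i = r \<and> r < K")
        case False
        then obtain s where s: "s < 10 * n" "s mod (2 * n) = i" "p s \<in> fiber 10 n r" using slotN i by blast
        then have "s \<in> marked n K P ?Z" using i by (auto simp: marked_def closed_by_matched_to)
        then have "p s \<in> ?S \<inter> fiber 10 n r" "i = ?own (p s)" using s inv by auto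
        then show ?thesis by blast
      qed (use i in auto)
    qed
    then have "loss r \<le> card (?own ` (?S \<inter> fiber 10 n r) \<union> ?E)"
      unfolding loss_def by (intro card_mono) auto
    also have "\<dots> \<le> card (?own ` (?S \<inter> fiber 10 n r)) + card ?E" by (rule card_Un_le)
    also have "\<dots> \<le> card (?S \<inter> fiber 10 n r) + card ?E" by (intro add_right_mono card_image_le) simp
    finally show ?thesis by (simp add: closed_by_matched_to split: if_splits)
  qed
  \<comment> \<open>Smallest loss first, then smallest index. The tie-break makes every pair of
    \<open>P\<close> below \<open>r\<close> lose at least one vertex more than \<open>r\<close>,
    which yields the index threshold.\<close>
  define psi where "psi r = loss r * (n + 1) + r" for r
  have finpsi: "finite (psi ` P)" using PS by simp
  have "psi ` P \<noteq> {}" using \<open>P \<noteq> {}\<close> by simp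
  from Min_in[OF finpsi this] obtain r where r: "r \<in> P" and rmin: "psi r = Min (psi ` P)" by auto
  have min: "psi r \<le> psi r'" if "r' \<in> P" for r'
    unfolding rmin using that finpsi by (intro Min_le) auto
  have rn: "r < n" using r PS by auto
  define g where "g = loss r"
  have g2: "2 \<le> g" using loss_ge[OF r] mu by (simp add: g_def)
  have "loss r \<le> card (N r)" unfolding loss_def by (intro card_mono finN) auto
  \<comment> \<open>The loss is at least u - m + 1 and at most 11.\<close>
  then have u10: "u \<le> m + 10" using loss_ge[OF r] cardN[OF rn] by linarith
  have min1: "(if i < r then g + 1 else g) \<le> loss i" if "i \<in> P" for i
  proof -
    have "g \<le> loss i"
    proof (rule ccontr)
      assume "\<not> ?thesis"
      then have "(loss i + 1) * (n + 1) \<le> g * (n + 1)" by (intro mult_right_mono) auto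
      moreover have "i < n" using that PS by auto
      ultimately show False using min[OF that] unfolding psi_def g_def by (simp add: algebra_simps)
    qed
    moreover have "loss i \<noteq> g" if "i < r"
      using min[OF \<open>i \<in> P\<close>] that unfolding psi_def g_def by auto
    ultimately show ?thesis by (cases "i < r") auto
  qed
  \<comment> \<open>The vertices that become confined when \<open>j\<close> joins \<open>P\<close>.
    Distinct critical slots matched into \<open>j\<close> belong to distinct vertices of this set,
    so it bounds the critical load of \<open>j\<close>.\<close>
  define G where "G j = {i. i < 2 * n \<and> i \<notin> ?cl P \<and> ?nb i \<subseteq> insert j P}" for j
  have finG: "finite (G j)" for j by (rule finite_subset[of _ "{..<2 * n}"]) (auto simp: G_def)
  have gainS: "card (?S \<inter> fiber 10 n j) \<le> card (G j)" if j: "j < n" "j \<notin> P" for j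
  proof (rule card_inj_on_le[where f = ?own])
    have crit: "inv p t \<in> critical_slots n K P ?Z \<and> p (inv p t) = t" if "t \<in> ?S \<inter> fiber 10 n j" for t
    proof -
      obtain s where s: "s \<in> marked n K P ?Z" "t = p s" using \<open>t \<in> ?S \<inter> fiber 10 n j\<close> by auto
      have "s \<notin> ?Z" using s that j by (auto simp: matched_to_def fiber_def)
      then have "s \<in> critical_slots n K P ?Z" using s closed_slots_subset[OF n, of K P ?Z] by (auto simp: marked_def)
      then show ?thesis using s inv by simp
    qed
    show "inj_on ?own (?S \<inter> fiber 10 n j)"
      using crit critical_slot_unique n by (intro inj_onI) (metis (no_types, lifting))
    show "?own ` (?S \<inter> fiber 10 n j) \<subseteq> G j"
    proof
      fix i assume "i \<in> ?own ` (?S \<inter> fiber 10 n j)"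
      then obtain t where t: "t \<in> ?S \<inter> fiber 10 n j" "i = inv p t mod (2 * n)" by auto
      let ?s = "inv p t"
      have s: "?s \<in> critical_slots n K P ?Z" "p ?s mod n = j" using crit[OF t(1)] t by (auto simp: fiber_def)
      have "?nb i \<subseteq> insert j P"
      proof
        fix k assume k: "k \<in> ?nb i"
        show "k \<in> insert j P"
        proof (cases "k = i \<and> i < K")
          case True
          then show ?thesis using s t(2) by (auto simp: critical_slots_def)
        next
          case False
          then obtain s' where s': "s' \<in> fiber 5 (2 * n) i" "k = p s' mod n" using k by (auto simp: nbr_pairs_def)
          show ?thesis
          proof (cases "s' \<in> ?Z")
            case True
            then show ?thesis using s' by (auto simp: matched_to_def)
          next
            case False
            then have "s' \<in> critical_slots n K P ?Z" using s' s(1) t(2) by (auto simp: critical_slots_def fiber_def)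
            then have "s' = ?s" using critical_slot_unique[OF _ s(1)] s' t(2) n by (auto simp: fiber_def)
            then show ?thesis using s s' by simp
          qed
        qed
      qed
      moreover have "i \<notin> ?cl P"
        using s t(2) n by (auto simp: closed_by_matched_to[symmetric] closed_by_def critical_slots_def fiber_def)
      moreover have "i < 2 * n" using n t(2) by simp
      ultimately show "i \<in> G j" by (simp add: G_def)
    qed
  qed (rule finG)
  \<comment> \<open>If no gained vertex touches \<open>r\<close>, exchanging \<open>r\<close> for
    \<open>j\<close> changes the confined count by exactly gain minus loss or better. Maximality
    gives gain at most loss, and in a tie the maximal index sum forces \<open>j < r\<close>.\<close>
  have swap: "card (G j) < (if j < r then g + 1 else g)" if j: "j < n" "j \<notin> P" "G j \<inter> N r = {}" for j
  proof -
    let ?P' = "insert j (P - {r})"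
    have "card ?P' = Suc (card (P - {r}))" using j PS by simp
    also have "\<dots> = m" using card_Suc_Diff1[OF PS(3) r] PS by simp
    finally have P': "?P' \<in> ?Ps" using PS j by auto
    have "?cl (P - {r}) \<union> G j \<subseteq> ?cl ?P'"
      using j(3) by (auto simp: confined_def G_def N_def)
    moreover have "?cl (P - {r}) \<inter> G j = {}" by (auto simp: confined_def G_def)
    ultimately have "card (?cl (P - {r})) + card (G j) \<le> card (?cl ?P')"
      using card_mono[of "?cl ?P'" "?cl (P - {r}) \<union> G j"] finG by (simp add: card_Un_disjoint)
    then have *: "u + card (G j) \<le> card (?cl ?P') + g" using loss_eq[of r] by (simp add: g_def)
    have le: "card (?cl ?P') \<le> u" using max1[OF P'] by (simp add: u_def)
    have "j < r" if "card (G j) = g"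
    proof -
      have "card (?cl ?P') = card (?cl P)" using * le that by (simp add: u_def)
      from max2[OF P' this] have "\<Sum>?P' \<le> \<Sum>P" .
      moreover have "\<Sum>?P' = j + \<Sum>(P - {r})" using j PS by simp
      moreover have "\<Sum>P = r + \<Sum>(P - {r})" using r PS by (simp add: sum.remove)
      ultimately have "j \<le> r" by simp
      then show ?thesis using j r by (cases "j = r") auto
    qed
    moreover have "card (G j) \<le> g" using * le by simp
    ultimately show ?thesis by (cases "card (G j) = g") auto
  qed
  let ?c = "\<lambda>i. if i < r then g + 1 else g"
  let ?V = "{j. j < n \<and> j \<notin> P \<and> ?c j \<le> card (?S \<inter> fiber 10 n j)}"
  have ex: "\<exists>i. i \<in> G j \<inter> N r" if "j \<in> ?V" for j
    using that swap[of j] gainS[of j] by fastforce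
  \<comment> \<open>An exceptional \<open>j\<close> gains some neighbour of \<open>r\<close>. That
    vertex determines \<open>j\<close>, the only pair outside \<open>P\<close> it touches.\<close>
  have "card ?V \<le> card (N r)"
  proof (rule card_inj_on_le[where f = "\<lambda>j. SOME i. i \<in> G j \<inter> N r"])
    have Gj: "(SOME i. i \<in> G j \<inter> N r) \<in> G j \<inter> N r" if "j \<in> ?V" for j using someI_ex[OF ex[OF that]] .
    show "inj_on (\<lambda>j. SOME i. i \<in> G j \<inter> N r) ?V"
    proof (rule inj_onI)
      fix j j' assume jj: "j \<in> ?V" "j' \<in> ?V" and eq: "(SOME i. i \<in> G j \<inter> N r) = (SOME i. i \<in> G j' \<inter> N r)"
      let ?i = "SOME i. i \<in> G j \<inter> N r"
      have i: "?i \<in> G j" "?i \<in> G j'" using Gj[OF jj(1)] Gj[OF jj(2)] eq by auto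
      then have "\<not> ?nb ?i \<subseteq> P" by (simp add: G_def confined_def)
      then show "j = j'" using i by (auto simp: G_def)
    qed
    show "(\<lambda>j. SOME i. i \<in> G j \<inter> N r) ` ?V \<subseteq> N r" using Gj by blast
  qed (rule finN)
  then have V11: "card ?V \<le> 11" using cardN[OF rn] by simp
  have "tight n K ?c ?c u UNIV P p"
    unfolding tight_def Let_def
  proof (intro conjI ballI)
    show "card (closed_by n K P ?Z) = u" by (simp add: closed_by_matched_to u_def)
    fix i assume "i \<in> P"
    from min1[OF this] loss_le[of i]
    show "?c i \<le> card (?S \<inter> fiber 10 n i) + (if i < K \<and> i \<in> closed_by n K P ?Z then 1 else 0)" by linarith
  qed (use V11 in auto)
  then show ?thesis using PS mu u10 g2 rn by blast
qed

lemma tight_weaken: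
  assumes "tight n K cP cQ u B P p" "\<And>i. cP' i \<le> cP i" "\<And>i. cQ i \<le> cQ' i"
  shows "tight n K cP' cQ' u B P p"
proof -
  let ?S = "p ` marked n K P (matched_to n P p)"
  have "card {i. i < n \<and> i \<notin> P \<and> cQ' i \<le> card (?S \<inter> fiber 10 n i)} \<le> card {i. i < n \<and> i \<notin> P \<and> cQ i \<le> card (?S \<inter> fiber 10 n i)}"
    using assms(3) by (intro card_mono) (auto intro: order_trans)
  then show ?thesis
    using assms order_trans unfolding tight_def Let_def by (smt (verit, ccfv_SIG))
qed

text \<open>The minimal loss is at least 2. If it equals 2, the thresholds are 2 and 3; otherwise
  the demand inside is weakened to 3 and the outside bound to 11, which no pair reaches because it
  has only ten slots. Thus two shapes cover all minimal losses.\<close>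

lemma minimal_violator_cases:
  assumes p: "p permutes {..<10 * n}" and n: "n > 0"
    and P0: "P0 \<subseteq> {..<n}" "card P0 = m" "m < card (confined n K p P0)"
    and minimal: "\<And>P. P \<subseteq> {..<n} \<Longrightarrow> card P < m \<Longrightarrow> card (confined n K p P) \<le> card P"
  shows "\<exists>P u. P \<subseteq> {..<n} \<and> card P = m \<and> m < u \<and> u \<le> m + 10 \<and>
     (tight n K (\<lambda>_. 3) (\<lambda>_. 11) u UNIV P p \<or>
      (\<exists>r<n. tight n K (\<lambda>i. if i < r then 3 else 2) (\<lambda>i. if i < r then 3 else 2) u UNIV P p))"
proof -
  obtain P g r u where *: "P \<subseteq> {..<n}" "card P = m" "m < u" "u \<le> m + 10" "2 \<le> g" "r < n"
    "tight n K (\<lambda>i. if i < r then g + 1 else g) (\<lambda>i. if i < r then g + 1 else g) u UNIV P p"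
    using extremal_violator_tight[OF assms(1-5)] minimal by blast
  show ?thesis
  proof (cases "g = 2")
    case True
    have "(2::nat) + 1 = 3" by simp
    then show ?thesis using * unfolding True by metis
  next
    case False
    let ?S = "p ` marked n K P (matched_to n P p)"
    have "card (?S \<inter> fiber 10 n i) \<le> 10" if "i < n" for i
      using card_mono[of "fiber 10 n i" "?S \<inter> fiber 10 n i"] that by simp
    then have "{i. i < n \<and> i \<notin> P \<and> 11 \<le> card (?S \<inter> fiber 10 n i)} = {}" by fastforce
    then have "tight n K (\<lambda>i. if i < r then g + 1 else g) (\<lambda>_. 11) u UNIV P p"
      using *(7) unfolding tight_def Let_def by (simp only: card.empty) auto
    then have "tight n K (\<lambda>_. 3) (\<lambda>_. 11) u UNIV P p"
      using False *(5) by (elim tight_weaken) auto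
    then show ?thesis using * by blast
  qed
qed

section \<open>First-moment counts\<close>

text \<open>Union bound over the exact image of \<open>A\<close>, a subset of \<open>B\<close> of
  the same size. For a fixed image the permutation respects a colouring with two classes.\<close>

lemma card_permutes_image_subset:
  assumes "finite X" "A \<subseteq> X" "B \<subseteq> X"
  shows "card {p. p permutes X \<and> p ` A \<subseteq> B} * (card X choose card A) \<le> fact (card X) * (card B choose card A)"
proof -
  let ?Bs = "{B'. B' \<subseteq> B \<and> card B' = card A}"
  let ?G = "\<lambda>B'. {p. p permutes X \<and> (\<forall>x\<in>X. (p x \<in> B') = (x \<in> A))}"
  have finB: "finite B" "finite A" using assms finite_subset by auto
  have fin: "finite ?Bs" by (rule finite_subset[of _ "Pow B"]) (use finB in auto)
  have cA: "{x\<in>X. (x \<in> A) = True} = A" "{x\<in>X. (x \<in> A) = False} = X - A" using assms by auto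
  have G: "card (?G B') \<le> fact (card A) * fact (card X - card A)" for B'
  proof -
    have "card (?G B') \<le> (\<Prod>c\<in>{True,False}. fact (card {x\<in>X. (x \<in> A) = c}))"
      by (rule card_permutes_colouring_le) (use assms in auto)
    also have "\<dots> = fact (card {x\<in>X. (x \<in> A) = True}) * fact (card {x\<in>X. (x \<in> A) = False})" by simp
    also have "\<dots> = fact (card A) * fact (card X - card A)"
      unfolding cA using assms finB by (simp add: card_Diff_subset)
    finally show ?thesis .
  qed
  have "{p. p permutes X \<and> p ` A \<subseteq> B} \<subseteq> (\<Union>B'\<in>?Bs. ?G B')"
  proof
    fix p assume "p \<in> {p. p permutes X \<and> p ` A \<subseteq> B}"
    then have p: "p permutes X" "p ` A \<subseteq> B" by auto
    have "card (p ` A) = card A" by (rule card_image[OF permutes_inj_on[OF p(1)]])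
    moreover have "p \<in> ?G (p ` A)" using p by (auto simp: inj_image_mem_iff[OF permutes_inj[OF p(1)]])
    ultimately show "p \<in> (\<Union>B'\<in>?Bs. ?G B')" using p by blast
  qed
  then have "card {p. p permutes X \<and> p ` A \<subseteq> B} \<le> card (\<Union>B'\<in>?Bs. ?G B')"
    by (rule card_mono[rotated]) (use fin in \<open>auto intro: finite_subset[OF _ finite_permutations[OF assms(1)]]\<close>)
  also have "\<dots> \<le> (\<Sum>B'\<in>?Bs. card (?G B'))" by (rule card_UN_le[OF fin])
  also have "\<dots> \<le> (\<Sum>B'\<in>?Bs. fact (card A) * fact (card X - card A))" by (intro sum_mono G)
  also have "\<dots> = (card B choose card A) * (fact (card A) * fact (card X - card A))"
    using finB by (simp add: n_subsets)
  finally have "card {p. p permutes X \<and> p ` A \<subseteq> B} * (card X choose card A)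
      \<le> (card B choose card A) * (fact (card A) * fact (card X - card A)) * (card X choose card A)"
    by (rule mult_right_mono) simp
  also have "\<dots> = (card B choose card A) * (fact (card A) * fact (card X - card A) * (card X choose card A))"
    by (simp only: mult_ac)
  also have "fact (card A) * fact (card X - card A) * (card X choose card A) = (fact (card X) :: nat)"
    using assms by (intro binomial_fact_lemma card_mono)
  finally show ?thesis by (simp only: mult_ac)
qed

lemma card_permutes_ex_image_subset:
  assumes "finite X" "finite F" "\<And>f. f \<in> F \<Longrightarrow> A f \<subseteq> X \<and> B f \<subseteq> X \<and> card (A f) = a \<and> card (B f) = b"
  shows "card {p. p permutes X \<and> (\<exists>f\<in>F. p ` A f \<subseteq> B f)} * (card X choose a) \<le> card F * (fact (card X) * (b choose a))"
proof -
  have "{p. p permutes X \<and> (\<exists>f\<in>F. p ` A f \<subseteq> B f)} = (\<Union>f\<in>F. {p. p permutes X \<and> p ` A f \<subseteq> B f})" by blast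
  then have "card {p. p permutes X \<and> (\<exists>f\<in>F. p ` A f \<subseteq> B f)} \<le> (\<Sum>f\<in>F. card {p. p permutes X \<and> p ` A f \<subseteq> B f})"
    using card_UN_le[OF assms(2)] by metis
  then have "card {p. p permutes X \<and> (\<exists>f\<in>F. p ` A f \<subseteq> B f)} * (card X choose a)
     \<le> (\<Sum>f\<in>F. card {p. p permutes X \<and> p ` A f \<subseteq> B f}) * (card X choose a)" by (rule mult_right_mono) simp
  also have "\<dots> = (\<Sum>f\<in>F. card {p. p permutes X \<and> p ` A f \<subseteq> B f} * (card X choose a))" by (simp add: sum_distrib_right)
  also have "\<dots> \<le> (\<Sum>f\<in>F. fact (card X) * (b choose a))"
  proof (intro sum_mono)
    fix f assume "f \<in> F"
    then show "card {p. p permutes X \<and> p ` A f \<subseteq> B f} * (card X choose a) \<le> fact (card X) * (b choose a)"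
      using card_permutes_image_subset[OF assms(1), of "A f" "B f"] assms(3) by auto
  qed
  finally show ?thesis by simp
qed

text \<open>\<open>T\<close> is any set of size \<open>t\<close> that contains the image, so that
  the union bound runs over sets of fixed size. The condition on indices below \<open>K\<close>
  accounts for the additional edges.\<close>

definition covered :: "nat \<Rightarrow> nat \<Rightarrow> nat \<Rightarrow> nat \<Rightarrow> (nat \<Rightarrow> nat) \<Rightarrow> bool" where
  "covered n K s t p \<longleftrightarrow> (\<exists>S T. S \<subseteq> {..<2 * n} \<and> T \<subseteq> {..<2 * n} \<and> card S = s \<and> card T = t \<and>
     (\<forall>i\<in>S. i < K \<longrightarrow> i \<in> T) \<and> (\<forall>x<10 * n. x mod (2 * n) \<in> S \<longrightarrow> p x mod (2 * n) \<in> T))"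

definition over :: "nat \<Rightarrow> nat \<Rightarrow> nat set \<Rightarrow> nat set" where
  "over n m A = {x. x < 10 * n \<and> x mod m \<in> A}"

lemma over_subset: "over n m A \<subseteq> {..<10 * n}" by (auto simp: over_def)

lemma card_over2: "A \<subseteq> {..<2 * n} \<Longrightarrow> card (over n (2 * n) A) = 5 * card A"
  using card_slots_over[of A "2 * n" 5] by (simp add: over_def)

lemma card_over1: "A \<subseteq> {..<n} \<Longrightarrow> card (over n n A) = 10 * card A"
  using card_slots_over[of A n 10] by (simp add: over_def)

lemma image_over_iff:
  assumes "p permutes {..<10 * n}"
  shows "p ` over n m A \<subseteq> over n k B \<longleftrightarrow> (\<forall>x<10 * n. x mod m \<in> A \<longrightarrow> p x mod k \<in> B)"
  using permutes_in_image[OF assms] by (auto simp: over_def)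

abbreviation covered_perms :: "nat \<Rightarrow> nat \<Rightarrow> nat \<Rightarrow> nat \<Rightarrow> (nat \<Rightarrow> nat) set" where
  "covered_perms n K s t \<equiv> {p. p permutes {..<10 * n} \<and> covered n K s t p}"

abbreviation covering_pairs :: "nat \<Rightarrow> nat \<Rightarrow> nat \<Rightarrow> nat \<Rightarrow> (nat set \<times> nat set) set" where
  "covering_pairs n K s t \<equiv> {(S,T). S \<subseteq> {..<2 * n} \<and> T \<subseteq> {..<2 * n} \<and> card S = s \<and> card T = t \<and> (\<forall>i\<in>S. i < K \<longrightarrow> i \<in> T)}"

lemma card_covered:
  "card (covered_perms n K s t) * (10 * n choose (5 * s))
   \<le> card (covering_pairs n K s t)
      * (fact (10 * n) * ((5 * t) choose (5 * s)))"
proof -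
  let ?F = "covering_pairs n K s t"
  have fin: "finite ?F" by (rule finite_subset[of _ "Pow {..<2 * n} \<times> Pow {..<2 * n}"]) auto
  have "covered_perms n K s t
     = {p. p permutes {..<10 * n} \<and> (\<exists>f\<in>?F. p ` over n (2 * n) (fst f) \<subseteq> over n (2 * n) (snd f))}"
    by (rule Collect_cong, rule conj_cong[OF refl])
      (simp only: covered_def image_over_iff Bex_def split_paired_Ex mem_Collect_eq prod.case fst_conv snd_conv conj_assoc)
  then show ?thesis
    using card_permutes_ex_image_subset[of "{..<10 * n}" ?F "\<lambda>f. over n (2 * n) (fst f)" "\<lambda>f. over n (2 * n) (snd f)" "5 * s" "5 * t"]
      fin over_subset card_over2 by auto
qed

lemma card_covering_pairs_le:
  "card (covering_pairs n K s t)
    \<le> (2 * n choose s) * (2 * n choose t)"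
proof -
  let ?B = "\<lambda>s. {S. S \<subseteq> {..<2 * n} \<and> card S = s}"
  have fin: "finite (?B s)" for s by (rule finite_subset[of _ "Pow {..<2 * n}"]) auto
  have "card (covering_pairs n K s t) \<le> card (?B s \<times> ?B t)"
    using fin by (intro card_mono) auto
  then show ?thesis by (simp add: card_cartesian_product n_subsets)
qed

text \<open>Each index contributes independently: above \<open>K\<close> any of the four memberships
  in S and T is possible, below \<open>K\<close> membership in S without T is excluded, which leaves
  1 + w + y w.\<close>

lemma card_covering_pairs_genfun:
  fixes y w :: real
  assumes K: "K \<le> 2 * n" and pos: "y \<ge> 0" "w \<ge> 0"
  shows "card (covering_pairs n K s t) * (y ^ s * w ^ t)
     \<le> (1 + w + y * w) ^ K * ((1 + y) * (1 + w)) ^ (2 * n - K)"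
proof -
  let ?X = "{..<2 * n}"
  let ?F = "{(S,T). S \<subseteq> ?X \<and> T \<subseteq> ?X \<and> card S = s \<and> card T = t \<and> (\<forall>i\<in>S. i < K \<longrightarrow> i \<in> T)}"
  let ?a = "\<lambda>T i. if i < K \<and> i \<notin> T then 0 else y"
  let ?w = "\<lambda>T. \<Prod>i\<in>?X. if i \<in> T then w else 1"
  have wT: "?w T = w ^ card T" if "T \<subseteq> ?X" for T
  proof -
    have "?X \<inter> {i. i \<in> T} = T" using that by auto
    then show ?thesis by (simp add: prod.If_cases)
  qed
  have val: "(\<Prod>i\<in>?X. if i \<in> S then ?a T i else 1) * ?w T = y ^ s * w ^ t" if "(S,T) \<in> ?F" for S T
  proof -
    have "(\<Prod>i\<in>?X. if i \<in> S then ?a T i else 1) = (\<Prod>i\<in>?X. if i \<in> S then y else 1)"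
      using that by (intro prod.cong) auto
    also have "\<dots> = y ^ card S"
    proof -
      have "?X \<inter> {i. i \<in> S} = S" using that by auto
      then show ?thesis by (simp add: prod.If_cases)
    qed
    finally show ?thesis using that wT by auto
  qed
  have nn: "0 \<le> (\<Prod>i\<in>?X. if i \<in> S then ?a T i else 1) * ?w T" for S T
    using pos by (intro mult_nonneg_nonneg prod_nonneg ballI) auto
  have "card ?F * (y ^ s * w ^ t) = (\<Sum>f\<in>?F. case f of (S,T) \<Rightarrow> (\<Prod>i\<in>?X. if i \<in> S then ?a T i else 1) * ?w T)"
    using val by (simp add: case_prod_beta' sum.cong[of ?F ?F _ "\<lambda>_. y ^ s * w ^ t"] split_beta)
  also have "\<dots> \<le> (\<Sum>f\<in>Pow ?X \<times> Pow ?X. case f of (S,T) \<Rightarrow> (\<Prod>i\<in>?X. if i \<in> S then ?a T i else 1) * ?w T)"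
    by (intro sum_mono2) (auto simp only: nn split: prod.splits)
  also have "\<dots> = (\<Sum>S\<in>Pow ?X. \<Sum>T\<in>Pow ?X. (\<Prod>i\<in>?X. if i \<in> S then ?a T i else 1) * ?w T)"
    by (simp only: sum.cartesian_product)
  also have "\<dots> = (\<Sum>T\<in>Pow ?X. \<Sum>S\<in>Pow ?X. (\<Prod>i\<in>?X. if i \<in> S then ?a T i else 1) * ?w T)"
    by (rule sum.swap)
  also have "\<dots> = (\<Sum>T\<in>Pow ?X. (\<Prod>i\<in>?X. ?a T i + 1) * ?w T)"
    by (simp only: sum_distrib_right[symmetric] sum_Pow_prod_if[OF finite_lessThan])
  also have "\<dots> = (\<Sum>T\<in>Pow ?X. \<Prod>i\<in>?X. if i \<in> T then w * (1 + y) else (if i < K then 1 else 1 + y))"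
    unfolding prod.distrib[symmetric] by (intro sum.cong prod.cong refl) auto
  also have "\<dots> = (\<Prod>i\<in>?X. w * (1 + y) + (if i < K then 1 else 1 + y))"
    by (rule sum_Pow_prod_if) simp
  also have "\<dots> = (\<Prod>i\<in>?X. if i < K then 1 + w + y * w else (1 + y) * (1 + w))"
    by (intro prod.cong refl) (auto simp: algebra_simps)
  also have "\<dots> = (1 + w + y * w) ^ K * ((1 + y) * (1 + w)) ^ (2 * n - K)"
  proof -
    have "?X \<inter> {i. i < K} = {..<K}" "?X \<inter> - {i. i < K} = {K..<2 * n}" using K by auto
    then show ?thesis by (simp add: prod.If_cases)
  qed
  finally show ?thesis .
qed

text \<open>A relaxation of confinement that looks at the slots only and ignores the additional
  edges. Its first moment is small for \<open>m\<close> up to 0.305 N, where N = 2 n.\<close>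

definition crowded :: "nat \<Rightarrow> nat \<Rightarrow> (nat \<Rightarrow> nat) \<Rightarrow> bool" where
  "crowded n m p \<longleftrightarrow> (\<exists>U P. U \<subseteq> {..<2 * n} \<and> P \<subseteq> {..<n} \<and> card U = Suc m \<and> card P = m \<and>
     (\<forall>x<10 * n. x mod (2 * n) \<in> U \<longrightarrow> p x mod n \<in> P))"

abbreviation crowded_perms :: "nat \<Rightarrow> nat \<Rightarrow> (nat \<Rightarrow> nat) set" where
  "crowded_perms n m \<equiv> {p. p permutes {..<10 * n} \<and> crowded n m p}"

lemma card_crowded:
  "card (crowded_perms n m) * (10 * n choose (5 * Suc m))
   \<le> (2 * n choose Suc m) * (n choose m) * (fact (10 * n) * ((10 * m) choose (5 * Suc m)))"
proof -
  let ?F = "{U. U \<subseteq> {..<2 * n} \<and> card U = Suc m} \<times> {P. P \<subseteq> {..<n} \<and> card P = m}"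
  have fin: "finite ?F" by (rule finite_subset[of _ "Pow {..<2 * n} \<times> Pow {..<n}"]) auto
  have "crowded_perms n m
     = {p. p permutes {..<10 * n} \<and> (\<exists>f\<in>?F. p ` over n (2 * n) (fst f) \<subseteq> over n n (snd f))}"
    by (rule Collect_cong, rule conj_cong[OF refl])
      (simp only: crowded_def image_over_iff Bex_def split_paired_Ex mem_Collect_eq mem_Sigma_iff fst_conv snd_conv, blast)
  moreover have "card ?F = (2 * n choose Suc m) * (n choose m)" by (simp add: card_cartesian_product n_subsets)
  ultimately show ?thesis
    using card_permutes_ex_image_subset[of "{..<10 * n}" ?F "\<lambda>f. over n (2 * n) (fst f)" "\<lambda>f. over n n (snd f)" "5 * Suc m" "10 * m"]
      fin over_subset card_over2 card_over1 by auto
qed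

section \<open>The random graph\<close>

text \<open>Indices are shifted by one because slots are counted from 0 and vertices from 1.
  Parallel edges collapse, so the number of edges is only bounded above.\<close>

definition random_graph :: "nat \<Rightarrow> nat \<Rightarrow> (nat \<Rightarrow> nat) \<Rightarrow> (nat \<times> nat) set" where
  "random_graph n K p = (\<lambda>x. (Suc (x mod (2 * n)), Suc (p x mod (2 * n)))) ` {..<10 * n} \<union> (\<lambda>i. (Suc i, Suc i)) ` {..<K}"

lemma random_graph_subset:
  assumes "n > 0" "K \<le> n"
  shows "random_graph n K p \<subseteq> {1..2 * n} \<times> {1..2 * n}"
  using assms by (auto simp: random_graph_def Suc_le_eq)

lemma card_random_graph: "card (random_graph n K p) \<le> 10 * n + K"
proof -
  have "card (random_graph n K p) \<le> card ((\<lambda>x. (Suc (x mod (2 * n)), Suc (p x mod (2 * n)))) ` {..<10 * n}) + card ((\<lambda>i. (Suc i, Suc i)) ` {..<K})"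
    unfolding random_graph_def by (rule card_Un_le)
  also have "\<dots> \<le> card {..<10 * n} + card {..<K}" by (intro add_mono card_image_le) auto
  finally show ?thesis by simp
qed

text \<open>The image is padded to a set of exactly \<open>t\<close> right vertices, so that one
  value of \<open>t\<close> per size of \<open>S\<close> represents all violating images.\<close>

lemma covered_if_small_image:
  assumes n: "n > 0" and K: "K \<le> n" and S: "S \<subseteq> {1..2 * n}" and t: "card (random_graph n K p `` S) \<le> t" "t \<le> 2 * n"
  shows "covered n K (card S) t p"
proof -
  let ?E = "random_graph n K p"
  let ?S = "(\<lambda>i. i - 1) ` S" and ?T = "(\<lambda>i. i - 1) ` (?E `` S)"
  have im: "?E `` S \<subseteq> {1..2 * n}" using random_graph_subset[OF n K, of p] by auto
  have inj: "inj_on (\<lambda>i. i - 1) {1..2 * n}" by (rule inj_on_diff_nat) auto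
  have cS: "card ?S = card S" by (rule card_image[OF inj_on_subset[OF inj S]])
  have cT: "card ?T = card (?E `` S)" by (rule card_image[OF inj_on_subset[OF inj im]])
  have shift: "(\<lambda>i. i - 1) ` {1..2 * n} \<subseteq> {..<2 * n}" by auto
  have "?T \<subseteq> {..<2 * n}" by (rule subset_trans[OF image_mono[OF im] shift])
  then obtain T where T: "?T \<subseteq> T" "T \<subseteq> {..<2 * n}" "card T = t"
    using exists_subset_between[of ?T t "{..<2 * n}"] t cT by auto
  have inS: "Suc i \<in> S" if "i \<in> ?S" for i
  proof -
    from that obtain j where j: "j \<in> S" "i = j - 1" by auto
    then have "1 \<le> j" using S by auto
    then have "Suc i = j" using j by simp
    then show ?thesis using j by simp
  qed
  have inT: "i \<in> T" if "(Suc j, Suc i) \<in> ?E" "j \<in> ?S" for i j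
  proof -
    have "Suc i \<in> ?E `` S" using that inS by auto
    then have "Suc i - 1 \<in> ?T" by blast
    then show ?thesis using T by auto
  qed
  have "\<forall>i\<in>?S. i < K \<longrightarrow> i \<in> T"
  proof (intro ballI impI)
    fix i assume "i \<in> ?S" "i < K"
    then show "i \<in> T" using inT[of i i] by (auto simp: random_graph_def)
  qed
  moreover have "\<forall>x<10 * n. x mod (2 * n) \<in> ?S \<longrightarrow> p x mod (2 * n) \<in> T"
    using inT by (auto simp: random_graph_def)
  moreover have "?S \<subseteq> {..<2 * n}" by (rule subset_trans[OF image_mono[OF S] shift])
  ultimately show ?thesis using T cS unfolding covered_def by blast
qed

lemma crowded_if_confined:
  assumes "P \<subseteq> {..<n}" "card P = m" "m < card (confined n K p P)"
  shows "crowded n m p"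
proof -
  have "Suc m \<le> card (confined n K p P)" using assms(3) by simp
  from obtain_subset_with_card_n[OF this] obtain U where U: "U \<subseteq> confined n K p P" "card U = Suc m"
    by metis
  have "\<forall>x<10 * n. x mod (2 * n) \<in> U \<longrightarrow> p x mod n \<in> P"
  proof (intro allI impI)
    fix x assume x: "x < 10 * n" "x mod (2 * n) \<in> U"
    then have "x \<in> fiber 5 (2 * n) (x mod (2 * n))" by (simp add: fiber_def)
    then have "p x mod n \<in> nbr_pairs n K p (x mod (2 * n))" by (auto simp: nbr_pairs_def)
    then show "p x mod n \<in> P" using x U by (auto simp: confined_def)
  qed
  moreover have "U \<subseteq> {..<2 * n}" using U by (auto simp: confined_def)
  ultimately show ?thesis using U assms unfolding crowded_def by blast
qed

text \<open>The translation of (b): if \<open>U\<close> were adjacent to fewer pairs than it has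
  vertices, those pairs would confine more left vertices than their number.\<close>

lemma confining_pairs:
  assumes n: "n > 0" and K: "K \<le> n" and U: "U \<subseteq> {1..2 * n}"
  shows "\<exists>P\<subseteq>{..<n}. card P = card (adjacent_pairs (random_graph n K p) (half_shift_pairs (2 * n)) U)
     \<and> card U \<le> card (confined n K p P)"
proof -
  let ?E = "random_graph n K p"
  let ?A = "adjacent_pairs ?E (half_shift_pairs (2 * n)) U"
  let ?pr = "\<lambda>r. {Suc r, Suc r + n}"
  define P where "P = {r. r < n \<and> ?pr r \<in> ?A}"
  have inj: "inj_on ?pr {..<n}"
  proof (rule inj_onI)
    fix r r' assume "r \<in> {..<n}" "r' \<in> {..<n}" and eq: "?pr r = ?pr r'"
    have "Min (?pr r) = Suc r" "Min (?pr r') = Suc r'" by simp_all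
    then show "r = r'" using eq by (metis Suc_inject)
  qed
  have "half_shift_pairs (2 * n) = ?pr ` {..<n}"
  proof -
    have "{1..n} = Suc ` {..<n}" by (metis One_nat_def image_Suc_lessThan)
    then show ?thesis by (simp add: half_shift_pairs_def image_image)
  qed
  then have "?A = ?pr ` P" by (auto simp: P_def adjacent_pairs_def)
  then have cP: "card ?A = card P" using card_image[OF inj_on_subset[OF inj, of P]] by (auto simp: P_def)
  have mem: "r \<in> P" if "(Suc i, Suc j) \<in> ?E" "Suc i \<in> U" "j mod n = r" "j < 2 * n" for i j r
  proof -
    have rn: "r < n" using that n by auto
    have "j = r \<or> j = r + n"
    proof (cases "j < n")
      case False
      then have "j mod n = j - n" using that(4) by (simp add: mod_if)
      then show ?thesis using False that by auto
    qed (use that in auto)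
    then have "Suc j \<in> ?pr r" by auto
    moreover have "?pr r \<in> half_shift_pairs (2 * n)"
      using rn \<open>half_shift_pairs (2 * n) = ?pr ` {..<n}\<close> by auto
    ultimately show ?thesis using that rn unfolding P_def adjacent_pairs_def by blast
  qed
  have injU: "inj_on (\<lambda>i. i - 1) U" by (rule inj_on_diff_nat) (use U in auto)
  have "(\<lambda>i. i - 1) ` U \<subseteq> confined n K p P"
  proof
    fix i assume "i \<in> (\<lambda>i. i - 1) ` U"
    then obtain j where "j \<in> U" "i = j - 1" by auto
    moreover from \<open>j \<in> U\<close> have "1 \<le> j" "j \<le> 2 * n" using U by auto
    ultimately have i: "Suc i \<in> U" "i < 2 * n" by auto
    have "nbr_pairs n K p i \<subseteq> P"
    proof
      fix r assume "r \<in> nbr_pairs n K p i"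
      then consider (slot) s where "s \<in> fiber 5 (2 * n) i" "r = p s mod n" | (extra) "r = i" "i < K"
        by (auto simp: nbr_pairs_def)
      then show "r \<in> P"
      proof cases
        case slot
        then have "(Suc i, Suc (p s mod (2 * n))) \<in> ?E" by (auto simp: random_graph_def fiber_def)
        then show ?thesis by (rule mem) (use i n slot in \<open>auto simp: mod_mod_cancel\<close>)
      next
        case extra
        then have "(Suc i, Suc i) \<in> ?E" by (auto simp: random_graph_def)
        then show ?thesis by (rule mem) (use i extra K in auto)
      qed
    qed
    then show "i \<in> confined n K p P" using i by (simp add: confined_def)
  qed
  then have "card ((\<lambda>i. i - 1) ` U) \<le> card (confined n K p P)" by (intro card_mono) auto
  then have "card U \<le> card (confined n K p P)" using card_image[OF injU] by simp
  then show ?thesis using cP by (intro exI[of _ P]) (auto simp: P_def)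
qed

section \<open>Exponential rates\<close>

definition entropy :: "real \<Rightarrow> real" where
  "entropy x = - x * ln x - (1 - x) * ln (1 - x)"

lemma power_as_exp: "(0::real) < a \<Longrightarrow> a ^ k = exp (real k * ln a)"
  by (simp add: exp_of_nat_mult)

lemma binomial_ge_entropy:
  assumes "0 < k" "k < n"
  shows "exp (real n * entropy (real k / n)) \<le> (real n + 1) * real (n choose k)"
proof -
  let ?q = "real k / n"
  have q: "0 < ?q" "?q < 1" using assms by auto
  have "?q ^ k * (1 - ?q) ^ (n - k) = exp (real k * ln ?q + real (n - k) * ln (1 - ?q))"
    using q by (simp add: power_as_exp exp_add)
  also have "real k * ln ?q + real (n - k) * ln (1 - ?q) = - (real n * entropy ?q)"
  proof -
    have "real k = n * ?q" "real (n - k) = n * (1 - ?q)" using assms by (auto simp: of_nat_diff field_simps)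
    then have "real k * ln ?q + real (n - k) * ln (1 - ?q) = n * ?q * ln ?q + n * (1 - ?q) * ln (1 - ?q)" by metis
    then show ?thesis by (simp only: entropy_def) (simp add: algebra_simps)
  qed
  finally have "1 \<le> (real n + 1) * real (n choose k) * exp (- (real n * entropy ?q))"
    using binomial_mode[of k n] assms by (simp add: mult.assoc)
  then show ?thesis by (simp add: exp_minus field_simps)
qed

lemma binomial_le_entropy:
  assumes "0 < k" "k < n"
  shows "real (n choose k) \<le> exp (real n * entropy (real k / n))"
proof -
  let ?q = "real k / n" and ?t = "real k / (real n - k)"
  have q: "0 < ?q" "?q < 1" and t: "?t > 0" using assms by auto
  have t1: "1 + ?t = 1 / (1 - ?q)" "?t = ?q / (1 - ?q)" using assms by (auto simp: field_simps)
  have "real (n choose k) \<le> (1 + ?t) ^ n / ?t ^ k" by (rule binomial_le_genfun[OF t])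
  also have "\<dots> = exp (real n * ln (1 + ?t) - real k * ln ?t)"
    using t by (simp add: power_as_exp exp_diff)
  also have "real n * ln (1 + ?t) - real k * ln ?t = real n * entropy ?q"
  proof -
    have "ln (1 + ?t) = - ln (1 - ?q)"
      unfolding t1(1) using q ln_divide_pos[of 1 "1 - ?q"] by simp
    moreover have "ln ?t = ln ?q - ln (1 - ?q)"
      unfolding t1(2) by (rule ln_divide_pos) (use q in auto)
    moreover have "real k = n * ?q" using assms by auto
    ultimately have "real n * ln (1 + ?t) - real k * ln ?t = real n * (- ln (1 - ?q)) - n * ?q * (ln ?q - ln (1 - ?q))" by metis
    then show ?thesis by (simp only: entropy_def) (simp add: algebra_simps)
  qed
  finally show ?thesis .
qed

lemma le_if_second_deriv_nonneg:
  fixes f :: "real \<Rightarrow> real"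
  assumes "\<And>x. x \<in> {a..b} \<Longrightarrow> (f has_real_derivative f' x) (at x)"
    and "\<And>x. x \<in> {a..b} \<Longrightarrow> (f' has_real_derivative f'' x) (at x)"
    and "\<And>x. x \<in> {a..b} \<Longrightarrow> 0 \<le> f'' x"
    and "f a \<le> c" "f b \<le> c" "x \<in> {a..b}"
  shows "f x \<le> c"
proof -
  have "convex_on {a..b} f" by (rule f''_ge0_imp_convex[of _ f f' f'']) (use assms in auto)
  from convex_on_le_max[OF this assms(6)] show ?thesis using assms by simp
qed

text \<open>As the base is at most \<open>rho\<close>, the s-th power is at most (c / N) s
  rho^(s-1). These bounds sum to the derivative of the geometric series, which leaves a total of
  order 1 / N.\<close>

lemma sum_power_small:
  assumes "0 < c" "0 \<le> rho" "rho < 1" "\<And>s. s \<in> S \<Longrightarrow> 0 < s \<and> c * real s / N \<le> rho" "finite S" "N > 0"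
  shows "(\<Sum>s\<in>S. (c * real s / N) ^ s) \<le> (c / (1 - rho)\<^sup>2) / N"
proof -
  have sums: "(\<lambda>n. of_nat (Suc n) * rho ^ n) sums (1 / (1 - rho)\<^sup>2)"
    using assms by (intro geometric_deriv_sums) auto
  have each: "(c * real s / N) ^ s \<le> c / N * (of_nat (Suc (s - 1)) * rho ^ (s - 1))" if "s \<in> S" for s
  proof -
    have s: "s = Suc (s - 1)" "c * real s / N \<le> rho" using assms(4)[OF that] by auto
    have "(c * real s / N) ^ s = (c * real s / N) * (c * real s / N) ^ (s - 1)" using s(1) by (metis power_Suc)
    also have "\<dots> \<le> (c * real s / N) * rho ^ (s - 1)"
      using assms s(2) by (intro mult_left_mono power_mono) auto
    also have "\<dots> = c / N * (real (Suc (s - 1)) * rho ^ (s - 1))" using s(1) by simp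
    finally show ?thesis .
  qed
  have inj: "inj_on (\<lambda>s. s - 1) S" using assms(4) by (auto simp: inj_on_def) (metis Suc_pred)
  have "(\<Sum>s\<in>S. (c * real s / N) ^ s) \<le> (\<Sum>s\<in>S. c / N * (of_nat (Suc (s - 1)) * rho ^ (s - 1)))"
    by (intro sum_mono each)
  also have "\<dots> = c / N * (\<Sum>s\<in>(\<lambda>s. s - 1) ` S. of_nat (Suc s) * rho ^ s)"
    by (simp only: sum_distrib_left sum.reindex[OF inj] o_def)
  also have "\<dots> \<le> c / N * (1 / (1 - rho)\<^sup>2)"
    using assms sums by (intro mult_left_mono sum_le_suminf[OF sums_summable[OF sums], THEN order_trans]) (auto simp: sums_iff)
  finally show ?thesis by (simp add: mult.commute)
qed

text \<open>The index 5 (m + c) is within a bounded distance of the middle of row 10 m, so the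
  coefficient is 2^(10 m) up to a polynomial and a constant. Applying \<open>binomial_mode\<close>
  at (1 + c/m) / 2 and 1 + t \<le> exp t, the deviation costs at most exp (10 c^2 / m), where c
  \<le> 10 \<le> m. The factor \<open>q ^ 100\<close> absorbs the excess of \<open>q\<close> over
  \<open>1 - q\<close> in the weights.\<close>

lemma middle_binomial_ge:
  fixes q :: real
  assumes m: "10 \<le> m" and c: "1 \<le> c" "c \<le> 10" "c < m" and q: "0 < q" "q \<le> 1 / 2"
  shows "(4 * q * (1 - q)) ^ (5 * m) * (q ^ 100 * exp (- 100))
    \<le> (10 * real m + 1) * (real (10 * m choose (5 * (m + c))) * (q ^ (5 * (m + c)) * (1 - q) ^ (10 * m - 5 * (m + c))))"
proof -
  let ?u = "5 * (m + c)"
  let ?C = "real (10 * m choose ?u)"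
  have sub: "10 * m - ?u = 5 * (m - c)" using c by simp
  have uM: "?u \<le> 10 * m" using c by simp
  define r where "r = real ?u / real (10 * m)"
  have mp: "real m > 0" using m by simp
  have r: "r = (1 + c / m) / 2" "1 - r = (1 - c / m) / 2" using mp by (auto simp: r_def field_simps)
  have cm: "0 \<le> real c / m" "real c / m < 1" using c mp by auto
  have "(1 + c / m) ^ ?u * (1 - c / m) ^ (10 * m - ?u) \<le> exp (c / m) ^ ?u * exp (- (c / m)) ^ (10 * m - ?u)"
    using cm exp_ge_add_one_self[of "- (real c / m)"] exp_ge_add_one_self[of "real c / m"]
    by (intro mult_mono power_mono) auto
  also have "\<dots> = exp (real ?u * (c / m) - real (10 * m - ?u) * (c / m))"
    by (simp only: exp_of_nat_mult[symmetric] exp_add[symmetric]) simp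
  also have "real ?u * (c / m) - real (10 * m - ?u) * (c / m) = 10 * (real c * c) / m"
    unfolding sub using c mp by (simp add: of_nat_diff field_simps)
  also have "10 * (real c * c) / m \<le> 100"
  proof -
    have "real c * c \<le> 10 * 10" using c by (intro mult_mono) auto
    then have "10 * (real c * c) \<le> 100 * real m" using m by simp
    then show ?thesis using mp by (simp add: field_simps)
  qed
  finally have e100: "(1 + c / m) ^ ?u * (1 - c / m) ^ (10 * m - ?u) \<le> exp 100" by simp
  have "r ^ ?u * (1 - r) ^ (10 * m - ?u) = ((1 + c / m) ^ ?u * (1 - c / m) ^ (10 * m - ?u)) / 2 ^ (?u + (10 * m - ?u))"
    by (simp only: r(2), simp only: r(1), simp add: power_divide power_add)
  also have "\<dots> \<le> exp 100 / 2 ^ (10 * m)"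
    using e100 uM by (simp add: divide_right_mono)
  finally have rr: "r ^ ?u * (1 - r) ^ (10 * m - ?u) \<le> exp 100 / 2 ^ (10 * m)" .
  have "1 \<le> (real (10 * m) + 1) * (?C * r ^ ?u * (1 - r) ^ (10 * m - ?u))"
    unfolding r_def by (rule binomial_mode) (use uM m in auto)
  also have "\<dots> = (10 * real m + 1) * ?C * (r ^ ?u * (1 - r) ^ (10 * m - ?u))" by simp
  also have "\<dots> \<le> (10 * real m + 1) * ?C * (exp 100 / 2 ^ (10 * m))"
    using rr by (intro mult_left_mono) auto
  finally have 1: "2 ^ (10 * m) * exp (- 100) \<le> (10 * real m + 1) * ?C"
    by (simp add: exp_minus field_simps)
  have 2: "(q * (1 - q)) ^ (5 * m) * q ^ 100 \<le> q ^ ?u * (1 - q) ^ (10 * m - ?u)"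
  proof -
    have "(q * (1 - q)) ^ (5 * m) * q ^ 100 \<le> (q * (1 - q)) ^ (5 * m) * q ^ (10 * c)"
      using q c by (intro mult_left_mono power_decreasing) auto
    also have "\<dots> = (q * (1 - q)) ^ (5 * (m - c)) * ((q * (1 - q)) ^ (5 * c) * q ^ (10 * c))"
    proof -
      have "5 * m = 5 * (m - c) + 5 * c" using c by simp
      then show ?thesis by (metis (no_types) power_add mult.assoc)
    qed
    also have "\<dots> \<le> (q * (1 - q)) ^ (5 * (m - c)) * (1 * q ^ (10 * c))"
      using q by (intro mult_left_mono mult_right_mono power_le_one) (auto intro: mult_le_one)
    also have "\<dots> = q ^ (5 * (m - c) + 10 * c) * (1 - q) ^ (5 * (m - c))"
      by (simp add: power_mult_distrib power_add)
    also have "5 * (m - c) + 10 * c = ?u" using c by simp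
    finally show ?thesis by (simp only: sub)
  qed
  have "(2 ^ (10 * m) * exp (- 100)) * ((q * (1 - q)) ^ (5 * m) * q ^ 100) \<le> ((10 * real m + 1) * ?C) * (q ^ ?u * (1 - q) ^ (10 * m - ?u))"
    by (rule mult_mono[OF 1 2]) (use q in auto)
  moreover have "(4 * q * (1 - q)) ^ (5 * m) = 2 ^ (10 * m) * (q * (1 - q)) ^ (5 * m)"
  proof -
    have "(2::real) ^ (10 * m) = (2 ^ 2) ^ (5 * m)" by (simp only: power_mult[symmetric]) simp
    then show ?thesis by (simp add: power_mult_distrib)
  qed
  ultimately show ?thesis by (simp only: mult_ac)
qed

text \<open>The rate per left vertex of the bound in \<open>card_ex_tight\<close>, with x = m / N
  and N = 2 n. The coefficients are the limits of K / N, (n - K) / N and (2 n - K) / N; the entropy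
  comes from the choice of the 10 m slots, and \<open>W\<close> collects the bases of all m-th
  powers.\<close>

definition exponent :: "real \<Rightarrow> real \<Rightarrow> real \<Rightarrow> real \<Rightarrow> real \<Rightarrow> real" where
  "exponent X Y F W x = 13/40 * ln X + 7/40 * ln Y + 27/40 * ln F - 5 * entropy (2 * x) - x * ln W"

text \<open>One factor \<open>10 * n + 1\<close> stems from the unknown number of critical slots and
  two from the lower bounds for the two binomial coefficients. Rounding \<open>K\<close> down costs
  at most one factor \<open>Y\<close> and one factor \<open>F\<close>.\<close>

lemma card_ex_tight_exp:
  fixes q eps y z th om v X Y F W :: real and kap :: "nat \<Rightarrow> real"
  assumes n: "n > 0" and K: "real K \<le> 13/40 * (2 * n)" "13/40 * (2 * n) < real K + 1"
    and m: "10 \<le> m" "m < n" and c: "1 \<le> c" "c \<le> 10" "c < m"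
    and q: "0 < q" "q \<le> 1 / 2" and eps: "0 < eps" "eps \<le> 1" and pos: "y \<ge> 1" "z > 0" "th > 0" "om > 0" "v > 0"
    and omega: "\<And>i. i < n \<Longrightarrow> upper_tail q (cP i - 1) \<le> om * upper_tail q (cP i)"
    and kappa: "\<And>i rho. i < n \<Longrightarrow> 0 \<le> rho \<Longrightarrow> rho \<le> 1 \<Longrightarrow> rho \<in> B \<Longrightarrow> lower_tail eps (rho / th) (1 - rho) (cQ i) \<le> kap i"
    and kap: "\<And>i. i < n \<Longrightarrow> 0 \<le> kap i"
    and X: "\<And>i. i < n \<Longrightarrow> v * upper_tail q (cP i) * left_total z th (y * om) + kap i * (1 + z) ^ 5 \<le> X"
    and Y: "\<And>i. i < n \<Longrightarrow> v * upper_tail q (cP i) + kap i \<le> Y"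
    and F: "left_total z th y \<le> F"
    and W: "0 < W" "W \<le> (4 * q * (1 - q) * z\<^sup>2) ^ 5 * y * v"
    and XYF: "1 \<le> X" "1 \<le> Y" "1 \<le> F"
  shows "card (tight_perms n K cP cQ m (m + c) B)
    \<le> fact (10 * n) * ((10 * real n + 1) ^ 3 * (Y * F / (q ^ 100 * exp (- 100) * eps ^ 11)) * exp (2 * real n * exponent X Y F W (m / (2 * n))))"
    (is "real (card ?T) \<le> _")
proof -
  let ?u = "m + c"
  let ?C1 = "real (10 * n choose (10 * m))" and ?C2 = "real (10 * m choose (5 * ?u))"
  let ?Q = "q ^ (5 * ?u) * (1 - q) ^ (10 * m - 5 * ?u)"
  let ?k0 = "q ^ 100 * exp (- 100) * eps ^ 11"
  let ?H = "exp (10 * real n * entropy (m / n))"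
  let ?F1 = "left_total z th y"
  have Kn: "K \<le> n" using K by linarith
  have F1: "?F1 \<ge> 0" using pos by (auto intro!: sum_nonneg simp: left_weight_def)
  have k0: "?k0 > 0" using q eps by simp
  have Wpos: "W > 0" by (rule W(1))
  have main: "card ?T * (?C1 * ?C2 * (?Q * eps ^ 11) * (z ^ (10 * m) * y ^ ?u) * v ^ m)
     \<le> fact (10 * n) * (10 * real n + 1) * (X ^ K * Y ^ (n - K) * ?F1 ^ (2 * n - K))"
    by (rule card_ex_tight[where B = B and om = om and th = th]) (use n Kn m c q eps pos omega kappa kap X Y in auto)
  have c1: "?H / (10 * real n + 1) \<le> ?C1"
    using binomial_ge_entropy[of "10 * m" "10 * n"] m by (simp add: field_simps)
  have c2: "(4 * q * (1 - q)) ^ (5 * m) * (q ^ 100 * exp (- 100)) / (10 * real n + 1) \<le> ?C2 * ?Q"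
  proof -
    have "(4 * q * (1 - q)) ^ (5 * m) * (q ^ 100 * exp (- 100)) \<le> (10 * real m + 1) * (?C2 * ?Q)"
      by (rule middle_binomial_ge[OF m(1) c q])
    also have "\<dots> \<le> (10 * real n + 1) * (?C2 * ?Q)" using m q by (intro mult_right_mono) auto
    finally show ?thesis by (simp add: field_simps)
  qed
  have c3: "z ^ (10 * m) * y ^ m \<le> z ^ (10 * m) * y ^ ?u"
    using pos by (intro mult_left_mono power_increasing) auto
  have "(?H / (10 * real n + 1)) * ((4 * q * (1 - q)) ^ (5 * m) * (q ^ 100 * exp (- 100)) / (10 * real n + 1)) * (z ^ (10 * m) * y ^ m) * (eps ^ 11 * v ^ m)
     \<le> ?C1 * (?C2 * ?Q) * (z ^ (10 * m) * y ^ ?u) * (eps ^ 11 * v ^ m)"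
    using q pos eps by (intro mult_mono c1 c2 c3) auto
  also have "\<dots> = ?C1 * ?C2 * (?Q * eps ^ 11) * (z ^ (10 * m) * y ^ ?u) * v ^ m" by (simp only: mult_ac)
  finally have pre: "(?H / (10 * real n + 1)) * ((4 * q * (1 - q)) ^ (5 * m) * (q ^ 100 * exp (- 100)) / (10 * real n + 1)) * (z ^ (10 * m) * y ^ m) * (eps ^ 11 * v ^ m)
     \<le> ?C1 * ?C2 * (?Q * eps ^ 11) * (z ^ (10 * m) * y ^ ?u) * v ^ m" .
  have low: "?H * W ^ m * ?k0 / (10 * real n + 1)\<^sup>2 \<le> ?C1 * ?C2 * (?Q * eps ^ 11) * (z ^ (10 * m) * y ^ ?u) * v ^ m"
  proof -
    have "W ^ m \<le> ((4 * q * (1 - q) * z\<^sup>2) ^ 5 * y * v) ^ m"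
      using W by (intro power_mono) auto
    also have "\<dots> = (4 * q * (1 - q)) ^ (5 * m) * z ^ (10 * m) * y ^ m * v ^ m"
      by (simp add: power_mult_distrib power_mult[symmetric] mult_ac)
    finally have "?H * W ^ m * ?k0 / (10 * real n + 1)\<^sup>2
       \<le> ?H * ((4 * q * (1 - q)) ^ (5 * m) * z ^ (10 * m) * y ^ m * v ^ m) * ?k0 / (10 * real n + 1)\<^sup>2"
      using k0 by (intro divide_right_mono mult_right_mono mult_left_mono) auto
    also have "\<dots> = (?H / (10 * real n + 1)) * ((4 * q * (1 - q)) ^ (5 * m) * (q ^ 100 * exp (- 100)) / (10 * real n + 1)) * (z ^ (10 * m) * y ^ m) * (eps ^ 11 * v ^ m)"
      by (simp add: power2_eq_square mult_ac)
    finally show ?thesis using pre by linarith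
  qed
  have up: "X ^ K * Y ^ (n - K) * ?F1 ^ (2 * n - K) \<le> Y * F * exp (2 * real n * (13/40 * ln X + 7/40 * ln Y + 27/40 * ln F))"
  proof -
    have "X ^ K * Y ^ (n - K) * ?F1 ^ (2 * n - K) \<le> X ^ K * Y ^ (n - K) * F ^ (2 * n - K)"
      using F F1 XYF by (intro mult_left_mono power_mono) auto
    also have "\<dots> = exp (real K * ln X + real (n - K) * ln Y + real (2 * n - K) * ln F)"
      using XYF by (simp add: power_as_exp exp_add)
    also have "\<dots> \<le> exp (ln Y + ln F + 2 * real n * (13/40 * ln X + 7/40 * ln Y + 27/40 * ln F))"
    proof -
      have "real K * ln X \<le> 13/40 * (2 * n) * ln X" using K XYF by (intro mult_right_mono) auto
      moreover have "real (n - K) * ln Y \<le> (n - 13/40 * (2 * n) + 1) * ln Y"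
        using K Kn XYF by (intro mult_right_mono) (auto simp: of_nat_diff)
      moreover have "real (2 * n - K) * ln F \<le> (2 * n - 13/40 * (2 * n) + 1) * ln F"
        using K Kn XYF by (intro mult_right_mono) (auto simp: of_nat_diff)
      ultimately show ?thesis by (simp add: algebra_simps)
    qed
    also have "\<dots> = Y * F * exp (2 * real n * (13/40 * ln X + 7/40 * ln Y + 27/40 * ln F))"
      using XYF by (simp add: exp_add)
    finally show ?thesis .
  qed
  let ?N3 = "(10 * real n + 1)"
  have "?N3 > 0" by linarith
  moreover have "?H * W ^ m * ?k0 > 0" by (rule mult_pos_pos[OF _ k0]) (use Wpos in simp)
  ultimately have D: "?H * W ^ m * ?k0 / ?N3\<^sup>2 > 0" by simp
  have "card ?T * (?H * W ^ m * ?k0 / ?N3\<^sup>2) \<le> card ?T * (?C1 * ?C2 * (?Q * eps ^ 11) * (z ^ (10 * m) * y ^ ?u) * v ^ m)"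
    using low by (intro mult_left_mono) auto
  also note main
  also have "fact (10 * n) * ?N3 * (X ^ K * Y ^ (n - K) * ?F1 ^ (2 * n - K))
      \<le> fact (10 * n) * ?N3 * (Y * F * exp (2 * real n * (13/40 * ln X + 7/40 * ln Y + 27/40 * ln F)))"
    using up by (intro mult_left_mono) auto
  finally have "card ?T \<le> fact (10 * n) * ?N3 * (Y * F * exp (2 * real n * (13/40 * ln X + 7/40 * ln Y + 27/40 * ln F))) / (?H * W ^ m * ?k0 / ?N3\<^sup>2)"
    by (simp only: pos_le_divide_eq[OF D])
  also have "\<dots> = fact (10 * n) * (?N3 ^ 3 * (Y * F / ?k0) * (exp (2 * real n * (13/40 * ln X + 7/40 * ln Y + 27/40 * ln F)) / (?H * W ^ m)))"
    using k0 Wpos by (simp add: field_simps power2_eq_square power3_eq_cube)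
  also have "exp (2 * real n * (13/40 * ln X + 7/40 * ln Y + 27/40 * ln F)) / (?H * W ^ m)
      = exp (2 * real n * exponent X Y F W (m / (2 * n)))"
  proof -
    have "?H * W ^ m = exp (10 * real n * entropy (m / n) + m * ln W)"
      using Wpos by (simp add: power_as_exp exp_add)
    moreover have "2 * real n * exponent X Y F W (m / (2 * n)) = 2 * real n * (13/40 * ln X + 7/40 * ln Y + 27/40 * ln F) - (10 * real n * entropy (m / n) + m * ln W)"
      using n by (simp add: exponent_def field_simps)
    ultimately show ?thesis by (simp only: exp_diff)
  qed
  finally show ?thesis by (simp only: of_nat_mult of_nat_numeral mult.assoc)
qed

section \<open>Numerical estimates\<close>

text \<open>Three terms of the series ln s = 2 artanh t, with a geometric bound for the
  remainder.\<close>

lemma ln_series_bounds: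
  fixes s :: real
  assumes "s > 1"
  defines "t \<equiv> (s - 1) / (s + 1)"
  shows "2 * t + 2 * t ^ 3 / 3 + 2 * t ^ 5 / 5 \<le> ln s"
    and "ln s \<le> 2 * t + 2 * t ^ 3 / 3 + 2 * t ^ 5 / 5 + 2 * (t ^ 7 / (1 - t\<^sup>2) / 7)"
proof -
  have *: "(\<Sum>k<3. 2 * t ^ (2 * k + 1) / real (2 * k + 1)) = 2 * t + 2 * t ^ 3 / 3 + 2 * t ^ 5 / 5"
    by (simp add: numeral_eq_Suc)
  show "2 * t + 2 * t ^ 3 / 3 + 2 * t ^ 5 / 5 \<le> ln s"
    and "ln s \<le> 2 * t + 2 * t ^ 3 / 3 + 2 * t ^ 5 / 5 + 2 * (t ^ 7 / (1 - t\<^sup>2) / 7)"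
    using ln_approx_bounds[OF assms(1), of 3] * by (auto simp: t_def)
qed

text \<open>The series converges fast only near 1. Every number below is therefore scaled by a power
  of two to \<open>s\<close> or \<open>1 / s\<close> with \<open>s\<close> between 1 and 7/5, where
  the remainder is below 10^-6.\<close>

lemma ln_scaled:
  fixes r s :: real
  assumes "s > 0" "r * 2 ^ j = 2 ^ k * s"
  shows "ln r = (real k - real j) * ln 2 + ln s"
proof -
  have r: "r = 2 ^ k * s / 2 ^ j" using assms by (simp add: field_simps)
  show ?thesis unfolding r using assms(1) by (simp add: ln_mult ln_div ln_realpow algebra_simps)
qed

lemma ln_scaled_inverse:
  fixes r s :: real
  assumes "s > 0" "r * 2 ^ j * s = 2 ^ k"
  shows "ln r = (real k - real j) * ln 2 - ln s"
  using ln_scaled[of "1 / s" r j k] assms by (simp add: field_simps ln_div)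

lemma ln2_bounds: "693143 / 1000000 \<le> ln (2::real)" "ln (2::real) \<le> 693148 / 1000000"
proof -
  \<comment> \<open>The splitting 2 = (4/3) (3/2) replaces the series argument t = 1/3 by 1/7 and
    1/5.\<close>
  have 1: "ln (2::real) = ln (4/3) + ln (3/2)" using ln_mult_pos[of "4/3" "3/2::real"] by simp
  show "693143 / 1000000 \<le> ln (2::real)" "ln (2::real) \<le> 693148 / 1000000"
    using ln_series_bounds[of "4/3"] ln_series_bounds[of "3/2"] unfolding 1 by (simp_all add: power_divide)
qed

section \<open>Polynomial bounds for the binomial tails\<close>

lemma left_weight_sum:
  "left_total z th Y = 1 + 5 * z + 10 * z ^ 2 + 10 * z ^ 3 + 5 * th * z ^ 4 + Y * z ^ 5"
  by (simp add: left_weight_def numeral_eq_Suc)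

lemma sum_split_10:
  fixes f :: "nat \<Rightarrow> real"
  assumes "c \<le> 11"
  shows "(\<Sum>j\<le>10. f j) = (\<Sum>j<c. f j) + (\<Sum>j\<le>10. if c \<le> j then f j else 0)"
proof -
  have "{..10} = {..<c} \<union> {c..10}" "{..10::nat} \<inter> {j. c \<le> j} = {c..10}" using assms by auto
  moreover have "sum f ({..<c} \<union> {c..10}) = sum f {..<c} + sum f {c..10}" by (rule sum.union_disjoint) auto
  ultimately show ?thesis by (simp add: sum.If_cases)
qed

lemma upper_tail_eq:
  assumes "c \<le> 11"
  shows "upper_tail q c = 1 - (\<Sum>j<c. real (10 choose j) * q ^ j * (1 - q) ^ (10 - j))"
proof -
  let ?f = "\<lambda>j. real (10 choose j) * q ^ j * (1 - q) ^ (10 - j)"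
  have "(\<Sum>j\<le>10. if c \<le> j then ?f j else 0) = upper_tail q c"
    unfolding upper_tail_def by (intro sum.cong) auto
  then have "(\<Sum>j\<le>10. ?f j) = (\<Sum>j<c. ?f j) + upper_tail q c"
    using sum_split_10[OF assms, of ?f] by simp
  moreover have "(q + (1 - q)) ^ 10 = (\<Sum>j\<le>10. ?f j)" by (rule binomial_ring)
  ultimately show ?thesis by simp
qed

lemma upper_tail_1: "upper_tail q 1 = 1 - (1 - q) ^ 10"
  by (simp add: upper_tail_eq)

lemma upper_tail_2: "upper_tail q 2 = 1 - (1 - q) ^ 10 - 10 * q * (1 - q) ^ 9"
  by (simp add: upper_tail_eq numeral_2_eq_2)

lemma upper_tail_3: "upper_tail q 3 = 1 - (1 - q) ^ 10 - 10 * q * (1 - q) ^ 9 - 45 * q\<^sup>2 * (1 - q) ^ 8"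
proof -
  have "(10 choose 2) = (45::nat)" by (simp add: choose_two)
  then have "(10 choose Suc (Suc 0)) = (45::nat)" by (simp add: numeral_2_eq_2)
  then show ?thesis by (simp add: upper_tail_eq numeral_3_eq_3 power2_eq_square)
qed

lemma lower_tail_le:
  assumes "c \<le> 11" "0 \<le> a" "0 \<le> b" "0 \<le> eps"
  shows "lower_tail eps a b c \<le> (\<Sum>j<c. real (10 choose j) * a ^ j * b ^ (10 - j)) + eps * (a + b) ^ 10"
proof -
  let ?f = "\<lambda>j. real (10 choose j) * a ^ j * b ^ (10 - j)"
  have nn: "?f j \<ge> 0" for j using assms by auto
  have "lower_tail eps a b c = (\<Sum>j\<le>10. (if j < c then ?f j else 0) + eps * (if c \<le> j then ?f j else 0))"
    unfolding lower_tail_def by (intro sum.cong) auto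
  also have "\<dots> \<le> (\<Sum>j\<le>10. (if j < c then ?f j else 0) + eps * ?f j)"
    using nn assms by (intro sum_mono add_left_mono mult_left_mono) auto
  also have "\<dots> = (\<Sum>j\<le>10. if j < c then ?f j else 0) + eps * (\<Sum>j\<le>10. ?f j)"
    by (simp add: sum.distrib sum_distrib_left)
  also have "(\<Sum>j\<le>10. ?f j) = (a + b) ^ 10" by (rule binomial_ring[symmetric])
  also have "(\<Sum>j\<le>10. if j < c then ?f j else 0) = (\<Sum>j<c. ?f j)"
  proof -
    have "{..10} \<inter> {j. j < c} = {..<c}" using assms by auto
    then show ?thesis by (simp add: sum.If_cases)
  qed
  finally show ?thesis .
qed

lemma lower_tail_11: "0 \<le> rho \<Longrightarrow> rho \<le> 1 \<Longrightarrow> lower_tail eps rho (1 - rho) 11 = 1"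
proof -
  have "lower_tail eps rho (1 - rho) 11 = (\<Sum>j\<le>10. real (10 choose j) * rho ^ j * (1 - rho) ^ (10 - j))"
    unfolding lower_tail_def by (intro sum.cong) auto
  also have "\<dots> = (rho + (1 - rho)) ^ 10" by (rule binomial_ring[symmetric])
  finally show ?thesis by simp
qed

text \<open>The sum is a truncation of the power series of \<open>(1 - x)\<close> to the power \<open>- (m + 1)\<close>.\<close>

lemma truncated_inverse_power_le:
  fixes x :: real
  assumes "0 \<le> x" "x \<le> 1"
  shows "(1 - x) ^ Suc m * (\<Sum>j\<le>k. real (m + j choose j) * x ^ j) \<le> 1"
proof (induction m)
  case 0
  have "(1 - x) * (\<Sum>j\<le>k. x ^ j) = 1 - x ^ Suc k"
    using one_diff_power_eq[of x "Suc k"] by (simp add: lessThan_Suc_atMost)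
  then show ?case using assms by simp
next
  case (Suc m)
  have "(1 - x) * (\<Sum>j\<le>k. real (Suc m + j choose j) * x ^ j) \<le> (\<Sum>j\<le>k. real (m + j choose j) * x ^ j) - real (Suc m + k choose k) * x ^ Suc k"
    for k
  proof (induction k)
    case (Suc k)
    have "real (Suc m + Suc k choose Suc k) = real (m + Suc k choose Suc k) + real (Suc m + k choose k)" by simp
    then show ?case using Suc by (simp add: algebra_simps)
  qed (simp add: algebra_simps)
  then have "(1 - x) * (\<Sum>j\<le>k. real (Suc m + j choose j) * x ^ j) \<le> (\<Sum>j\<le>k. real (m + j choose j) * x ^ j)"
    using assms by (smt (verit, best) of_nat_0_le_iff mult_nonneg_nonneg zero_le_power)
  then have "(1 - x) ^ Suc m * ((1 - x) * (\<Sum>j\<le>k. real (Suc m + j choose j) * x ^ j)) \<le> (1 - x) ^ Suc m * (\<Sum>j\<le>k. real (m + j choose j) * x ^ j)"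
    using assms by (intro mult_left_mono) auto
  then show ?case using Suc by (simp add: mult_ac)
qed

text \<open>The coefficients 8, 36, 120, 330 are those of (1 - x)^(-8). Moving this truncated series
  to the other side turns an inequality of degree ten into one of degree four.\<close>

lemma truncated_power_8:
  fixes x :: real
  assumes "0 \<le> x" "x \<le> 1" "Q \<le> kap * (1 + 8 * x + 36 * x ^ 2 + 120 * x ^ 3 + 330 * x ^ 4)" "0 \<le> kap"
  shows "(1 - x) ^ 8 * Q \<le> kap"
proof -
  have "(\<Sum>j\<le>4. real (7 + j choose j) * x ^ j) = 1 + 8 * x + 36 * x ^ 2 + 120 * x ^ 3 + 330 * x ^ 4"
    by (simp add: numeral_eq_Suc)
  then have T: "(1 - x) ^ 8 * (1 + 8 * x + 36 * x ^ 2 + 120 * x ^ 3 + 330 * x ^ 4) \<le> 1"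
    using truncated_inverse_power_le[OF assms(1,2), of 7 4] by simp
  have "(1 - x) ^ 8 * Q \<le> (1 - x) ^ 8 * (kap * (1 + 8 * x + 36 * x ^ 2 + 120 * x ^ 3 + 330 * x ^ 4))"
    using assms by (intro mult_left_mono) auto
  also have "\<dots> = kap * ((1 - x) ^ 8 * (1 + 8 * x + 36 * x ^ 2 + 120 * x ^ 3 + 330 * x ^ 4))" by simp
  also have "\<dots> \<le> kap * 1" using T assms(4) by (rule mult_left_mono)
  finally show ?thesis by simp
qed

lemma lower_tail_le_th:
  fixes rho th eps :: real
  assumes "0 \<le> rho" "rho \<le> 1" "0 < th" "th \<le> 1" "0 \<le> eps" "c \<le> 11"
  shows "lower_tail eps (rho / th) (1 - rho) c
    \<le> (\<Sum>j<c. real (10 choose j) * (rho / th) ^ j * (1 - rho) ^ (10 - j)) + eps * (1 / th) ^ 10"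
proof -
  have "rho / th + (1 - rho) \<le> 1 / th"
  proof -
    have "(1 - rho) * 1 \<le> (1 - rho) * (1 / th)" using assms by (intro mult_left_mono) auto
    moreover have "rho / th + (1 - rho) / th = 1 / th" by (simp add: add_divide_distrib[symmetric])
    ultimately show ?thesis by simp
  qed
  then have "(rho / th + (1 - rho)) ^ 10 \<le> (1 / th) ^ 10" using assms by (intro power_mono) auto
  then have "eps * (rho / th + (1 - rho)) ^ 10 \<le> eps * (1 / th) ^ 10" using assms by (intro mult_left_mono) auto
  then show ?thesis using lower_tail_le[of c "rho / th" "1 - rho" eps] assms by simp
qed

lemma lower_tail_2_le:
  fixes rho th kap eps :: real
  assumes "0 \<le> rho" "rho \<le> 1" "0 < th" "th \<le> 1" "0 \<le> eps" "0 \<le> kap"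
    "(1 - rho) ^ 2 + 10 * (rho / th) * (1 - rho) \<le> kap * (1 + 8 * rho + 36 * rho ^ 2 + 120 * rho ^ 3 + 330 * rho ^ 4)"
  shows "lower_tail eps (rho / th) (1 - rho) 2 \<le> kap + eps * (1 / th) ^ 10"
proof -
  have p: "(1 - rho) ^ 10 = (1 - rho) ^ 8 * (1 - rho) ^ 2" "(1 - rho) ^ 9 = (1 - rho) ^ 8 * (1 - rho)"
    by (simp_all flip: power_add power_Suc2)
  have "lower_tail eps (rho / th) (1 - rho) 2 \<le> (\<Sum>j<2. real (10 choose j) * (rho / th) ^ j * (1 - rho) ^ (10 - j)) + eps * (1 / th) ^ 10"
    using assms by (intro lower_tail_le_th) auto
  also have "(\<Sum>j<2. real (10 choose j) * (rho / th) ^ j * (1 - rho) ^ (10 - j)) = (1 - rho) ^ 10 + 10 * (rho / th) * (1 - rho) ^ 9"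
    by (simp add: numeral_2_eq_2)
  also have "\<dots> = (1 - rho) ^ 8 * ((1 - rho) ^ 2 + 10 * (rho / th) * (1 - rho))"
    by (simp only: p distrib_left mult_ac)
  also have "\<dots> \<le> kap" using truncated_power_8[OF assms(1,2,7,6)] .
  finally show ?thesis by simp
qed

lemma lower_tail_3_le:
  fixes rho th kap eps :: real
  assumes "0 \<le> rho" "rho \<le> 1" "0 < th" "th \<le> 1" "0 \<le> eps" "0 \<le> kap"
    "(1 - rho) ^ 2 + 10 * (rho / th) * (1 - rho) + 45 * (rho / th) ^ 2 \<le> kap * (1 + 8 * rho + 36 * rho ^ 2 + 120 * rho ^ 3 + 330 * rho ^ 4)"
  shows "lower_tail eps (rho / th) (1 - rho) 3 \<le> kap + eps * (1 / th) ^ 10"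
proof -
  have "(10 choose 2) = (45::nat)" by (simp add: choose_two)
  then have c2: "(10 choose Suc (Suc 0)) = (45::nat)" by (simp add: numeral_2_eq_2)
  have p: "(1 - rho) ^ 10 = (1 - rho) ^ 8 * (1 - rho) ^ 2" "(1 - rho) ^ 9 = (1 - rho) ^ 8 * (1 - rho)"
    by (simp_all flip: power_add power_Suc2)
  have "lower_tail eps (rho / th) (1 - rho) 3 \<le> (\<Sum>j<3. real (10 choose j) * (rho / th) ^ j * (1 - rho) ^ (10 - j)) + eps * (1 / th) ^ 10"
    using assms by (intro lower_tail_le_th) auto
  also have "(\<Sum>j<3. real (10 choose j) * (rho / th) ^ j * (1 - rho) ^ (10 - j)) = (1 - rho) ^ 10 + 10 * (rho / th) * (1 - rho) ^ 9 + 45 * (rho / th) ^ 2 * (1 - rho) ^ 8"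
    by (simp add: numeral_3_eq_3 c2 power2_eq_square)
  also have "\<dots> = (1 - rho) ^ 8 * ((1 - rho) ^ 2 + 10 * (rho / th) * (1 - rho) + 45 * (rho / th) ^ 2)"
    by (simp only: p distrib_left mult_ac)
  also have "\<dots> \<le> kap" using truncated_power_8[OF assms(1,2,7,6)] .
  finally show ?thesis by simp
qed

text \<open>Up to the \<open>eps\<close> term the tail peaks at (1 - th) / (10 - th), which is about
  0.029 for th = 73/100; its maximum is about 1.050.\<close>

lemma lower_tail_sparse_2:
  assumes "0 \<le> rho" "rho \<le> 1"
  shows "lower_tail (1 / 10 ^ 9) (rho / (73/100)) (1 - rho) 2 \<le> 1051 / 1000"
proof -
  \<comment> \<open>Nonnegative products with double roots near the peak. They reduce the quartic
    inequality to linear arithmetic in the powers of \<open>rho\<close>; the three lemmas that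
    follow use the same kind of certificate.\<close>
  have "0 \<le> rho * (rho - 3/100)\<^sup>2" "0 \<le> (rho - 29/1000)\<^sup>2" "0 \<le> rho\<^sup>2 * (rho - 3/100)\<^sup>2"
    using assms by simp_all
  then have f: "0 \<le> rho ^ 3 - 3/50 * rho ^ 2 + 9/10000 * rho" "0 \<le> rho ^ 2 - 29/500 * rho + 841/1000000" "0 \<le> rho ^ 4 - 3/50 * rho ^ 3 + 9/10000 * rho ^ 2"
    by (simp_all add: power2_eq_square power3_eq_cube power4_eq_xxxx algebra_simps)
  have "(1 - rho) ^ 2 + 10 * (rho / (73/100)) * (1 - rho) = 1 - 2 * rho + rho ^ 2 + 10 * (100/73) * rho - 10 * (100/73) * rho ^ 2"
    by (simp add: power2_eq_square field_simps)
  also have "\<dots> \<le> 10509 / 10000 * (1 + 8 * rho + 36 * rho ^ 2 + 120 * rho ^ 3 + 330 * rho ^ 4)"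
    using assms f by (simp add: power_divide)
  finally have "lower_tail (1 / 10 ^ 9) (rho / (73/100)) (1 - rho) 2 \<le> 10509 / 10000 + 1 / 10 ^ 9 * (1 / (73/100)) ^ 10"
    using assms by (intro lower_tail_2_le) auto
  also have "\<dots> \<le> 1051 / 1000" by (simp add: power_divide)
  finally show ?thesis .
qed

text \<open>The tail is still increasing at density 1/20, so the range ends before its peak and the
  certificate vanishes at the endpoint 1/20.\<close>

lemma lower_tail_sparse_3:
  assumes "0 \<le> rho" "rho \<le> 1 / 20"
  shows "lower_tail (1 / 10 ^ 9) (rho / (73/100)) (1 - rho) 3 \<le> 1172 / 1000"
proof -
  have "0 \<le> rho * (rho - 1/20)\<^sup>2" "0 \<le> (rho - 1/20)\<^sup>2" "0 \<le> rho\<^sup>2 * (rho - 1/20)\<^sup>2" "0 \<le> rho * (1/20 - rho)" "0 \<le> rho\<^sup>2 * (1/20 - rho)"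
    using assms by simp_all
  then have f: "0 \<le> rho ^ 3 - 1/10 * rho ^ 2 + 1/400 * rho" "0 \<le> rho ^ 2 - 1/10 * rho + 1/400" "0 \<le> rho ^ 4 - 1/10 * rho ^ 3 + 1/400 * rho ^ 2" "0 \<le> 1/20 * rho - rho ^ 2" "0 \<le> 1/20 * rho ^ 2 - rho ^ 3"
    by (simp_all add: power2_eq_square power3_eq_cube power4_eq_xxxx algebra_simps)
  have "(1 - rho) ^ 2 + 10 * (rho / (73/100)) * (1 - rho) + 45 * (rho / (73/100)) ^ 2 = 1 - 2 * rho + rho ^ 2 + 10 * (100/73) * rho - 10 * (100/73) * rho ^ 2 + 45 * (100/73) ^ 2 * rho ^ 2"
    by (simp add: power2_eq_square field_simps)
  also have "\<dots> \<le> 11719 / 10000 * (1 + 8 * rho + 36 * rho ^ 2 + 120 * rho ^ 3 + 330 * rho ^ 4)"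
    using assms f by (simp add: power_divide)
  finally have "lower_tail (1 / 10 ^ 9) (rho / (73/100)) (1 - rho) 3 \<le> 11719 / 10000 + 1 / 10 ^ 9 * (1 / (73/100)) ^ 10"
    using assms by (intro lower_tail_3_le) auto
  also have "\<dots> \<le> 1172 / 1000" by (simp add: power_divide)
  finally show ?thesis .
qed

text \<open>For th = 884/1000 the peak is near 0.013. Beyond density 1/20 the tail only decreases
  and stays below 1, which is the gain from restricting the density.\<close>

lemma lower_tail_dense_2:
  assumes "1 / 20 \<le> rho" "rho \<le> 1"
  shows "lower_tail (1 / 10 ^ 9) (rho / (884/1000)) (1 - rho) 2 \<le> 957 / 1000"
proof -
  have "0 \<le> rho * (rho - 1/20)" "0 \<le> rho\<^sup>2 * (rho - 1/20)" "0 \<le> rho ^ 3 * (rho - 1/20)"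
    using assms by simp_all
  then have f: "0 \<le> rho ^ 2 - 1/20 * rho" "0 \<le> rho ^ 3 - 1/20 * rho ^ 2" "0 \<le> rho ^ 4 - 1/20 * rho ^ 3"
    by (simp_all add: power2_eq_square power3_eq_cube power4_eq_xxxx algebra_simps)
  have "(1 - rho) ^ 2 + 10 * (rho / (884/1000)) * (1 - rho) = 1 - 2 * rho + rho ^ 2 + 10 * (1000/884) * rho - 10 * (1000/884) * rho ^ 2"
    by (simp add: power2_eq_square field_simps)
  also have "\<dots> \<le> 9569 / 10000 * (1 + 8 * rho + 36 * rho ^ 2 + 120 * rho ^ 3 + 330 * rho ^ 4)"
    using assms f by (simp add: power_divide)
  finally have "lower_tail (1 / 10 ^ 9) (rho / (884/1000)) (1 - rho) 2 \<le> 9569 / 10000 + 1 / 10 ^ 9 * (1 / (884/1000)) ^ 10"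
    using assms by (intro lower_tail_2_le) auto
  also have "\<dots> \<le> 957 / 1000" by (simp add: power_divide)
  finally show ?thesis .
qed

text \<open>The peak is near 0.065, inside the range, so the double roots are placed close to
  it.\<close>

lemma lower_tail_dense_3:
  assumes "0 \<le> rho" "rho \<le> 1"
  shows "lower_tail (1 / 10 ^ 9) (rho / (884/1000)) (1 - rho) 3 \<le> 1056 / 1000"
proof -
  have "0 \<le> rho * (rho - 13/200)\<^sup>2" "0 \<le> (rho - 171/2500)\<^sup>2" "0 \<le> rho\<^sup>2 * (rho - 13/200)\<^sup>2"
    using assms by simp_all
  then have f: "0 \<le> rho ^ 3 - 13/100 * rho ^ 2 + 169/40000 * rho" "0 \<le> rho ^ 2 - 171/1250 * rho + 29241/6250000" "0 \<le> rho ^ 4 - 13/100 * rho ^ 3 + 169/40000 * rho ^ 2"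
    by (simp_all add: power2_eq_square power3_eq_cube power4_eq_xxxx algebra_simps)
  have "(1 - rho) ^ 2 + 10 * (rho / (884/1000)) * (1 - rho) + 45 * (rho / (884/1000)) ^ 2 = 1 - 2 * rho + rho ^ 2 + 10 * (1000/884) * rho - 10 * (1000/884) * rho ^ 2 + 45 * (1000/884) ^ 2 * rho ^ 2"
    by (simp add: power2_eq_square field_simps)
  also have "\<dots> \<le> 10559 / 10000 * (1 + 8 * rho + 36 * rho ^ 2 + 120 * rho ^ 3 + 330 * rho ^ 4)"
    using assms f by (simp add: power_divide)
  finally have "lower_tail (1 / 10 ^ 9) (rho / (884/1000)) (1 - rho) 3 \<le> 10559 / 10000 + 1 / 10 ^ 9 * (1 / (884/1000)) ^ 10"
    using assms by (intro lower_tail_3_le) auto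
  also have "\<dots> \<le> 1056 / 1000" by (simp add: power_divide)
  finally show ?thesis .
qed

section \<open>Rational enclosures of the required logarithms\<close>

lemma ln_bounds_121_1: "ln (121 :: real) \<le> 4795797 / 1000000"
  using ln_series_bounds[of "128 / 121"] ln2_bounds ln_scaled_inverse[of "128 / 121" "121" 0 7] by (simp_all add: power_divide)

lemma ln_bounds_5_2: "ln (5 / 2 :: real) \<le> 916292 / 1000000"
  using ln_series_bounds[of "5 / 4"] ln2_bounds ln_scaled[of "5 / 4" "5 / 2" 0 1] by (simp_all add: power_divide)

lemma ln_bounds_1381_25: "ln (1381 / 25 :: real) \<le> 4011693 / 1000000"
  using ln_series_bounds[of "1600 / 1381"] ln2_bounds ln_scaled_inverse[of "1600 / 1381" "1381 / 25" 0 6] by (simp_all add: power_divide)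

lemma ln_bounds_1037_25: "3725190 / 1000000 \<le> ln (1037 / 25 :: real)"
  using ln_series_bounds[of "1037 / 800"] ln2_bounds ln_scaled[of "1037 / 800" "1037 / 25" 0 5] by (simp_all add: power_divide)

lemma ln_bounds_787_5: "ln (787 / 5 :: real) \<le> 5058797 / 1000000"
  using ln_series_bounds[of "787 / 640"] ln2_bounds ln_scaled[of "787 / 640" "787 / 5" 0 7] by (simp_all add: power_divide)

lemma ln_bounds_72_25: "ln (72 / 25 :: real) \<le> 1057793 / 1000000"
  using ln_series_bounds[of "25 / 18"] ln2_bounds ln_scaled_inverse[of "25 / 18" "72 / 25" 0 2] by (simp_all add: power_divide)

lemma ln_bounds_1533_25: "ln (1533 / 25 :: real) \<le> 4116111 / 1000000"
  using ln_series_bounds[of "1600 / 1533"] ln2_bounds ln_scaled_inverse[of "1600 / 1533" "1533 / 25" 0 6] by (simp_all add: power_divide)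

lemma ln_bounds_1791_25: "4271628 / 1000000 \<le> ln (1791 / 25 :: real)"
  using ln_series_bounds[of "1791 / 1600"] ln2_bounds ln_scaled[of "1791 / 1600" "1791 / 25" 0 6] by (simp_all add: power_divide)

lemma ln_bounds_261_2: "ln (261 / 2 :: real) \<le> 4871379 / 1000000"
  using ln_series_bounds[of "261 / 256"] ln2_bounds ln_scaled[of "261 / 256" "261 / 2" 0 7] by (simp_all add: power_divide)

lemma ln_bounds_2567_1000: "ln (2567 / 1000 :: real) \<le> 942739 / 1000000"
  using ln_series_bounds[of "2567 / 2000"] ln2_bounds ln_scaled[of "2567 / 2000" "2567 / 1000" 0 1] by (simp_all add: power_divide)

lemma ln_bounds_2879_50: "ln (2879 / 50 :: real) \<le> 4053181 / 1000000"
  using ln_series_bounds[of "3200 / 2879"] ln2_bounds ln_scaled_inverse[of "3200 / 2879" "2879 / 50" 0 6] by (simp_all add: power_divide)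

lemma ln_bounds_1233_25: "3898304 / 1000000 \<le> ln (1233 / 25 :: real)"
  using ln_series_bounds[of "1600 / 1233"] ln2_bounds ln_scaled_inverse[of "1600 / 1233" "1233 / 25" 0 6] by (simp_all add: power_divide)

lemma ln_bounds_61_100: "- (494298 / 1000000) \<le> ln (61 / 100 :: real)" "ln (61 / 100 :: real) \<le> - (494292 / 1000000)"
  using ln_series_bounds[of "61 / 50"] ln2_bounds ln_scaled[of "61 / 50" "61 / 100" 1 0] by (simp_all add: power_divide)

lemma ln_bounds_39_100: "- (941610 / 1000000) \<le> ln (39 / 100 :: real)" "ln (39 / 100 :: real) \<le> - (941604 / 1000000)"
  using ln_series_bounds[of "50 / 39"] ln2_bounds ln_scaled_inverse[of "50 / 39" "39 / 100" 1 0] by (simp_all add: power_divide)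

lemma ln_bounds_1661_2500: "ln (1661 / 2500 :: real) \<le> - (408866 / 1000000)"
  using ln_series_bounds[of "1661 / 1250"] ln2_bounds ln_scaled[of "1661 / 1250" "1661 / 2500" 1 0] by (simp_all add: power_divide)

lemma ln_bounds_839_2500: "ln (839 / 2500 :: real) \<le> - (1091826 / 1000000)"
  using ln_series_bounds[of "839 / 625"] ln2_bounds ln_scaled[of "839 / 625" "839 / 2500" 2 0] by (simp_all add: power_divide)

lemma ln_bounds_2301_10000: "- (1469243 / 1000000) \<le> ln (2301 / 10000 :: real)"
  using ln_series_bounds[of "2500 / 2301"] ln2_bounds ln_scaled_inverse[of "2500 / 2301" "2301 / 10000" 2 0] by (simp_all add: power_divide)

lemma ln_bounds_5623_10000: "- (575721 / 1000000) \<le> ln (5623 / 10000 :: real)" "ln (5623 / 10000 :: real) \<le> - (575715 / 1000000)"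
  using ln_series_bounds[of "5623 / 5000"] ln2_bounds ln_scaled[of "5623 / 5000" "5623 / 10000" 1 0] by (simp_all add: power_divide)

lemma ln_bounds_519_2500: "- (1572144 / 1000000) \<le> ln (519 / 2500 :: real)"
  using ln_series_bounds[of "625 / 519"] ln2_bounds ln_scaled_inverse[of "625 / 519" "519 / 2500" 2 0] by (simp_all add: power_divide)

lemma ln_bounds_7699_10000: "ln (7699 / 10000 :: real) \<le> - (261494 / 1000000)"
  using ln_series_bounds[of "10000 / 7699"] ln2_bounds ln_scaled_inverse[of "10000 / 7699" "7699 / 10000" 0 0] by (simp_all add: power_divide)

lemma ln_bounds_4377_10000: "- (826223 / 1000000) \<le> ln (4377 / 10000 :: real)" "ln (4377 / 10000 :: real) \<le> - (826217 / 1000000)"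
  using ln_series_bounds[of "5000 / 4377"] ln2_bounds ln_scaled_inverse[of "5000 / 4377" "4377 / 10000" 1 0] by (simp_all add: power_divide)

lemma ln_bounds_1661_5000: "- (1102021 / 1000000) \<le> ln (1661 / 5000 :: real)"
  using ln_series_bounds[of "1661 / 1250"] ln2_bounds ln_scaled[of "1661 / 1250" "1661 / 5000" 2 0] by (simp_all add: power_divide)

lemma ln_bounds_3339_5000: "ln (3339 / 5000 :: real) \<le> - (403762 / 1000000)"
  using ln_series_bounds[of "3339 / 2500"] ln2_bounds ln_scaled[of "3339 / 2500" "3339 / 5000" 1 0] by (simp_all add: power_divide)

lemma ln_bounds_1_20: "- (2995736 / 1000000) \<le> ln (1 / 20 :: real)" "ln (1 / 20 :: real) \<le> - (2995715 / 1000000)"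
  using ln_series_bounds[of "5 / 4"] ln2_bounds ln_scaled_inverse[of "5 / 4" "1 / 20" 4 0] by (simp_all add: power_divide)

lemma ln_bounds_19_20: "- (51294 / 1000000) \<le> ln (19 / 20 :: real)" "ln (19 / 20 :: real) \<le> - (51293 / 1000000)"
  using ln_series_bounds[of "20 / 19"] ln2_bounds ln_scaled_inverse[of "20 / 19" "19 / 20" 0 0] by (simp_all add: power_divide)

lemma ln_bounds_1_10: "- (2302588 / 1000000) \<le> ln (1 / 10 :: real)"
  using ln_series_bounds[of "5 / 4"] ln2_bounds ln_scaled_inverse[of "5 / 4" "1 / 10" 3 0] by (simp_all add: power_divide)

lemma ln_bounds_9_10: "- (105361 / 1000000) \<le> ln (9 / 10 :: real)"
  using ln_series_bounds[of "10 / 9"] ln2_bounds ln_scaled_inverse[of "10 / 9" "9 / 10" 0 0] by (simp_all add: power_divide)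

lemma ln_bounds_61_200: "ln (61 / 200 :: real) \<le> - (1187435 / 1000000)"
  using ln_series_bounds[of "61 / 50"] ln2_bounds ln_scaled[of "61 / 50" "61 / 200" 2 0] by (simp_all add: power_divide)

lemma ln_bounds_139_200: "ln (139 / 200 :: real) \<le> - (363839 / 1000000)"
  using ln_series_bounds[of "139 / 100"] ln2_bounds ln_scaled[of "139 / 100" "139 / 200" 1 0] by (simp_all add: power_divide)

lemma ln_bounds_1459_15340: "ln (1459 / 15340 :: real) \<le> - (2352699 / 1000000)"
  using ln_series_bounds[of "3835 / 2918"] ln2_bounds ln_scaled_inverse[of "3835 / 2918" "1459 / 15340" 3 0] by (simp_all add: power_divide)

lemma ln_bounds_13881_15340: "- (99943 / 1000000) \<le> ln (13881 / 15340 :: real)"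
  using ln_series_bounds[of "15340 / 13881"] ln2_bounds ln_scaled_inverse[of "15340 / 13881" "13881 / 15340" 0 0] by (simp_all add: power_divide)

lemma ln_bounds_173_3835: "- (3098637 / 1000000) \<le> ln (173 / 3835 :: real)"
  using ln_series_bounds[of "3835 / 2768"] ln2_bounds ln_scaled_inverse[of "3835 / 2768" "173 / 3835" 4 0] by (simp_all add: power_divide)

lemma ln_bounds_1661_56230: "- (3522035 / 1000000) \<le> ln (1661 / 56230 :: real)"
  using ln_series_bounds[of "28115 / 26576"] ln2_bounds ln_scaled_inverse[of "28115 / 26576" "1661 / 56230" 5 0] by (simp_all add: power_divide)

lemma ln_bounds_2301_112460: "- (3889259 / 1000000) \<le> ln (2301 / 112460 :: real)"
  using ln_series_bounds[of "36816 / 28115"] ln2_bounds ln_scaled[of "36816 / 28115" "2301 / 112460" 6 0] by (simp_all add: power_divide)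

lemma ln_bounds_8707_10000: "ln (8707 / 10000 :: real) \<le> - (138457 / 1000000)"
  using ln_series_bounds[of "10000 / 8707"] ln2_bounds ln_scaled_inverse[of "10000 / 8707" "8707 / 10000" 0 0] by (simp_all add: power_divide)

lemma ln_bounds_4273_5000: "ln (4273 / 5000 :: real) \<le> - (157121 / 1000000)"
  using ln_series_bounds[of "5000 / 4273"] ln2_bounds ln_scaled_inverse[of "5000 / 4273" "4273 / 5000" 0 0] by (simp_all add: power_divide)

section \<open>Negativity of the exponential rates\<close>

lemma entropy_has_real_derivative:
  assumes "0 < x" "x < 1"
  shows "(entropy has_real_derivative ln (1 - x) - ln x) (at x)"
  unfolding entropy_def using assms by (auto intro!: derivative_eq_intros)

text \<open>Negative entropy is convex and the other terms are constant or linear in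
  \<open>x\<close>, so the two endpoints suffice. The logarithms are those of 2 x and 1 - 2 x at x =
  0.305 and x = 0.3322.\<close>

lemma exponent_le:
  assumes "305 / 1000 \<le> x" "x \<le> 3322 / 10000"
    and "13/40 * ln X + 7/40 * ln Y + 27/40 * ln F + 5 * (61/100 * ln (61/100) + 39/100 * ln (39/100)) - 305/1000 * ln W \<le> c"
    and "13/40 * ln X + 7/40 * ln Y + 27/40 * ln F + 5 * (1661/2500 * ln (1661/2500) + 839/2500 * ln (839/2500)) - 3322/10000 * ln W \<le> c"
  shows "exponent X Y F W x \<le> c"
proof (rule le_if_second_deriv_nonneg[where f = "exponent X Y F W" and a = "305/1000" and b = "3322/10000"
      and f' = "\<lambda>x. 10 * (ln (2 * x) - ln (1 - 2 * x)) - ln W" and f'' = "\<lambda>x. 10 * (1 / x + 2 / (1 - 2 * x))"])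
  fix x :: real assume x: "x \<in> {305/1000..3322/10000}"
  show "(exponent X Y F W has_real_derivative 10 * (ln (2 * x) - ln (1 - 2 * x)) - ln W) (at x)"
    unfolding exponent_def using x
    by (auto intro!: derivative_eq_intros DERIV_chain2[OF entropy_has_real_derivative])
  show "((\<lambda>x. 10 * (ln (2 * x) - ln (1 - 2 * x)) - ln W) has_real_derivative 10 * (1 / x + 2 / (1 - 2 * x))) (at x)"
    using x by (auto intro!: derivative_eq_intros simp: field_simps)
  show "0 \<le> 10 * (1 / x + 2 / (1 - 2 * x))" using x by auto
qed (use assms in \<open>simp_all add: exponent_def entropy_def algebra_simps\<close>)

text \<open>The four numbers round \<open>X\<close>, \<open>Y\<close>, \<open>F\<close> upwards and
  \<open>W\<close> downwards for the weights chosen in \<open>card_tight_three\<close>; the next two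
  lemmas do the same for the sparse and the dense case.\<close>

lemma exponent_three_le:
  assumes "305 / 1000 \<le> x" "x \<le> 3322 / 10000"
  shows "exponent 121 (5 / 2) (1381 / 25) (1037 / 25) x \<le> - (1 / 2000)"
  by (rule exponent_le[OF assms]) (use ln_bounds_121_1 ln_bounds_5_2 ln_bounds_1381_25 ln_bounds_1037_25 ln_bounds_61_100 ln_bounds_39_100 ln_bounds_1661_2500 ln_bounds_839_2500 in simp_all)

lemma exponent_sparse_le:
  assumes "305 / 1000 \<le> x" "x \<le> 3322 / 10000"
  shows "exponent (787 / 5) (72 / 25) (1533 / 25) (1791 / 25) x \<le> - (1 / 2000)"
  by (rule exponent_le[OF assms]) (use ln_bounds_787_5 ln_bounds_72_25 ln_bounds_1533_25 ln_bounds_1791_25 ln_bounds_61_100 ln_bounds_39_100 ln_bounds_1661_2500 ln_bounds_839_2500 in simp_all)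

lemma exponent_dense_le:
  assumes "305 / 1000 \<le> x" "x \<le> 3322 / 10000"
  shows "exponent (261 / 2) (2567 / 1000) (2879 / 50) (1233 / 25) x \<le> - (1 / 2000)"
  by (rule exponent_le[OF assms]) (use ln_bounds_261_2 ln_bounds_2567_1000 ln_bounds_2879_50 ln_bounds_1233_25 ln_bounds_61_100 ln_bounds_39_100 ln_bounds_1661_2500 ln_bounds_839_2500 in simp_all)

text \<open>The rate per left vertex of the union bound for (a), with s = x N and an image of size t
  N. The last term is the effect of the additional edges: its argument is 1 - x (1 - t), where x (1
  - t) is the density of the forbidden membership in S but not in T.\<close>

definition cover_exponent :: "real \<Rightarrow> real \<Rightarrow> real" where
  "cover_exponent x t = - (x * ln x) + 4 * ((1 - x) * ln (1 - x)) + 4 * (t * ln t) - (1 - t) * ln (1 - t)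
     - 5 * ((t - x) * ln (t - x)) + 13/40 * ln (1 - x + x * t)"

lemma DERIV_mult_ln_self:
  assumes "(u has_real_derivative d) (at x)" "0 < u x"
  shows "((\<lambda>x. u x * ln (u x)) has_real_derivative d * (ln (u x) + 1)) (at x)"
  using assms by (auto intro!: derivative_eq_intros simp: algebra_simps)

lemma DERIV_ln_comp:
  assumes "(u has_real_derivative d) (at x)" "0 < u x"
  shows "((\<lambda>x. ln (u x)) has_real_derivative d / u x) (at x)"
  using assms by (auto intro!: derivative_eq_intros)

text \<open>Along a line the second derivative consists of rational terms and of that of the final
  logarithm. Both are kept nonnegative separately: \<open>main\<close> treats the former, and
  \<open>extra\<close> is the numerator g'' g - g'^2 of the latter, with g'' = 2 m. Convexity then
  reduces the claim to the ends.\<close>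

lemma cover_exponent_segment:
  fixes a b m al c :: real
  assumes range: "\<And>x. x \<in> {a..b} \<Longrightarrow> 0 < x \<and> x < 1 \<and> x < al + m * x \<and> al + m * x < 1"
    and main: "\<And>x. x \<in> {a..b} \<Longrightarrow> 0 \<le> - (1 / x) + 4 * (1 / (1 - x)) + 4 * m\<^sup>2 * (1 / (al + m * x))
        - m\<^sup>2 * (1 / (1 - (al + m * x))) - 5 * (m - 1)\<^sup>2 * (1 / (al + m * x - x))"
    and extra: "\<And>x. x \<in> {a..b} \<Longrightarrow> (m * x + (al + m * x) - 1)\<^sup>2 \<le> 2 * m * (1 - x + x * (al + m * x))"
    and ends: "cover_exponent a (al + m * a) \<le> c" "cover_exponent b (al + m * b) \<le> c" and x: "x \<in> {a..b}"
  shows "cover_exponent x (al + m * x) \<le> c"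
proof -
  let ?t = "\<lambda>x. al + m * x" and ?g = "\<lambda>x. 1 - x + x * (al + m * x)"
  define f' where "f' x = - ln x - 4 * ln (1 - x) + 4 * m * ln (?t x) + m * ln (1 - ?t x) - 5 * (m - 1) * ln (?t x - x)
      + 13/40 * ((m * x + ?t x - 1) / ?g x)" for x
  define f'' where "f'' x = - (1 / x) + 4 * (1 / (1 - x)) + 4 * m\<^sup>2 * (1 / ?t x)
        - m\<^sup>2 * (1 / (1 - ?t x)) - 5 * (m - 1)\<^sup>2 * (1 / (?t x - x))
        + 13/40 * ((2 * m * ?g x - (m * x + ?t x - 1)\<^sup>2) / (?g x)\<^sup>2)" for x
  have g: "0 < ?g x" if "x \<in> {a..b}" for x
  proof -
    have "0 < x * ?t x" "0 < 1 - x" using range[OF that] by auto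
    then show ?thesis by linarith
  qed
  show ?thesis
  \<comment> \<open>The added constant collects the terms \<open>+ 1\<close> in the derivatives of u
    ln u. It is identically 0, but this form matches the derivative rule term by term.\<close>
  proof (rule le_if_second_deriv_nonneg[where f = "\<lambda>x. cover_exponent x (?t x)" and f' = "\<lambda>x. f' x + (4 * m - 5 - 5 * (m - 1) + m)" and f'' = f'' and a = a and b = b])
    fix y assume y: "y \<in> {a..b}"
    note r = range[OF y]
    have u: "((\<lambda>x. x) has_real_derivative 1) (at y)" "((\<lambda>x. 1 - x) has_real_derivative - 1) (at y)"
      "(?t has_real_derivative m) (at y)" "((\<lambda>x. 1 - ?t x) has_real_derivative - m) (at y)"
      "((\<lambda>x. ?t x - x) has_real_derivative m - 1) (at y)"
      "(?g has_real_derivative m * y + ?t y - 1) (at y)"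
      "((\<lambda>x. m * x + ?t x - 1) has_real_derivative 2 * m) (at y)"
      by (auto intro!: derivative_eq_intros)
    have pos: "0 < y" "0 < 1 - y" "0 < ?t y" "0 < 1 - ?t y" "0 < ?t y - y" "0 < ?g y"
      using r g[OF y] by auto
    note D = DERIV_mult_ln_self[OF u(1) pos(1)] DERIV_mult_ln_self[OF u(2) pos(2)] DERIV_mult_ln_self[OF u(3) pos(3)]
      DERIV_mult_ln_self[OF u(4) pos(4)] DERIV_mult_ln_self[OF u(5) pos(5)] DERIV_ln_comp[OF u(6) pos(6)]
    show "((\<lambda>x. cover_exponent x (?t x)) has_real_derivative f' y + (4 * m - 5 - 5 * (m - 1) + m)) (at y)"
      unfolding cover_exponent_def f'_def
      by (rule DERIV_cong[OF DERIV_add[OF DERIV_diff[OF DERIV_diff[OF DERIV_add[OF DERIV_add[OF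
            DERIV_minus[OF D(1)] DERIV_cmult[OF D(2)]] DERIV_cmult[OF D(3)]] D(4)] DERIV_cmult[OF D(5)]] DERIV_cmult[OF D(6)]]])
        (simp add: algebra_simps)
    note L = DERIV_ln_comp[OF u(1) pos(1)] DERIV_ln_comp[OF u(2) pos(2)] DERIV_ln_comp[OF u(3) pos(3)]
      DERIV_ln_comp[OF u(4) pos(4)] DERIV_ln_comp[OF u(5) pos(5)] DERIV_divide[OF u(7) u(6) pos(6)[THEN less_imp_neq, symmetric]]
    have "(f' has_real_derivative f'' y) (at y)"
      unfolding f'_def f''_def
      by (rule DERIV_cong[OF DERIV_add[OF DERIV_diff[OF DERIV_add[OF DERIV_add[OF DERIV_diff[OF
            DERIV_minus[OF L(1)] DERIV_cmult[OF L(2)]] DERIV_cmult[OF L(3)]] DERIV_cmult[OF L(4)]] DERIV_cmult[OF L(5)]] DERIV_cmult[OF L(6)]]])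
        (simp add: power2_eq_square algebra_simps diff_divide_distrib add_divide_distrib)
    then show "((\<lambda>x. f' x + (4 * m - 5 - 5 * (m - 1) + m)) has_real_derivative f'' y) (at y)"
      using DERIV_add[OF _ DERIV_const] by fastforce
    have "0 \<le> (2 * m * ?g y - (m * y + ?t y - 1)\<^sup>2) / (?g y)\<^sup>2"
      using extra[OF y] by (intro divide_nonneg_nonneg) auto
    then show "0 \<le> f'' y"
      unfolding f''_def by (intro add_nonneg_nonneg[OF main[OF y] mult_nonneg_nonneg]) auto
  qed (use ends x in auto)
qed

lemma power2_le_one: "- 1 \<le> u \<Longrightarrow> u \<le> 1 \<Longrightarrow> u\<^sup>2 \<le> (1::real)"
  by (simp add: abs_square_le_1)

text \<open>The rate per left vertex of the union bound for \<open>crowded\<close>, with x = m / N.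
  Choosing the vertices gives one entropy, the ratio of slot subsets removes five, choosing the
  pairs gives half of entropy (2 x), and the coefficient 10 m over 5 (m + 1) is bounded by 2^(10
  m).\<close>

definition crowd_exponent :: "real \<Rightarrow> real" where
  "crowd_exponent x = - 4 * entropy x + entropy (2 * x) / 2 + 10 * x * ln 2"

text \<open>Convex again. The right end stays below the zero of the rate: the value is about -0.012
  at 0.305 and about 0.079 at \<open>C3\<close>.\<close>

lemma crowd_exponent_le:
  assumes "1/20 \<le> x" "x \<le> 305/1000"
  shows "crowd_exponent x \<le> - (1/1000)"
proof (rule le_if_second_deriv_nonneg[where f = crowd_exponent and a = "1/20" and b = "305/1000"
      and f' = "\<lambda>x. - 4 * (ln (1 - x) - ln x) + (ln (1 - 2 * x) - ln (2 * x)) + 10 * ln 2"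
      and f'' = "\<lambda>x. 4 * (1 / (1 - x) + 1 / x) - (2 / (1 - 2 * x) + 1 / x)"])
  fix x :: real assume x: "x \<in> {1/20..305/1000}"
  show "(crowd_exponent has_real_derivative - 4 * (ln (1 - x) - ln x) + (ln (1 - 2 * x) - ln (2 * x)) + 10 * ln 2) (at x)"
    unfolding crowd_exponent_def using x
    by (auto intro!: derivative_eq_intros DERIV_chain2[OF entropy_has_real_derivative])
  show "((\<lambda>x. - 4 * (ln (1 - x) - ln x) + (ln (1 - 2 * x) - ln (2 * x)) + 10 * ln 2) has_real_derivative
      4 * (1 / (1 - x) + 1 / x) - (2 / (1 - 2 * x) + 1 / x)) (at x)"
    using x by (auto intro!: derivative_eq_intros simp: field_simps)
  have "1 / x \<ge> 1000/305" "2 / (1 - 2 * x) \<le> 2000/390" "1 / (1 - x) \<ge> 1" using x by (auto simp: field_simps)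
  then show "0 \<le> 4 * (1 / (1 - x) + 1 / x) - (2 / (1 - 2 * x) + 1 / x)" by (simp add: distrib_left)
next
  show "crowd_exponent (1/20) \<le> - (1/1000)"
    using ln_bounds_1_20 ln_bounds_19_20 ln_bounds_1_10 ln_bounds_9_10 ln2_bounds by (simp add: crowd_exponent_def entropy_def diff_divide_distrib)
  show "crowd_exponent (305/1000) \<le> - (1/1000)"
    using ln_bounds_61_200 ln_bounds_139_200 ln_bounds_61_100 ln_bounds_39_100 ln2_bounds by (simp add: crowd_exponent_def entropy_def diff_divide_distrib)
qed (use assms in auto)

text \<open>The four pieces are written as \<open>al + m * x\<close>, with the trivial
  \<open>0 +\<close> and \<open>1 *\<close> kept, to fit \<open>cover_exponent_segment\<close>. The
  slopes are C2/C1, (C4 - C2)/(C3 - C1), 1 and (1 - C6)/(1 - C5).\<close>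

lemma e_first: "x \<le> 2301/10000 \<Longrightarrow> e x = 0 + 4377/2301 * x"
  by (simp add: e_def line_through_def C1_def C2_def C3_def)

lemma e_second: "2301/10000 < x \<Longrightarrow> x \<le> 3322/10000 \<Longrightarrow> e x = (4377/10000 - 1246/1021 * (2301/10000)) + 1246/1021 * x"
  by (simp add: e_def line_through_def C1_def C2_def C3_def C4_def field_simps)

lemma e_third: "3322/10000 < x \<Longrightarrow> x \<le> 4377/10000 \<Longrightarrow> e x = 2301/10000 + 1 * x"
  by (simp add: e_def line_through_def C1_def C2_def C3_def C4_def C5_def C6_def)

lemma e_fourth: "4377/10000 < x \<Longrightarrow> e x = (1 - 3322/5623) + 3322/5623 * x"
  by (simp add: e_def line_through_def C1_def C2_def C3_def C4_def C5_def C6_def field_simps)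

text \<open>The margin is smallest at C1, about 0.003. The two middle values agree because the rate
  is invariant under (x, t) to (1 - t, 1 - x), which exchanges (C3,C4) and (C5,C6).\<close>

lemma cover_exponent_breakpoints:
  "cover_exponent (1/20) (0 + 4377/2301 * (1/20)) \<le> - (1/1000)"
  "cover_exponent (2301/10000) (4377/10000) \<le> - (1/1000)"
  "cover_exponent (3322/10000) (5623/10000) \<le> - (1/1000)"
  "cover_exponent (4377/10000) (6678/10000) \<le> - (1/1000)"
  "cover_exponent (19/20) ((1 - 3322/5623) + 3322/5623 * (19/20)) \<le> - (1/1000)"
proof -
  \<comment> \<open>At the outer points 1/20 and 19/20 it suffices that the logarithm from the
    additional edges is not positive; at the inner points its argument is rounded up to a number
    with a known enclosure.\<close>
  have 1: "ln (292919 / 306800) \<le> (0::real)" and 5: "ln (1093041 / 1124600) \<le> (0::real)" "ln (54569 / 56230) \<le> (0::real)" by simp_all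
  have 2: "ln (87061477/100000000) \<le> ln (8707/10000 :: real)" by simp
  have 3: "ln (42729803/50000000) \<le> ln (4273/5000 :: real)" by simp
  show "cover_exponent (1/20) (0 + 4377/2301 * (1/20)) \<le> - (1/1000)"
    using ln_bounds_1_20 ln_bounds_19_20 ln_bounds_1459_15340 ln_bounds_13881_15340 ln_bounds_173_3835 by (simp add: cover_exponent_def) (use 1 in linarith)
  show "cover_exponent (2301/10000) (4377/10000) \<le> - (1/1000)"
    using ln_bounds_2301_10000 ln_bounds_7699_10000 ln_bounds_4377_10000 ln_bounds_5623_10000 ln_bounds_519_2500 ln_bounds_8707_10000 by (simp add: cover_exponent_def) (use 2 in linarith)
  show "cover_exponent (3322/10000) (5623/10000) \<le> - (1/1000)"
    using ln_bounds_1661_5000 ln_bounds_3339_5000 ln_bounds_5623_10000 ln_bounds_4377_10000 ln_bounds_2301_10000 ln_bounds_4273_5000 by (simp add: cover_exponent_def) (use 3 in linarith)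
  show "cover_exponent (4377/10000) (6678/10000) \<le> - (1/1000)"
    using ln_bounds_4377_10000 ln_bounds_5623_10000 ln_bounds_3339_5000 ln_bounds_1661_5000 ln_bounds_2301_10000 ln_bounds_4273_5000 by (simp add: cover_exponent_def) (use 3 in linarith)
  show "cover_exponent (19/20) ((1 - 3322/5623) + 3322/5623 * (19/20)) \<le> - (1/1000)"
    using ln_bounds_1_20 ln_bounds_19_20 ln_bounds_1661_56230 ln_bounds_2301_112460 by (simp add: cover_exponent_def) (use 5 in linarith)
qed

lemma cover_exponent_e:
  assumes "1/20 \<le> x" "x \<le> 19/20"
  shows "cover_exponent x (e x) \<le> - (1/1000)" "x < e x" "1/20 \<le> e x" "e x \<le> 49/50"
proof -
  consider (1) "x \<in> {1/20..2301/10000}" | (2) "2301/10000 < x" "x \<in> {2301/10000..3322/10000}"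
    | (3) "3322/10000 < x" "x \<in> {3322/10000..4377/10000}" | (4) "4377/10000 < x" "x \<in> {4377/10000..19/20}"
    using assms by fastforce
  then have "cover_exponent x (e x) \<le> - (1/1000) \<and> x < e x \<and> 1/20 \<le> e x \<and> e x \<le> 49/50"
  proof cases
    case 1
    have "cover_exponent x (0 + 4377/2301 * x) \<le> - (1/1000)"
    proof (rule cover_exponent_segment[where a = "1/20" and b = "2301/10000"])
      fix y :: real assume y: "y \<in> {1/20..2301/10000}"
      \<comment> \<open>The first piece passes through the origin, so two of the reciprocals are
        multiples of 1 / y and the inequality becomes linear in three independently bounded
        quantities.\<close>
      have "1 / (0 + 4377/2301 * y) = 2301/4377 * (1 / y)" "1 / (0 + 4377/2301 * y - y) = 2301/2076 * (1 / y)"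
        using y by (auto simp: field_simps)
      moreover have "1 / y \<ge> 10000/2301" "1 / (1 - y) \<ge> 1" "1 / (1 - (0 + 4377/2301 * y)) \<le> 10000/5623"
        using y by (auto simp: field_simps)
      moreover have "0 \<le> - A + 4 * B + 4 * (4377/2301)\<^sup>2 * (2301/4377 * A) - (4377/2301)\<^sup>2 * C - 5 * (4377/2301 - 1)\<^sup>2 * (2301/2076 * A)"
        if "A \<ge> 10000/2301" "B \<ge> 1" "C \<le> 10000/5623" for A B C :: real using that by (simp add: power2_eq_square)
      ultimately show "0 \<le> - (1 / y) + 4 * (1 / (1 - y)) + 4 * (4377/2301)\<^sup>2 * (1 / (0 + 4377/2301 * y))
        - (4377/2301)\<^sup>2 * (1 / (1 - (0 + 4377/2301 * y))) - 5 * (4377/2301 - 1)\<^sup>2 * (1 / (0 + 4377/2301 * y - y))"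
        by presburger
      have "0 \<le> y * (0 + 4377/2301 * y)" using y by auto
      moreover have "(4377/2301 * y + (0 + 4377/2301 * y) - 1)\<^sup>2 \<le> 1" by (rule power2_le_one) (use y in auto)
      moreover have "1 \<le> 2 * (4377/2301) * (1 - y)" using y by simp
      moreover have "2 * (4377/2301) * (1 - y) \<le> 2 * (4377/2301) * (1 - y + y * (0 + 4377/2301 * y))"
        using \<open>0 \<le> y * (0 + 4377/2301 * y)\<close> by (intro mult_left_mono) auto
      ultimately show "(4377/2301 * y + (0 + 4377/2301 * y) - 1)\<^sup>2 \<le> 2 * (4377/2301) * (1 - y + y * (0 + 4377/2301 * y))"
        by (meson order_trans)
    qed (use cover_exponent_breakpoints 1 in auto)
    then show ?thesis using 1 by (simp add: e_first)
  next
    case 2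
    let ?m = "1246/1021 :: real" and ?al = "4377/10000 - 1246/1021 * (2301/10000) :: real"
    have "cover_exponent x (?al + ?m * x) \<le> - (1/1000)"
    proof (rule cover_exponent_segment[where a = "2301/10000" and b = "3322/10000"])
      fix y :: real assume y: "y \<in> {2301/10000..3322/10000}"
      have "1 / y \<le> 10000/2301" "1 / (1 - y) \<ge> 10000/7699" "1 / (?al + ?m * y) \<ge> 10000/5623"
         "1 / (1 - (?al + ?m * y)) \<le> 10000/4377" "1 / (?al + ?m * y - y) \<le> 10000/2076"
        using y by (auto simp: field_simps)
      moreover have "0 \<le> - A + 4 * B + 4 * ?m\<^sup>2 * C - ?m\<^sup>2 * D - 5 * (?m - 1)\<^sup>2 * E"
        if "A \<le> 10000/2301" "B \<ge> 10000/7699" "C \<ge> 10000/5623" "D \<le> 10000/4377" "E \<le> 10000/2076" for A B C D E :: real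
        using that by (simp add: power2_eq_square)
      ultimately show "0 \<le> - (1 / y) + 4 * (1 / (1 - y)) + 4 * ?m\<^sup>2 * (1 / (?al + ?m * y))
        - ?m\<^sup>2 * (1 / (1 - (?al + ?m * y))) - 5 * (?m - 1)\<^sup>2 * (1 / (?al + ?m * y - y))"
        by presburger
      have "0 \<le> y * (?al + ?m * y)" using y by auto
      moreover have "(?m * y + (?al + ?m * y) - 1)\<^sup>2 \<le> 1" by (rule power2_le_one) (use y in auto)
      moreover have "1 \<le> 2 * ?m * (1 - y)" using y by simp
      moreover have "2 * ?m * (1 - y) \<le> 2 * ?m * (1 - y + y * (?al + ?m * y))"
        using \<open>0 \<le> y * (?al + ?m * y)\<close> by (intro mult_left_mono) auto
      ultimately show "(?m * y + (?al + ?m * y) - 1)\<^sup>2 \<le> 2 * ?m * (1 - y + y * (?al + ?m * y))"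
        by (meson order_trans)
    qed (use cover_exponent_breakpoints 2 in auto)
    then show ?thesis using 2 by (simp add: e_second)
  next
    case 3
    let ?al = "2301/10000 :: real"
    have "cover_exponent x (?al + 1 * x) \<le> - (1/1000)"
    proof (rule cover_exponent_segment[where a = "3322/10000" and b = "4377/10000"])
      fix y :: real assume y: "y \<in> {3322/10000..4377/10000}"
      have "1 / y \<le> 10000/3322" "1 / (1 - y) \<ge> 10000/6678" "1 / (?al + 1 * y) \<ge> 10000/6678"
         "1 / (1 - (?al + 1 * y)) \<le> 10000/3322"
        using y by (auto simp: field_simps)
      then show "0 \<le> - (1 / y) + 4 * (1 / (1 - y)) + 4 * 1\<^sup>2 * (1 / (?al + 1 * y))
        - 1\<^sup>2 * (1 / (1 - (?al + 1 * y))) - 5 * (1 - 1)\<^sup>2 * (1 / (?al + 1 * y - y))"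
        by simp
      have "0 \<le> y * (?al + 1 * y)" using y by auto
      moreover have "(1 * y + (?al + 1 * y) - 1)\<^sup>2 \<le> 1" by (rule power2_le_one) (use y in auto)
      moreover have "1 \<le> 2 * 1 * (1 - y)" using y by simp
      moreover have "2 * 1 * (1 - y) \<le> 2 * 1 * (1 - y + y * (?al + 1 * y))"
        using \<open>0 \<le> y * (?al + 1 * y)\<close> by (intro mult_left_mono) auto
      ultimately show "(1 * y + (?al + 1 * y) - 1)\<^sup>2 \<le> 2 * 1 * (1 - y + y * (?al + 1 * y))"
        by (meson order_trans)
    qed (use cover_exponent_breakpoints 3 in auto)
    then show ?thesis using 3 by (simp add: e_third)
  next
    case 4
    let ?m = "3322/5623 :: real" and ?al = "1 - 3322/5623 :: real"
    have "cover_exponent x (?al + ?m * x) \<le> - (1/1000)"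
    proof (rule cover_exponent_segment[where a = "4377/10000" and b = "19/20"])
      fix y :: real assume y: "y \<in> {4377/10000..19/20}"
      \<comment> \<open>The last piece passes through (1,1), so two of the reciprocals are multiples
        of 1 / (1 - y).\<close>
      have "1 / (1 - (?al + ?m * y)) = 5623/3322 * (1 / (1 - y))" "1 / (?al + ?m * y - y) = 5623/2301 * (1 / (1 - y))"
        using y by (auto simp: field_simps)
      moreover have "1 / y \<le> 10000/4377" "1 / (1 - y) \<ge> 10000/5623" "1 / (?al + ?m * y) \<ge> 0"
        using y by (auto simp: field_simps)
      moreover have "0 \<le> - A + 4 * B + 4 * ?m\<^sup>2 * C - ?m\<^sup>2 * (5623/3322 * B) - 5 * (?m - 1)\<^sup>2 * (5623/2301 * B)"
        if "A \<le> 10000/4377" "B \<ge> 10000/5623" "C \<ge> 0" for A B C :: real using that by (simp add: power2_eq_square)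
      ultimately show "0 \<le> - (1 / y) + 4 * (1 / (1 - y)) + 4 * ?m\<^sup>2 * (1 / (?al + ?m * y))
        - ?m\<^sup>2 * (1 / (1 - (?al + ?m * y))) - 5 * (?m - 1)\<^sup>2 * (1 / (?al + ?m * y - y))"
        by presburger
      \<comment> \<open>On this piece 1 - y + y t equals 1 - m y (1 - y) with m = 3322/5623, hence
        it is at least 1 - m / 4, which exceeds 0.85.\<close>
      have "0 \<le> (y - 1/2)\<^sup>2" by simp
      then have "y - y * y \<le> 1/4" by (simp add: power2_eq_square algebra_simps)
      then have "3/4 + 1/10 \<le> 1 - y + y * (?al + ?m * y)" by (simp add: algebra_simps)
      moreover have "(?m * y + (?al + ?m * y) - 1)\<^sup>2 = (?m * (2 * y - 1))\<^sup>2"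
        by (rule arg_cong[where f = "\<lambda>u. u\<^sup>2"]) (simp add: field_simps)
      moreover have "(?m * (2 * y - 1))\<^sup>2 = ?m\<^sup>2 * (2 * y - 1)\<^sup>2" by (rule power_mult_distrib)
      moreover have "(2 * y - 1)\<^sup>2 \<le> 1" by (rule power2_le_one) (use y in auto)
      moreover have "?m\<^sup>2 * S \<le> 2 * ?m * G" if "S \<le> 1" "3/4 + 1/10 \<le> G" for S G :: real
        using that by (simp add: power2_eq_square)
      ultimately show "(?m * y + (?al + ?m * y) - 1)\<^sup>2 \<le> 2 * ?m * (1 - y + y * (?al + ?m * y))"
        by presburger
    qed (use cover_exponent_breakpoints 4 in auto)
    then show ?thesis using 4 by (simp add: e_fourth)
  qed
  then show "cover_exponent x (e x) \<le> - (1/1000)" "x < e x" "1/20 \<le> e x" "e x \<le> 49/50" by auto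
qed

section \<open>Bounds for the bad permutations\<close>

text \<open>The usual bound (e n / k)^k with Euler's number replaced by 3, obtained from the weight
  k / n.\<close>

lemma binomial_le_power:
  assumes "0 < k" "k \<le> n"
  shows "real (n choose k) \<le> (3 * real n / k) ^ k"
proof -
  have "(1 + real k / n) ^ n \<le> exp (real k / n) ^ n"
    by (intro power_mono exp_ge_add_one_self) auto
  also have "\<dots> = exp (real k)" using assms by (simp add: exp_of_nat_mult[symmetric])
  also have "\<dots> = exp 1 ^ k" using exp_of_nat_mult[of k "1::real"] by simp
  also have "\<dots> \<le> 3 ^ k" by (intro power_mono exp_le) auto
  finally have "(1 + real k / n) ^ n / (real k / n) ^ k \<le> 3 ^ k / (real k / n) ^ k"
    using assms by (intro divide_right_mono) auto
  moreover have "real (n choose k) \<le> (1 + real k / n) ^ n / (real k / n) ^ k"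
    using assms by (intro binomial_le_genfun) auto
  ultimately show ?thesis using assms by (simp add: power_divide power_mult_distrib)
qed

lemma card_covered_le:
  assumes "s \<le> 2 * n" "t \<le> 2 * n" "n > 0"
  shows "real (card (covered_perms n K s t)) \<le> fact (10 * n) * (real (2 * n choose s) * real (2 * n choose t) * (real t / (2 * n)) ^ (5 * s))"
proof -
  let ?c = "card (covered_perms n K s t)" and ?C = "real (10 * n choose (5 * s))"
  have "?c * (10 * n choose (5 * s)) \<le> (2 * n choose s) * (2 * n choose t) * (fact (10 * n) * ((5 * t) choose (5 * s)))"
    by (rule order_trans[OF card_covered]) (intro mult_right_mono card_covering_pairs_le, simp)
  from of_nat_mono[OF this, where 'a = real]
  have "real ?c * ?C \<le> real (2 * n choose s) * real (2 * n choose t) * (fact (10 * n) * real ((5 * t) choose (5 * s)))"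
    by (simp only: of_nat_mult of_nat_fact)
  also have "\<dots> \<le> real (2 * n choose s) * real (2 * n choose t) * (fact (10 * n) * ((real (5 * t) / real (10 * n)) ^ (5 * s) * ?C))"
    using assms by (intro mult_left_mono binomial_ratio_le_power) auto
  also have "real (5 * t) / real (10 * n) = real t / (2 * n)" by simp
  finally have "real ?c * ?C \<le> (fact (10 * n) * (real (2 * n choose s) * real (2 * n choose t) * (real t / (2 * n)) ^ (5 * s))) * ?C"
    by (simp only: mult_ac)
  moreover have "?C > 0" using assms by simp
  ultimately show ?thesis by (simp only: mult_le_cancel_right_pos)
qed

lemma card_covered_eq_0:
  assumes "t < s" "s \<le> 2 * n"
  shows "card (covered_perms n K s t) = 0"
proof -
  have "card (covered_perms n K s t) * (10 * n choose (5 * s)) = 0"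
    using card_covered[of n K s t] assms by (simp add: binomial_eq_0)
  then show ?thesis using assms by simp
qed

text \<open>With N = 2 n and t \<le> 2 s the union bound is at most (216 (s/N)^2)^s. One factor s/N
  \<le> 1/20 is spent to reach the shape required by \<open>sum_power_small\<close>.\<close>

lemma card_covered_small:
  assumes n: "n > 0" and s: "0 < s" "10 * s \<le> n" and t: "t \<le> 2 * s"
  shows "real (card (covered_perms n K s t)) \<le> fact (10 * n) * (54 / 5 * real s / (2 * n)) ^ s"
proof (cases "t < s")
  case True
  then show ?thesis using card_covered_eq_0[of t s n K] s by simp
next
  case False
  define N where "N = 2 * real n"
  have N: "N > 0" "real (2 * n) = N" using n by (auto simp: N_def)
  have sN: "20 * real s \<le> N" using s by (simp add: N_def)
  have "real (2 * n choose t) * (real t / N) ^ (5 * s) \<le> (3 * N / t) ^ t * (real t / N) ^ (5 * s)"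
    using binomial_le_power[of t "2 * n", unfolded N(2)] False s t N by (intro mult_right_mono) auto
  also have "\<dots> = 3 ^ t * (real t / N) ^ (5 * s - t)"
  proof -
    have "(real t / N) ^ (5 * s) = (real t / N) ^ t * (real t / N) ^ (5 * s - t)"
      using t by (simp add: power_add[symmetric])
    moreover have "(3 * N / t) ^ t * (real t / N) ^ t = 3 ^ t"
      unfolding power_mult_distrib[symmetric] using N False s by simp
    ultimately show ?thesis by (simp only: mult.assoc[symmetric])
  qed
  also have "\<dots> \<le> 3 ^ (2 * s) * (2 * real s / N) ^ (3 * s)"
  proof (intro mult_mono)
    have "(real t / N) ^ (5 * s - t) \<le> (2 * real s / N) ^ (5 * s - t)"
      using t N by (intro power_mono divide_right_mono) auto
    also have "\<dots> \<le> (2 * real s / N) ^ (3 * s)"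
      using t N sN by (intro power_decreasing) auto
    finally show "(real t / N) ^ (5 * s - t) \<le> (2 * real s / N) ^ (3 * s)" .
  qed (use t N in \<open>auto intro: power_increasing\<close>)
  finally have 1: "real (2 * n choose t) * (real t / N) ^ (5 * s) \<le> (9 * (2 * real s / N) ^ 3) ^ s"
    by (simp add: power_mult_distrib power_mult)
  have 2: "real (2 * n choose s) \<le> (3 * N / s) ^ s" using binomial_le_power[of s "2 * n", unfolded N(2)] s by simp
  have "real (2 * n choose s) * (real (2 * n choose t) * (real t / N) ^ (5 * s)) \<le> (3 * N / s) ^ s * (9 * (2 * real s / N) ^ 3) ^ s"
    using N by (intro mult_mono 1 2) auto
  also have "\<dots> = (216 * (real s / N)\<^sup>2) ^ s"
    unfolding power_mult_distrib[symmetric] using N s by (simp add: power2_eq_square power3_eq_cube)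
  also have "\<dots> \<le> (54 / 5 * real s / N) ^ s"
  proof (rule power_mono)
    have "real s / N * (real s / N) \<le> 1 / 20 * (real s / N)" using N sN by (intro mult_right_mono) (auto simp: field_simps)
    then show "216 * (real s / N)\<^sup>2 \<le> 54 / 5 * real s / N" by (simp add: power2_eq_square)
  qed simp
  finally have 3: "fact (10 * n) * (real (2 * n choose s) * real (2 * n choose t) * (real t / N) ^ (5 * s)) \<le> fact (10 * n) * (54 / 5 * real s / N) ^ s"
    by (intro mult_left_mono) (auto simp: mult.assoc)
  have "real (card (covered_perms n K s t)) \<le> fact (10 * n) * (real (2 * n choose s) * real (2 * n choose t) * (real t / N) ^ (5 * s))"
    using card_covered_le[of s n t K] s t n by (simp add: N_def)
  then show ?thesis unfolding N(2) using 3 by (rule order_trans)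
qed

text \<open>The complements of S and T are small here. Trinomial revision replaces the ratio of
  binomial coefficients by 5 s over 5 t divided by 10 n over 5 t, after which the argument for small
  sets applies. The number 59/100 lies just below the last slope 3322/5623 of
  \<open>e\<close>.\<close>

lemma card_covered_large:
  assumes n: "n > 0" and s: "0 < s" "10 * s \<le> n" and t: "t \<le> s" "59 * s \<le> 100 * t"
  shows "real (card (covered_perms n K (2 * n - s) (2 * n - t))) \<le> fact (10 * n) * (18 * real s / (2 * n)) ^ s"
proof -
  let ?c = "card (covered_perms n K (2 * n - s) (2 * n - t))" and ?M = "10 * n"
  let ?p = "(2 * n choose s) * (2 * n choose t)"
  define N where "N = 2 * real n"
  have N: "N > 0" "real (2 * n) = N" using n by (auto simp: N_def)
  have sN: "20 * real s \<le> N" using s by (simp add: N_def)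
  have t0: "0 < t" using t s by simp
  have st: "s \<le> 2 * n" "t \<le> 2 * n" using s t by auto
  have e: "5 * (2 * n - s) = ?M - 5 * s" "5 * (2 * n - t) = ?M - 5 * t" by auto
  have "?c * (?M choose (5 * (2 * n - s))) \<le> (2 * n choose (2 * n - s)) * (2 * n choose (2 * n - t)) * (fact ?M * ((5 * (2 * n - t)) choose (5 * (2 * n - s))))"
    by (rule order_trans[OF card_covered]) (intro mult_right_mono card_covering_pairs_le, simp)
  then have "?c * (?M choose (?M - 5 * s)) \<le> ?p * (fact ?M * ((?M - 5 * t) choose (?M - 5 * s)))"
    unfolding e binomial_symmetric[OF st(1)] binomial_symmetric[OF st(2)] .
  then have "?c * (?M choose (?M - 5 * s)) * (?M choose (?M - 5 * t)) \<le> ?p * (fact ?M * ((?M - 5 * t) choose (?M - 5 * s))) * (?M choose (?M - 5 * t))"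
    by (rule mult_right_mono) simp
  also have "\<dots> = ?p * fact ?M * ((?M choose (?M - 5 * t)) * ((?M - 5 * t) choose (?M - 5 * s)))" by (simp only: mult_ac)
  also have "(?M choose (?M - 5 * t)) * ((?M - 5 * t) choose (?M - 5 * s)) = (?M choose (?M - 5 * s)) * ((5 * s) choose (5 * t))"
  proof -
    have q: "?M - (?M - 5 * s) = 5 * s" "(?M - 5 * t) - (?M - 5 * s) = 5 * s - 5 * t" using st s t by auto
    have "(?M choose (?M - 5 * t)) * ((?M - 5 * t) choose (?M - 5 * s)) = (?M choose (?M - 5 * s)) * ((?M - (?M - 5 * s)) choose ((?M - 5 * t) - (?M - 5 * s)))"
      using t st by (intro choose_mult) auto
    moreover have "(5 * s choose (5 * t)) = (5 * s choose (5 * s - 5 * t))" using t by (intro binomial_symmetric) auto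
    ultimately show ?thesis unfolding q by simp
  qed
  also have "(?M choose (?M - 5 * t)) = (?M choose (5 * t))" using st by (intro binomial_symmetric[symmetric]) auto
  finally have "(?M choose (?M - 5 * s)) * (?c * (?M choose (5 * t))) \<le> (?M choose (?M - 5 * s)) * (?p * fact ?M * ((5 * s) choose (5 * t)))"
    by (simp only: mult_ac)
  then have "?c * (?M choose (5 * t)) \<le> ?p * fact ?M * ((5 * s) choose (5 * t))"
    by (simp only: nat_mult_le_cancel_disj) simp
  from of_nat_mono[OF this, where 'a = real]
  have "real ?c * real (?M choose (5 * t)) \<le> real ?p * fact ?M * real ((5 * s) choose (5 * t))"
    by (simp only: of_nat_mult of_nat_fact)
  also have "\<dots> \<le> real ?p * fact ?M * ((real (5 * s) / real ?M) ^ (5 * t) * real (?M choose (5 * t)))"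
    using st s n by (intro mult_left_mono binomial_ratio_le_power) auto
  also have "real (5 * s) / real ?M = real s / N" by (simp add: N_def)
  finally have "real ?c * real (?M choose (5 * t)) \<le> (real ?p * fact ?M * (real s / N) ^ (5 * t)) * real (?M choose (5 * t))"
    by (simp only: mult_ac)
  moreover have "0 < real (?M choose (5 * t))" using st by simp
  ultimately have c: "real ?c \<le> real ?p * fact ?M * (real s / N) ^ (5 * t)" by (simp only: mult_le_cancel_right_pos)
  have 1: "real (2 * n choose s) \<le> (3 * N / s) ^ s" using binomial_le_power[of s "2 * n", unfolded N(2)] s st by simp
  have "real (2 * n choose t) \<le> (3 * N / t) ^ t" using binomial_le_power[of t "2 * n", unfolded N(2)] t0 st by simp
  also have "\<dots> \<le> (6 * N / s) ^ t"
    using N s t t0 by (intro power_mono) (auto simp: field_simps)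
  finally have 2: "real (2 * n choose t) \<le> (6 * N / s) ^ t" .
  have "real ?p * (real s / N) ^ (5 * t) \<le> ((3 * N / s) ^ s * (6 * N / s) ^ t) * (real s / N) ^ (5 * t)"
    unfolding of_nat_mult using N by (intro mult_right_mono mult_mono 1 2) auto
  also have "\<dots> = 3 ^ s * 6 ^ t * (real s / N) ^ (4 * t - s)"
  proof -
    have r: "(real s / N) ^ (5 * t) = (real s / N) ^ s * (real s / N) ^ t * (real s / N) ^ (4 * t - s)"
      using t by (simp add: power_add[symmetric])
    have c: "(3 * N / s) ^ s * (real s / N) ^ s = 3 ^ s" "(6 * N / s) ^ t * (real s / N) ^ t = 6 ^ t"
      unfolding power_mult_distrib[symmetric] using N s by auto
    have "((3 * N / s) ^ s * (6 * N / s) ^ t) * (real s / N) ^ (5 * t)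
        = ((3 * N / s) ^ s * (real s / N) ^ s) * ((6 * N / s) ^ t * (real s / N) ^ t) * (real s / N) ^ (4 * t - s)"
      unfolding r by (simp only: mult_ac)
    then show ?thesis by (simp only: c)
  qed
  also have "\<dots> \<le> 3 ^ s * 6 ^ s * (real s / N) ^ s"
  proof (intro mult_mono)
    show "(real s / N) ^ (4 * t - s) \<le> (real s / N) ^ s" using t N sN by (intro power_decreasing) auto
  qed (use t N in \<open>auto intro: power_increasing\<close>)
  also have "\<dots> = (18 * real s / N) ^ s" by (simp add: power_mult_distrib[symmetric])
  finally have "fact ?M * (real ?p * (real s / N) ^ (5 * t)) \<le> fact ?M * (18 * real s / N) ^ s"
    by (intro mult_left_mono) auto
  moreover have "real ?c \<le> fact ?M * (real ?p * (real s / N) ^ (5 * t))" using c by (simp only: mult_ac)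
  ultimately show ?thesis unfolding N(2) by linarith
qed

lemma card_covered_all:
  assumes "t < 2 * n"
  shows "card (covered_perms n K (2 * n) t) = 0"
  by (rule card_covered_eq_0) (use assms in auto)

text \<open>The weights are the saddle points of the separate binomial counts, y = x / (1 - x), w =
  tau / (1 - tau) and th = x / (tau - x). With them the effect of the additional edges becomes the
  single factor g for each index below \<open>K\<close>.\<close>

lemma card_covered_middle:
  fixes n K s t :: nat and x tau :: real
  assumes n: "n > 0" and K: "real K \<le> 13/40 * (2 * n)" "13/40 * (2 * n) < real K + 1"
    and x: "x = real s / (2 * n)" "1/20 \<le> x" "x \<le> 19/20"
    and tau: "x < tau" "1/20 \<le> tau" "tau \<le> 49/50"
    and t: "real t \<le> tau * (2 * n)" "tau * (2 * n) \<le> real t + 1"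
  shows "real (card (covered_perms n K s t)) \<le> fact (10 * n) * ((10 * real n + 1) * 20000 * exp (2 * real n * cover_exponent x tau))"
proof -
  let ?c = "real (card (covered_perms n K s t))"
  let ?np = "card (covering_pairs n K s t)"
  define N where "N = 2 * real n"
  have N: "N > 0" using n by (simp add: N_def)
  have sx: "real s = N * x" using n x by (simp add: N_def)
  have x01: "0 < x" "x < 1" using x by linarith+
  have "0 < real s" "real s < N * 1"
    unfolding sx using mult_pos_pos[OF N x01(1)] mult_strict_left_mono[OF x01(2) N] by auto
  then have s: "0 < s" "s < 2 * n" "0 < x" "x < 1" using x01 by (auto simp: N_def)
  have tau1: "0 < tau" "tau < 1" using tau x by auto
  have K2: "K \<le> 2 * n" using K n by linarith
  define y w th g where "y = x / (1 - x)" and "w = tau / (1 - tau)" and "th = x / (tau - x)" and "g = 1 - x + x * tau"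
  have pos: "y > 0" "w > 0" "th > 0" using s tau tau1 by (auto simp: y_def w_def th_def)
  have "0 < x * tau" using s tau1 by simp
  then have g: "1/20 \<le> g" "0 < g" using x(2,3) by (auto simp: g_def)
  have "x * tau \<le> x" using s tau1 by simp
  then have g1: "g \<le> 1" by (simp add: g_def)
  have lns: "ln y = ln x - ln (1 - x)" "ln w = ln tau - ln (1 - tau)" "ln th = ln x - ln (tau - x)"
    unfolding y_def w_def th_def using s tau tau1 by (auto intro!: ln_divide_pos)
  have "1 + y = 1 / (1 - x)" "1 + w = 1 / (1 - tau)" "1 + th = tau / (tau - x)"
    using s tau tau1 by (auto simp: y_def w_def th_def field_simps)
  then have ln1: "ln (1 + y) = - ln (1 - x)" "ln (1 + w) = - ln (1 - tau)" "ln (1 + th) = ln tau - ln (tau - x)"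
    using s tau tau1 by (auto simp: ln_div)
  \<comment> \<open>In the product measure with densities x and tau, the excluded membership in S
    without T has probability x (1 - tau) = 1 - g.\<close>
  have fac: "1 + w + y * w = (1 + y) * (1 + w) * g"
  proof -
    have "y * (1 - x) = x" "w * (1 - tau) = tau" using s tau1 by (auto simp: y_def w_def)
    then have "(1 + y) * x = y" "(1 + w) * (1 - tau) = 1" by (auto simp: algebra_simps)
    moreover have "(1 + y) * (1 + w) * g = (1 + y) * (1 + w) - ((1 + y) * x) * ((1 + w) * (1 - tau))"
      by (simp add: g_def algebra_simps)
    ultimately have "(1 + y) * (1 + w) * g = (1 + y) * (1 + w) - y" by simp
    then show ?thesis by (simp add: algebra_simps)
  qed
  have np: "real ?np * (y ^ s * w ^ t) \<le> ((1 + y) * (1 + w) * g) ^ K * ((1 + y) * (1 + w)) ^ (2 * n - K)"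
    using card_covering_pairs_genfun[OF K2, of y w s t] pos by (simp only: fac)
  also have "\<dots> = ((1 + y) * (1 + w)) ^ (2 * n) * g ^ K"
    using K2 by (simp add: power_mult_distrib power_add[symmetric] mult_ac)
  also have "\<dots> = exp (N * (- ln (1 - x) - ln (1 - tau)) + K * ln g)"
    using pos g ln1 by (simp add: power_as_exp exp_add ln_mult N_def)
  finally have "real ?np \<le> exp (N * (- ln (1 - x) - ln (1 - tau)) + K * ln g) / (y ^ s * w ^ t)"
    using pos by (simp add: field_simps)
  also have "\<dots> = exp (N * (- ln (1 - x) - ln (1 - tau)) + K * ln g - s * ln y - t * ln w)"
    using pos by (simp add: power_as_exp exp_diff exp_add)
  also have "\<dots> \<le> exp (N * (- ln (1 - x) - ln (1 - tau) + 13/40 * ln g - x * ln y - tau * ln w) + ln 20000)"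
  proof -
    have "(13/40 * N - 1) * (- ln g) \<le> K * (- ln g)"
      using K g g1 by (intro mult_right_mono) (auto simp: N_def)
    then have a: "K * ln g \<le> N * (13/40 * ln g) - ln g" by (simp add: algebra_simps)
    have b: "- (t * ln w) \<le> - (N * (tau * ln w)) - ln tau - ln (1 - tau)"
    proof -
      have d: "0 \<le> N * tau - t" "N * tau - t \<le> 1" using t by (auto simp: N_def mult_ac)
      have "ln tau \<le> 0" "ln (1 - tau) \<le> 0" using tau1 by auto
      then have "(N * tau - t) * ln w \<le> (N * tau - t) * (- ln (1 - tau))"
        unfolding lns(2) using d by (intro mult_left_mono) auto
      also have "\<dots> \<le> 1 * (- ln (1 - tau))"
        using d \<open>ln (1 - tau) \<le> 0\<close> by (intro mult_right_mono) auto
      finally show ?thesis using \<open>ln tau \<le> 0\<close> by (simp add: algebra_simps)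
    qed
    \<comment> \<open>The total price of rounding \<open>K\<close> and \<open>t\<close> to integers,
      where 20000 = 20 * 20 * 50 comes from the lower bounds 1/20, 1/20 and 1/50 for g, tau and 1 -
      tau.\<close>
    have c: "- ln g - ln tau - ln (1 - tau) \<le> ln 20000"
    proof -
      have "ln (1/20) \<le> ln g" "ln (1/20) \<le> ln tau" "ln (1/50) \<le> ln (1 - tau)" using g tau by auto
      moreover have "ln (20000::real) = - ln (1/20) - ln (1/20) - ln (1/50)"
        using ln_mult_pos[of 20 "20 * 50 :: real"] ln_mult_pos[of 20 "50 :: real"] by (simp add: ln_div)
      ultimately show ?thesis by linarith
    qed
    show ?thesis using a b c sx by (simp add: algebra_simps)
  qed
  finally have np: "real ?np \<le> 20000 * exp (N * (- ln (1 - x) - ln (1 - tau) + 13/40 * ln g - x * ln y - tau * ln w))"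
    by (simp add: exp_add)
  have ch: "real ((5 * t) choose (5 * s)) \<le> exp (N * (5 * tau * ln (1 + th) - 5 * x * ln th))"
  proof -
    have "real ((5 * t) choose (5 * s)) \<le> (1 + th) ^ (5 * t) / th ^ (5 * s)" by (rule binomial_le_genfun[OF pos(3)])
    also have "\<dots> = exp (5 * real t * ln (1 + th) - 5 * real s * ln th)"
      using pos by (simp add: power_as_exp exp_diff)
    also have "\<dots> \<le> exp (N * (5 * tau * ln (1 + th) - 5 * x * ln th))"
    proof -
      have "5 * real t * ln (1 + th) \<le> 5 * (tau * N) * ln (1 + th)"
        using t pos by (intro mult_right_mono) (auto simp: N_def)
      then show ?thesis using sx by (simp add: algebra_simps)
    qed
    finally show ?thesis .
  qed
  have ent: "exp (N * (5 * entropy x)) / (10 * real n + 1) \<le> real (10 * n choose (5 * s))"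
  proof -
    have r: "real (5 * s) / real (10 * n) = x" using x(1) by simp
    have eq: "real (10 * n) * entropy x = N * (5 * entropy x)" by (simp add: N_def)
    have "exp (N * (5 * entropy x)) \<le> (real (10 * n) + 1) * real (10 * n choose (5 * s))"
      using binomial_ge_entropy[of "5 * s" "10 * n"] s unfolding r eq by auto
    then show ?thesis by (simp add: pos_divide_le_eq mult.commute)
  qed
  have "?c * (exp (N * (5 * entropy x)) / (10 * real n + 1)) \<le> ?c * real (10 * n choose (5 * s))"
    by (intro mult_left_mono ent) auto
  also have "\<dots> \<le> real ?np * (fact (10 * n) * real ((5 * t) choose (5 * s)))"
    using of_nat_mono[OF card_covered[of n K s t], where 'a = real] by (simp only: of_nat_mult of_nat_fact)
  also have "\<dots> \<le> (20000 * exp (N * (- ln (1 - x) - ln (1 - tau) + 13/40 * ln g - x * ln y - tau * ln w)))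
      * (fact (10 * n) * exp (N * (5 * tau * ln (1 + th) - 5 * x * ln th)))"
    by (intro mult_mono np mult_left_mono ch) auto
  finally have "?c \<le> (20000 * exp (N * (- ln (1 - x) - ln (1 - tau) + 13/40 * ln g - x * ln y - tau * ln w)))
      * (fact (10 * n) * exp (N * (5 * tau * ln (1 + th) - 5 * x * ln th))) * (10 * real n + 1) / exp (N * (5 * entropy x))"
    by (simp add: field_simps)
  also have "\<dots> = fact (10 * n) * ((10 * real n + 1) * 20000 *
      (exp (N * (- ln (1 - x) - ln (1 - tau) + 13/40 * ln g - x * ln y - tau * ln w)) * exp (N * (5 * tau * ln (1 + th) - 5 * x * ln th)) / exp (N * (5 * entropy x))))"
    by simp
  also have "exp (N * (- ln (1 - x) - ln (1 - tau) + 13/40 * ln g - x * ln y - tau * ln w)) * exp (N * (5 * tau * ln (1 + th) - 5 * x * ln th)) / exp (N * (5 * entropy x))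
      = exp (N * cover_exponent x tau)"
  proof -
    have "N * (- ln (1 - x) - ln (1 - tau) + 13/40 * ln g - x * ln y - tau * ln w) + N * (5 * tau * ln (1 + th) - 5 * x * ln th) - N * (5 * entropy x)
       = N * cover_exponent x tau"
      unfolding lns ln1 cover_exponent_def entropy_def g_def[symmetric] by (simp add: algebra_simps)
    then show ?thesis by (simp only: exp_add[symmetric] exp_diff[symmetric])
  qed
  finally show ?thesis by (simp add: N_def)
qed

lemma card_crowded_small:
  assumes n: "n > 0" and m: "0 < m" "10 * m \<le> n"
  shows "real (card (crowded_perms n m)) \<le> fact (10 * n) * (9 / 50 * real m / n) ^ m"
proof -
  let ?c = "real (card (crowded_perms n m))" and ?k = "Suc m"
  let ?C = "real (10 * n choose (5 * ?k))"
  define r where "r = real m / n"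
  have r: "0 < r" "r \<le> 1/10" using m n by (auto simp: r_def field_simps)
  have "?c * ?C \<le> real (2 * n choose ?k) * real (n choose m) * (fact (10 * n) * real ((10 * m) choose (5 * ?k)))"
    using of_nat_mono[OF card_crowded[of n m], where 'a = real] by (simp only: of_nat_mult of_nat_fact mult.assoc)
  also have "\<dots> \<le> real (2 * n choose ?k) * real (n choose m) * (fact (10 * n) * ((real (10 * m) / real (10 * n)) ^ (5 * ?k) * ?C))"
    using m n by (intro mult_left_mono binomial_ratio_le_power) auto
  also have "real (10 * m) / real (10 * n) = r" by (simp add: r_def)
  finally have "?c * ?C \<le> (fact (10 * n) * (real (2 * n choose ?k) * real (n choose m) * r ^ (5 * ?k))) * ?C"
    by (simp only: mult_ac)
  moreover have "?C > 0" using m by simp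
  ultimately have c: "?c \<le> fact (10 * n) * (real (2 * n choose ?k) * real (n choose m) * r ^ (5 * ?k))"
    by (simp only: mult_le_cancel_right_pos)
  have "real (2 * n choose ?k) \<le> (3 * real (2 * n) / ?k) ^ ?k" using m by (intro binomial_le_power) auto
  also have "\<dots> \<le> (6 / r) ^ ?k" using m n by (intro power_mono) (auto simp: r_def field_simps)
  finally have 1: "real (2 * n choose ?k) \<le> (6 / r) ^ ?k" .
  have "real (n choose m) \<le> (3 * real n / m) ^ m" using m by (intro binomial_le_power) auto
  also have "3 * real n / m = 3 / r" using m by (simp add: r_def)
  also have "(3 / r) ^ m \<le> (3 / r) ^ ?k" using r by (intro power_increasing) auto
  finally have 2: "real (n choose m) \<le> (3 / r) ^ ?k" .
  have "real (2 * n choose ?k) * real (n choose m) * r ^ (5 * ?k) \<le> (6 / r) ^ ?k * (3 / r) ^ ?k * r ^ (5 * ?k)"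
    using r by (intro mult_right_mono mult_mono 1 2) auto
  also have "\<dots> = (6 / r * (3 / r) * r ^ 5) ^ ?k" by (simp only: power_mult_distrib power_mult)
  also have "6 / r * (3 / r) * r ^ 5 = 18 * r ^ 3" using r by (simp add: power_numeral_reduce power3_eq_cube)
  also have "(18 * r ^ 3) ^ ?k \<le> (9 / 50 * r) ^ ?k"
  proof (rule power_mono)
    have "r * r \<le> 1/10 * (1/10)" using r by (intro mult_mono) auto
    then have "r * r * r \<le> 1/100 * r" using r by (intro mult_right_mono) auto
    then show "18 * r ^ 3 \<le> 9 / 50 * r" by (simp add: power3_eq_cube)
  qed (use r in auto)
  also have "\<dots> \<le> (9 / 50 * r) ^ m" using r by (intro power_decreasing) auto
  finally have "fact (10 * n) * (real (2 * n choose ?k) * real (n choose m) * r ^ (5 * ?k)) \<le> fact (10 * n) * (9 / 50 * r) ^ m"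
    by (intro mult_left_mono) auto
  then have "?c \<le> fact (10 * n) * (9 / 50 * r) ^ m" using c by linarith
  also have "9 / 50 * r = 9 / 50 * real m / n" by (simp add: r_def)
  finally show ?thesis .
qed

lemma card_crowded_middle:
  assumes n: "n > 0" and m: "1/20 \<le> real m / (2 * n)" "real m / (2 * n) \<le> 305/1000" and big: "n \<ge> 10"
  shows "real (card (crowded_perms n m)) \<le> fact (10 * n) * ((10 * real n + 1) * (2 * real n) * exp (2 * real n * crowd_exponent (real m / (2 * n))))"
proof -
  let ?c = "real (card (crowded_perms n m))" and ?k = "Suc m"
  define x where "x = real m / (2 * n)"
  have x: "1/20 \<le> x" "x \<le> 305/1000" using m by (auto simp: x_def)
  have mx: "real m = 2 * real n * x" using n by (simp add: x_def)
  have "real m \<le> 2 * real n * (305/1000)" "2 * real n * (1/20) \<le> real m"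
    unfolding mx using mult_left_mono[OF x(2), of "2 * real n"] mult_left_mono[OF x(1), of "2 * real n"] by auto
  then have "real m + 1 \<le> real n" "0 < real m" using big n by auto
  then have mn: "0 < m" "m < n" "5 * ?k \<le> 5 * n" by auto
  have 1: "real (2 * n choose ?k) \<le> 2 * real n * exp (2 * real n * entropy x)"
  proof -
    have "?k * (2 * n choose ?k) = (2 * n - m) * (2 * n choose m)"
      by (metis binomial_absorption binomial_absorb_comp)
    moreover have "1 * (2 * n choose ?k) \<le> ?k * (2 * n choose ?k)" by (rule mult_right_mono) auto
    moreover have "(2 * n - m) * (2 * n choose m) \<le> (2 * n) * (2 * n choose m)" by (rule mult_right_mono) auto
    ultimately have "2 * n choose ?k \<le> (2 * n) * (2 * n choose m)" by linarith
    from of_nat_mono[OF this, where 'a = real]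
    have "real (2 * n choose ?k) \<le> 2 * real n * real (2 * n choose m)"
      by (simp only: of_nat_mult of_nat_numeral)
    also have "\<dots> \<le> 2 * real n * exp (2 * real n * entropy x)"
      using binomial_le_entropy[of m "2 * n"] mn by (intro mult_left_mono) (auto simp: x_def)
    finally show ?thesis .
  qed
  have 2: "real (n choose m) \<le> exp (2 * real n * (entropy (2 * x) / 2))"
    using binomial_le_entropy[of m n] mn by (simp add: x_def)
  have 3: "real ((10 * m) choose (5 * ?k)) \<le> exp (2 * real n * (10 * x * ln 2))"
  proof -
    have "(10 * m) choose (5 * ?k) \<le> 2 ^ (10 * m)" by (rule binomial_le_pow2)
    from of_nat_mono[OF this, where 'a = real]
    have "real ((10 * m) choose (5 * ?k)) \<le> 2 ^ (10 * m)" by (simp only: of_nat_power of_nat_numeral)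
    also have "\<dots> = exp (2 * real n * (10 * x * ln 2))" using mx by (simp add: power_as_exp mult_ac)
    finally show ?thesis .
  qed
  \<comment> \<open>Both 5 m and 5 (m + 1) are at most the middle 5 n of the row, so passing from
    one to the other only increases the coefficient.\<close>
  have 4: "exp (2 * real n * (5 * entropy x)) / (10 * real n + 1) \<le> real (10 * n choose (5 * ?k))"
  proof -
    have "exp (2 * real n * (5 * entropy x)) \<le> (10 * real n + 1) * real (10 * n choose (5 * m))"
      using binomial_ge_entropy[of "5 * m" "10 * n"] mn by (simp add: x_def field_simps)
    also have "\<dots> \<le> (10 * real n + 1) * real (10 * n choose (5 * ?k))"
      using mn by (intro mult_left_mono of_nat_mono binomial_mono) auto
    finally show ?thesis by (simp add: field_simps)
  qed
  have "?c * (exp (2 * real n * (5 * entropy x)) / (10 * real n + 1)) \<le> ?c * real (10 * n choose (5 * ?k))"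
    by (intro mult_left_mono 4) auto
  also have "\<dots> \<le> real (2 * n choose ?k) * real (n choose m) * (fact (10 * n) * real ((10 * m) choose (5 * ?k)))"
    using of_nat_mono[OF card_crowded[of n m], where 'a = real] by (simp only: of_nat_mult of_nat_fact mult.assoc)
  also have "\<dots> \<le> (2 * real n * exp (2 * real n * entropy x)) * exp (2 * real n * (entropy (2 * x) / 2)) * (fact (10 * n) * exp (2 * real n * (10 * x * ln 2)))"
    by (intro mult_mono 1 2 mult_left_mono 3) auto
  finally have "?c \<le> (2 * real n * exp (2 * real n * entropy x)) * exp (2 * real n * (entropy (2 * x) / 2)) * (fact (10 * n) * exp (2 * real n * (10 * x * ln 2)))
       * (10 * real n + 1) / exp (2 * real n * (5 * entropy x))"
    by (simp add: field_simps)
  also have "\<dots> = fact (10 * n) * ((10 * real n + 1) * (2 * real n) *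
      (exp (2 * real n * entropy x) * exp (2 * real n * (entropy (2 * x) / 2)) * exp (2 * real n * (10 * x * ln 2)) / exp (2 * real n * (5 * entropy x))))"
    by simp
  also have "exp (2 * real n * entropy x) * exp (2 * real n * (entropy (2 * x) / 2)) * exp (2 * real n * (10 * x * ln 2)) / exp (2 * real n * (5 * entropy x))
      = exp (2 * real n * crowd_exponent x)"
    unfolding exp_add[symmetric] exp_diff[symmetric] crowd_exponent_def by (simp add: algebra_simps)
  finally show ?thesis by (simp add: x_def)
qed

section \<open>Tight pair sets with explicit weights\<close>

lemma tight_density_cases:
  assumes "tight n K cP cQ u UNIV P p"
  shows "tight n K cP cQ u {..1/20} P p \<or> tight n K cP cQ u {1/20..} P p"
  using assms unfolding tight_def Let_def by auto

text \<open>One constant for all three weight choices, whose \<open>Y\<close>, \<open>F\<close> and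
  \<open>q\<close> satisfy Y \<le> 4, F \<le> 100 and q \<ge> 48/100, with
  \<open>eps = 1 / 10 ^ 9\<close>.\<close>

definition tight_const :: real where
  "tight_const = 4 * 100 / ((48/100) ^ 100 * exp (- 100) * (1 / 10 ^ 9) ^ 11)"

lemma tight_const_ge:
  assumes "Y \<le> 4" "F \<le> 100" "48/100 \<le> q" "0 \<le> Y" "0 \<le> F"
  shows "Y * F / (q ^ 100 * exp (- 100) * (1 / 10 ^ 9) ^ 11) \<le> tight_const"
  unfolding tight_const_def using assms by (intro frac_le mult_mono mult_right_mono power_mono) auto

text \<open>The weights below come from a numerical minimisation of the exponent. The optimal
  \<open>th\<close> depends on the critical density, hence the split at density 1/20.\<close>

locale tight_bound =
  fixes n K m c :: nat
  assumes n: "n > 0" and K: "real K \<le> 13/40 * (2 * real n)" "13/40 * (2 * real n) < real K + 1"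
    and m: "10 \<le> m" "m < n" and c: "1 \<le> c" "c \<le> 10" "c < m"
    and x: "305 / 1000 \<le> real m / (2 * real n)" "real m / (2 * real n) \<le> 3322 / 10000"
begin

lemma tight_count_le:
  assumes "real T \<le> fact (10 * n) * ((10 * real n + 1) ^ 3 * C * exp (2 * real n * h))" "h \<le> - (1 / 2000)" "C \<le> tight_const" "0 \<le> C"
  shows "real T \<le> fact (10 * n) * ((10 * real n + 1) ^ 3 * tight_const * exp (- (real n / 1000)))"
proof -
  have "2 * real n * h \<le> 2 * real n * (- (1 / 2000))" using assms(2) by (intro mult_left_mono) auto
  then have "exp (2 * real n * h) \<le> exp (- (real n / 1000))" by simp
  then have "(10 * real n + 1) ^ 3 * C * exp (2 * real n * h) \<le> (10 * real n + 1) ^ 3 * tight_const * exp (- (real n / 1000))"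
    using assms(3,4) by (intro mult_mono mult_nonneg_nonneg) auto
  then have "fact (10 * n) * ((10 * real n + 1) ^ 3 * C * exp (2 * real n * h)) \<le> fact (10 * n) * ((10 * real n + 1) ^ 3 * tight_const * exp (- (real n / 1000)))"
    by (rule mult_left_mono) simp
  then show ?thesis using assms(1) by linarith
qed

lemma card_tight_three:
  "real (card (tight_perms n K (\<lambda>_. 3) (\<lambda>_. 11) m (m + c) UNIV))
    \<le> fact (10 * n) * ((10 * real n + 1) ^ 3 * tight_const * exp (- (real n / 1000)))"
proof (rule tight_count_le)
  let ?q = "482/1000 :: real" and ?z = "1052/1000 :: real" and ?y = "1563/100 :: real" and ?om = "10583/10000 :: real" and ?v = "1609/1000 :: real"
  show "real (card (tight_perms n K (\<lambda>_. 3) (\<lambda>_. 11) m (m + c) UNIV))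
    \<le> fact (10 * n) * ((10 * real n + 1) ^ 3 * (5 / 2 * (1381 / 25) / (?q ^ 100 * exp (- 100) * (1 / 10 ^ 9) ^ 11)) * exp (2 * real n * exponent 121 (5 / 2) (1381 / 25) (1037 / 25) (real m / (2 * real n))))"
    \<comment> \<open>The threshold 11 imposes nothing outside \<open>P\<close>. Hence critical
      edges get the neutral weight \<open>th = 1\<close>, and the factor of an outside pair is the
      total mass 1 of a binomial distribution.\<close>
    by (rule card_ex_tight_exp[where kap = "\<lambda>_. 1" and th = 1 and om = ?om and z = ?z and y = ?y and v = ?v and q = ?q, OF n K m c])
      (simp_all add: upper_tail_2 upper_tail_3 left_weight_sum lower_tail_11 power_divide)
  show "exponent 121 (5 / 2) (1381 / 25) (1037 / 25) (real m / (2 * real n)) \<le> - (1 / 2000)"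
    by (rule exponent_three_le[OF x])
  show "5 / 2 * (1381 / 25) / (?q ^ 100 * exp (- 100) * (1 / 10 ^ 9) ^ 11) \<le> tight_const"
    by (rule tight_const_ge) auto
qed simp

lemma card_tight_sparse:
  "real (card (tight_perms n K (\<lambda>i. if i < r then 3 else 2) (\<lambda>i. if i < r then 3 else 2) m (m + c) {..1/20}))
    \<le> fact (10 * n) * ((10 * real n + 1) ^ 3 * tight_const * exp (- (real n / 1000)))"
proof (rule tight_count_le)
  let ?q = "49/100 :: real" and ?z = "112/100 :: real" and ?y = "127/10 :: real" and ?om = "1053/1000 :: real" and ?v = "182/100 :: real" and ?th = "73/100 :: real"
  have omega: "upper_tail ?q ((if i < r then 3 else 2) - 1) \<le> ?om * upper_tail ?q (if i < r then 3 else 2)" if "i < n" for i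
    by (cases "i < r") (simp_all add: upper_tail_1[unfolded One_nat_def] upper_tail_2 upper_tail_3 power_divide)
  have kappa: "lower_tail (1 / 10 ^ 9) (rho / ?th) (1 - rho) (if i < r then 3 else 2) \<le> (if i < r then 1172/1000 else 1051/1000)"
    if "i < n" "0 \<le> rho" "rho \<le> 1" "rho \<in> {..1/20}" for i rho
    using lower_tail_sparse_3[of rho] lower_tail_sparse_2[of rho] that by (cases "i < r") simp_all
  show "real (card (tight_perms n K (\<lambda>i. if i < r then 3 else 2) (\<lambda>i. if i < r then 3 else 2) m (m + c) {..1/20}))
    \<le> fact (10 * n) * ((10 * real n + 1) ^ 3 * (72 / 25 * (1533 / 25) / (?q ^ 100 * exp (- 100) * (1 / 10 ^ 9) ^ 11)) * exp (2 * real n * exponent (787 / 5) (72 / 25) (1533 / 25) (1791 / 25) (real m / (2 * real n))))"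
    by (rule card_ex_tight_exp[where kap = "\<lambda>i. if i < r then 1172/1000 else 1051/1000" and th = ?th and om = ?om and z = ?z and y = ?y and v = ?v and q = ?q, OF n K m c _ _ _ _ _ _ _ _ _ omega kappa])
      (simp_all add: upper_tail_2 upper_tail_3 left_weight_sum power_divide)
  show "exponent (787 / 5) (72 / 25) (1533 / 25) (1791 / 25) (real m / (2 * real n)) \<le> - (1 / 2000)"
    by (rule exponent_sparse_le[OF x])
  show "72 / 25 * (1533 / 25) / (?q ^ 100 * exp (- 100) * (1 / 10 ^ 9) ^ 11) \<le> tight_const"
    by (rule tight_const_ge) auto
qed simp

lemma card_tight_dense:
  "real (card (tight_perms n K (\<lambda>i. if i < r then 3 else 2) (\<lambda>i. if i < r then 3 else 2) m (m + c) {1/20..}))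
    \<le> fact (10 * n) * ((10 * real n + 1) ^ 3 * tight_const * exp (- (real n / 1000)))"
proof (rule tight_count_le)
  let ?q = "49/100 :: real" and ?z = "1079/1000 :: real" and ?y = "1435/100 :: real" and ?om = "1053/1000 :: real" and ?v = "161/100 :: real" and ?th = "884/1000 :: real"
  have omega: "upper_tail ?q ((if i < r then 3 else 2) - 1) \<le> ?om * upper_tail ?q (if i < r then 3 else 2)" if "i < n" for i
    by (cases "i < r") (simp_all add: upper_tail_1[unfolded One_nat_def] upper_tail_2 upper_tail_3 power_divide)
  have kappa: "lower_tail (1 / 10 ^ 9) (rho / ?th) (1 - rho) (if i < r then 3 else 2) \<le> (if i < r then 1056/1000 else 957/1000)"
    if "i < n" "0 \<le> rho" "rho \<le> 1" "rho \<in> {1/20..}" for i rho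
    using lower_tail_dense_3[of rho] lower_tail_dense_2[of rho] that by (cases "i < r") simp_all
  show "real (card (tight_perms n K (\<lambda>i. if i < r then 3 else 2) (\<lambda>i. if i < r then 3 else 2) m (m + c) {1/20..}))
    \<le> fact (10 * n) * ((10 * real n + 1) ^ 3 * (2567 / 1000 * (2879 / 50) / (?q ^ 100 * exp (- 100) * (1 / 10 ^ 9) ^ 11)) * exp (2 * real n * exponent (261 / 2) (2567 / 1000) (2879 / 50) (1233 / 25) (real m / (2 * real n))))"
    by (rule card_ex_tight_exp[where kap = "\<lambda>i. if i < r then 1056/1000 else 957/1000" and th = ?th and om = ?om and z = ?z and y = ?y and v = ?v and q = ?q, OF n K m c _ _ _ _ _ _ _ _ _ omega kappa])
      (simp_all add: upper_tail_2 upper_tail_3 left_weight_sum power_divide)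
  show "exponent (261 / 2) (2567 / 1000) (2879 / 50) (1233 / 25) (real m / (2 * real n)) \<le> - (1 / 2000)"
    by (rule exponent_dense_le[OF x])
  show "2567 / 1000 * (2879 / 50) / (?q ^ 100 * exp (- 100) * (1 / 10 ^ 9) ^ 11) \<le> tight_const"
    by (rule tight_const_ge) auto
qed simp

end

text \<open>The largest image size that violates (a) for a set of \<open>s\<close> left vertices.\<close>

definition cover_size :: "nat \<Rightarrow> nat \<Rightarrow> nat" where
  "cover_size n s = nat (\<lceil>e (real s / (2 * real n)) * (2 * real n)\<rceil> - 1)"

definition violating :: "nat \<Rightarrow> nat \<Rightarrow> nat \<Rightarrow> nat \<Rightarrow> (nat \<Rightarrow> nat) set" where
  "violating n K m c = {p. p permutes {..<10 * n} \<and> (\<exists>P\<subseteq>{..<n}. card P = m \<and>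
     (tight n K (\<lambda>_. 3) (\<lambda>_. 11) (m + c) UNIV P p \<or>
      (\<exists>r<n. tight n K (\<lambda>i. if i < r then 3 else 2) (\<lambda>i. if i < r then 3 else 2) (m + c) UNIV P p)))}"

text \<open>The factor 1 + 2 n counts the case without an index threshold and, for each of the n
  thresholds, the two density ranges.\<close>

lemma (in tight_bound) card_violating:
  "real (card (violating n K m c)) \<le> fact (10 * n) * ((1 + 2 * real n) * (10 * real n + 1) ^ 3 * tight_const * exp (- (real n / 1000)))"
proof -
  let ?T = "\<lambda>cP cQ B. tight_perms n K cP cQ m (m + c) B"
  let ?c = "\<lambda>r i. if i < r then 3 else 2 :: nat"
  let ?b = "fact (10 * n) * ((10 * real n + 1) ^ 3 * tight_const * exp (- (real n / 1000)))"
  have fin: "finite (?T cP cQ B)" for cP cQ B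
    by (rule finite_subset[OF _ finite_permutations[of "{..<10 * n}"]]) auto
  have "violating n K m c \<subseteq> ?T (\<lambda>_. 3) (\<lambda>_. 11) UNIV \<union> (\<Union>r\<in>{..<n}. ?T (?c r) (?c r) {..1/20} \<union> ?T (?c r) (?c r) {1/20..})"
  proof
    fix p assume "p \<in> violating n K m c"
    then obtain P where P: "p permutes {..<10 * n}" "P \<subseteq> {..<n}" "card P = m"
      and t: "tight n K (\<lambda>_. 3) (\<lambda>_. 11) (m + c) UNIV P p \<or> (\<exists>r<n. tight n K (?c r) (?c r) (m + c) UNIV P p)"
      unfolding violating_def by blast
    from t show "p \<in> ?T (\<lambda>_. 3) (\<lambda>_. 11) UNIV \<union> (\<Union>r\<in>{..<n}. ?T (?c r) (?c r) {..1/20} \<union> ?T (?c r) (?c r) {1/20..})"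
    proof
      assume "tight n K (\<lambda>_. 3) (\<lambda>_. 11) (m + c) UNIV P p"
      then have "p \<in> ?T (\<lambda>_. 3) (\<lambda>_. 11) UNIV" using P by blast
      then show ?thesis by (rule UnI1)
    next
      assume "\<exists>r<n. tight n K (?c r) (?c r) (m + c) UNIV P p"
      then obtain r where r: "r \<in> {..<n}" "tight n K (?c r) (?c r) (m + c) UNIV P p" by auto
      from tight_density_cases[OF r(2)] have q: "p \<in> ?T (?c r) (?c r) {..1/20} \<union> ?T (?c r) (?c r) {1/20..}"
        using P by auto
      show ?thesis by (rule UnI2, rule UN_I[OF r(1)], rule q)
    qed
  qed
  then have "card (violating n K m c) \<le> card (?T (\<lambda>_. 3) (\<lambda>_. 11) UNIV \<union> (\<Union>r\<in>{..<n}. ?T (?c r) (?c r) {..1/20} \<union> ?T (?c r) (?c r) {1/20..}))"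
    by (rule card_mono[rotated]) (use fin in auto)
  also have "\<dots> \<le> card (?T (\<lambda>_. 3) (\<lambda>_. 11) UNIV) + card (\<Union>r\<in>{..<n}. ?T (?c r) (?c r) {..1/20} \<union> ?T (?c r) (?c r) {1/20..})"
    by (rule card_Un_le)
  also have "card (\<Union>r\<in>{..<n}. ?T (?c r) (?c r) {..1/20} \<union> ?T (?c r) (?c r) {1/20..})
     \<le> (\<Sum>r<n. card (?T (?c r) (?c r) {..1/20}) + card (?T (?c r) (?c r) {1/20..}))"
    by (rule order_trans[OF card_UN_le[OF finite_lessThan] sum_mono[OF card_Un_le]])
  finally have "card (violating n K m c) \<le> card (?T (\<lambda>_. 3) (\<lambda>_. 11) UNIV) + (\<Sum>r<n. card (?T (?c r) (?c r) {..1/20}) + card (?T (?c r) (?c r) {1/20..}))"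
    by simp
  from of_nat_mono[OF this, where 'a = real]
  have "real (card (violating n K m c)) \<le> real (card (?T (\<lambda>_. 3) (\<lambda>_. 11) UNIV)) + (\<Sum>r<n. real (card (?T (?c r) (?c r) {..1/20})) + real (card (?T (?c r) (?c r) {1/20..})))"
    by (simp only: of_nat_add of_nat_sum)
  also have "\<dots> \<le> ?b + (\<Sum>r<n. ?b + ?b)"
    by (intro add_mono sum_mono card_tight_three card_tight_sparse card_tight_dense)
  also have "\<dots> = (1 + 2 * real n) * ?b" by (simp add: algebra_simps)
  finally show ?thesis by (simp only: mult_ac)
qed

section \<open>Summation over all set sizes\<close>

lemma cover_size_small:
  assumes "n > 0" "0 < s" "10 * s \<le> n"
  shows "cover_size n s \<le> 2 * s"
proof -
  have "real s / (2 * real n) \<le> 2301/10000" using assms by (simp add: field_simps)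
  then have "e (real s / (2 * real n)) * (2 * real n) = 4377/2301 * real s" using assms by (simp add: e_first)
  then have "e (real s / (2 * real n)) * (2 * real n) \<le> real_of_int (2 * int s)" by simp
  then have "\<lceil>e (real s / (2 * real n)) * (2 * real n)\<rceil> \<le> 2 * int s" by (simp only: ceiling_le_iff)
  then show ?thesis unfolding cover_size_def by linarith
qed

lemma cover_size_large:
  assumes "n > 0" "0 < s" "10 * s \<le> n"
  shows "\<exists>t\<le>s. 59 * s \<le> 100 * t \<and> cover_size n (2 * n - s) = 2 * n - t"
proof -
  let ?x = "real (2 * n - s) / (2 * real n)"
  have x: "?x = 1 - real s / (2 * real n)" using assms by (simp add: of_nat_diff field_simps)
  have "real s / (2 * real n) \<le> 1/20" using assms by (simp add: field_simps)
  then have "4377/10000 < ?x" unfolding x by linarith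
  from e_fourth[OF this] have "e ?x = 1 - 3322/5623 * (real s / (2 * real n))" unfolding x by (simp add: right_diff_distrib)
  then have "e ?x * (2 * real n) = (1 - 3322/5623 * (real s / (2 * real n))) * (2 * real n)" by (simp only:)
  also have "\<dots> = real_of_int (2 * int n) - 3322/5623 * real s" using assms by (simp add: field_simps)
  finally have e: "e ?x * (2 * real n) = real_of_int (2 * int n) - 3322/5623 * real s" .
  \<comment> \<open>The added one is the one subtracted in \<open>cover_size\<close>: the image must
    miss strictly more than 3322/5623 s vertices.\<close>
  define t where "t = nat (\<lfloor>3322/5623 * real s\<rfloor> + 1)"
  have "\<lceil>e ?x * (2 * real n)\<rceil> = 2 * int n - \<lfloor>3322/5623 * real s\<rfloor>"
    unfolding e by linarith
  moreover have f: "0 \<le> \<lfloor>3322/5623 * real s\<rfloor>" by simp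
  ultimately have 1: "cover_size n (2 * n - s) = 2 * n - t" unfolding cover_size_def t_def by linarith
  have "\<lfloor>3322/5623 * real s\<rfloor> < int s" using assms by (simp add: floor_less_iff)
  then have 2: "t \<le> s" unfolding t_def by linarith
  have "3322/5623 * real s < real t" unfolding t_def using f by linarith
  then have "59 * real s \<le> 100 * real t" using assms by simp
  then have "59 * s \<le> 100 * t" by linarith
  then show ?thesis using 1 2 by blast
qed

lemma cover_size_all: "n > 0 \<Longrightarrow> cover_size n (2 * n) < 2 * n"
  by (simp add: cover_size_def e_fourth) linarith

text \<open>At both ends s / (2 n) \<le> 1/20, so the bases 54/5 and 18 of the single bounds give
  ratios 54/100 and 9/10 and sums of order 1 / n. The middle sizes are at most 2 n exponentially
  small terms. For s = 2 n nothing is covered, since \<open>e 1 = 1\<close> demands that the image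
  be everything but at most t < s vertices are allowed.\<close>

lemma sum_card_covered_le:
  assumes n: "n > 0" and K: "real K \<le> 13/40 * (2 * real n)" "13/40 * (2 * real n) < real K + 1"
  shows "(\<Sum>s\<in>{1..2 * n}. real (card (covered_perms n K s (cover_size n s))))
     \<le> fact (10 * n) * (1000 / n + 2 * real n * ((10 * real n + 1) * 20000 * exp (- (real n / 500))))"
proof -
  let ?f = "\<lambda>s. real (card (covered_perms n K s (cover_size n s)))"
  let ?S1 = "{s. 0 < s \<and> 10 * s \<le> n}" and ?S2 = "{s. n < 10 * s \<and> n < 10 * (2 * n - s)}"
  let ?m = "(10 * real n + 1) * 20000 * exp (- (real n / 500))"
  have fin: "finite ?S1" "finite ?S2"
    by (rule finite_subset[of _ "{..n}"], auto) (rule finite_subset[of _ "{..2 * n}"], auto)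
  have sub2: "?S2 \<subseteq> {1..2 * n}" by auto
  have split: "{1..2 * n} = ?S1 \<union> (?S2 \<union> ((\<lambda>s. 2 * n - s) ` ?S1 \<union> {2 * n}))"
  proof (intro equalityI subsetI)
    fix s assume s: "s \<in> {1..2 * n}"
    show "s \<in> ?S1 \<union> (?S2 \<union> ((\<lambda>s. 2 * n - s) ` ?S1 \<union> {2 * n}))"
    proof (cases "s = 2 * n \<or> 10 * s \<le> n \<or> n < 10 * (2 * n - s)")
      case False
      then have "2 * n - s \<in> ?S1" "s = 2 * n - (2 * n - s)" using s by auto
      then show ?thesis by blast
    qed (use s in auto)
  qed (use n in auto)
  have "(\<Sum>s\<in>{1..2 * n}. ?f s) \<le> (\<Sum>s\<in>?S1. ?f s) + ((\<Sum>s\<in>?S2. ?f s) + ((\<Sum>s\<in>(\<lambda>s. 2 * n - s) ` ?S1. ?f s) + ?f (2 * n)))"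
  proof -
    have un: "sum ?f (A \<union> B) \<le> sum ?f A + sum ?f B" if "finite A" "finite B" for A B
      using sum.union_inter[OF that, of ?f] sum_nonneg[of "A \<inter> B" ?f] by simp
    have "sum ?f {1..2 * n} \<le> sum ?f ?S1 + sum ?f (?S2 \<union> ((\<lambda>s. 2 * n - s) ` ?S1 \<union> {2 * n}))"
      unfolding split by (rule un) (use fin in auto)
    also have "sum ?f (?S2 \<union> ((\<lambda>s. 2 * n - s) ` ?S1 \<union> {2 * n})) \<le> sum ?f ?S2 + sum ?f ((\<lambda>s. 2 * n - s) ` ?S1 \<union> {2 * n})"
      by (rule un) (use fin in auto)
    also have "sum ?f ((\<lambda>s. 2 * n - s) ` ?S1 \<union> {2 * n}) \<le> sum ?f ((\<lambda>s. 2 * n - s) ` ?S1) + sum ?f {2 * n}"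
      by (rule un) (use fin in auto)
    finally show ?thesis by simp
  qed
  moreover have "(\<Sum>s\<in>?S1. ?f s) \<le> fact (10 * n) * (100 / n)"
  proof -
    have "(\<Sum>s\<in>?S1. ?f s) \<le> (\<Sum>s\<in>?S1. fact (10 * n) * (54 / 5 * real s / (2 * n)) ^ s)"
      using n cover_size_small by (intro sum_mono card_covered_small) auto
    also have "\<dots> = fact (10 * n) * (\<Sum>s\<in>?S1. (54 / 5 * real s / (2 * n)) ^ s)" by (simp only: sum_distrib_left)
    also have "(\<Sum>s\<in>?S1. (54 / 5 * real s / (2 * n)) ^ s) \<le> (54 / 5 / (1 - 54/100)\<^sup>2) / (2 * n)"
      using n fin by (intro sum_power_small) (auto simp: field_simps)
    also have "\<dots> \<le> 100 / n" using n by (simp add: field_simps)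
    finally show ?thesis by simp
  qed
  moreover have "(\<Sum>s\<in>(\<lambda>s. 2 * n - s) ` ?S1. ?f s) \<le> fact (10 * n) * (900 / n)"
  proof -
    have inj: "inj_on (\<lambda>s. 2 * n - s) ?S1" by (auto simp: inj_on_def)
    have "(\<Sum>s\<in>(\<lambda>s. 2 * n - s) ` ?S1. ?f s) = (\<Sum>s\<in>?S1. ?f (2 * n - s))" by (simp only: sum.reindex[OF inj] o_def)
    also have "\<dots> \<le> (\<Sum>s\<in>?S1. fact (10 * n) * (18 * real s / (2 * n)) ^ s)"
    proof (intro sum_mono)
      fix s assume s: "s \<in> ?S1"
      then obtain t where "t \<le> s" "59 * s \<le> 100 * t" "cover_size n (2 * n - s) = 2 * n - t"
        using cover_size_large[OF n, of s] by auto
      then show "?f (2 * n - s) \<le> fact (10 * n) * (18 * real s / (2 * n)) ^ s"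
        using card_covered_large[OF n, of s t K] s by simp
    qed
    also have "\<dots> = fact (10 * n) * (\<Sum>s\<in>?S1. (18 * real s / (2 * n)) ^ s)" by (simp only: sum_distrib_left)
    also have "(\<Sum>s\<in>?S1. (18 * real s / (2 * n)) ^ s) \<le> (18 / (1 - 9/10)\<^sup>2) / (2 * n)"
      using n fin by (intro sum_power_small) (auto simp: field_simps)
    also have "\<dots> \<le> 900 / n" using n by (simp add: field_simps power2_eq_square)
    finally show ?thesis by simp
  qed
  moreover have "?f (2 * n) = 0" using card_covered_all[OF cover_size_all[OF n]] by simp
  moreover have "(\<Sum>s\<in>?S2. ?f s) \<le> fact (10 * n) * (2 * real n * ?m)"
  proof -
    have each: "?f s \<le> fact (10 * n) * ?m" if s: "s \<in> ?S2" for s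
    proof -
      let ?x = "real s / (2 * real n)"
      have "n \<le> 10 * s" "10 * s + n \<le> 20 * n" "s \<le> 2 * n" using s by auto
      then have "real n \<le> 10 * real s" "10 * real s + real n \<le> 20 * real n" by linarith+
      then have x: "1/20 \<le> ?x" "?x \<le> 19/20" using n by (auto simp: field_simps)
      note ce = cover_exponent_e[OF x]
      have "0 < e ?x * (2 * real n)" using ce n by simp
      then have t: "real (cover_size n s) \<le> e ?x * (2 * n)" "e ?x * (2 * n) \<le> real (cover_size n s) + 1"
        unfolding cover_size_def by simp_all
      have "?f s \<le> fact (10 * n) * ((10 * real n + 1) * 20000 * exp (2 * real n * cover_exponent ?x (e ?x)))"
        by (rule card_covered_middle[where x = ?x]) (use n K x ce t in auto)
      also have "\<dots> \<le> fact (10 * n) * ?m"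
      proof -
        have "2 * real n * cover_exponent ?x (e ?x) \<le> 2 * real n * (- (1/1000))" using ce by (intro mult_left_mono) auto
        then have "exp (2 * real n * cover_exponent ?x (e ?x)) \<le> exp (- (real n / 500))" by simp
        then show ?thesis by (intro mult_left_mono) auto
      qed
      finally show ?thesis .
    qed
    have "(\<Sum>s\<in>?S2. ?f s) \<le> real (card ?S2) * (fact (10 * n) * ?m)" by (rule sum_bounded_above[OF each])
    also have "\<dots> \<le> 2 * real n * (fact (10 * n) * ?m)"
    proof (rule mult_right_mono)
      have "card ?S2 \<le> 2 * n" using card_mono[OF _ sub2] by simp
      then show "real (card ?S2) \<le> 2 * real n" by linarith
    qed auto
    finally show ?thesis by (simp only: mult_ac)
  qed
  ultimately have "(\<Sum>s\<in>{1..2 * n}. ?f s) \<le> fact (10 * n) * (100 / n) + (fact (10 * n) * (2 * real n * ?m) + (fact (10 * n) * (900 / n) + 0))"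
    by linarith
  also have "\<dots> = fact (10 * n) * (1000 / n + 2 * real n * ?m)" by (simp add: algebra_simps)
  finally show ?thesis .
qed

lemma sum_card_crowded_le:
  assumes n: "n \<ge> 10"
  shows "(\<Sum>m | 0 < m \<and> real m / (2 * real n) \<le> 305/1000. real (card (crowded_perms n m)))
     \<le> fact (10 * n) * (1 / n + real n * ((10 * real n + 1) * (2 * real n) * exp (- (real n / 500))))"
proof -
  let ?f = "\<lambda>m. real (card (crowded_perms n m))"
  let ?S1 = "{m. 0 < m \<and> 10 * m \<le> n}" and ?S2 = "{m. n < 10 * m \<and> real m / (2 * real n) \<le> 305/1000}"
  let ?m = "(10 * real n + 1) * (2 * real n) * exp (- (real n / 500))"
  have le: "m \<le> n" if "real m / (2 * real n) \<le> 305/1000" for m using that n by (simp add: field_simps)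
  have fin: "finite ?S1" "finite ?S2" using le by (auto intro: finite_subset[of _ "{..n}"])
  have "{m. 0 < m \<and> real m / (2 * real n) \<le> 305/1000} \<subseteq> ?S1 \<union> ?S2" by auto
  then have "(\<Sum>m | 0 < m \<and> real m / (2 * real n) \<le> 305/1000. ?f m) \<le> sum ?f (?S1 \<union> ?S2)"
    using fin by (intro sum_mono2) auto
  also have "\<dots> = sum ?f ?S1 + sum ?f ?S2" using fin by (intro sum.union_disjoint) auto
  also have "sum ?f ?S1 \<le> fact (10 * n) * (1 / n)"
  proof -
    have "sum ?f ?S1 \<le> (\<Sum>m\<in>?S1. fact (10 * n) * (9 / 50 * real m / n) ^ m)"
      using n by (intro sum_mono card_crowded_small) auto
    also have "\<dots> = fact (10 * n) * (\<Sum>m\<in>?S1. (9 / 50 * real m / n) ^ m)" by (simp only: sum_distrib_left)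
    also have "(\<Sum>m\<in>?S1. (9 / 50 * real m / n) ^ m) \<le> (9 / 50 / (1 - 18/1000)\<^sup>2) / n"
      using n fin by (intro sum_power_small) (auto simp: field_simps)
    also have "\<dots> \<le> 1 / n" using n by (simp add: field_simps power2_eq_square)
    finally show ?thesis by simp
  qed
  also have "sum ?f ?S2 \<le> fact (10 * n) * (real n * ?m)"
  proof -
    have each: "?f m \<le> fact (10 * n) * ?m" if m: "m \<in> ?S2" for m
    proof -
      let ?x = "real m / (2 * real n)"
      have x: "1/20 \<le> ?x" "?x \<le> 305/1000" using n m by (auto simp: field_simps)
      have "?f m \<le> fact (10 * n) * ((10 * real n + 1) * (2 * real n) * exp (2 * real n * crowd_exponent ?x))"
        using card_crowded_middle[of n m] n x by simp
      also have "\<dots> \<le> fact (10 * n) * ?m"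
      proof -
        have "2 * real n * crowd_exponent ?x \<le> 2 * real n * (- (1/1000))" using crowd_exponent_le[OF x] by (intro mult_left_mono) auto
        then have "exp (2 * real n * crowd_exponent ?x) \<le> exp (- (real n / 500))" by simp
        then show ?thesis by (intro mult_left_mono) auto
      qed
      finally show ?thesis .
    qed
    have "sum ?f ?S2 \<le> real (card ?S2) * (fact (10 * n) * ?m)" by (rule sum_bounded_above[OF each])
    also have "\<dots> \<le> real n * (fact (10 * n) * ?m)"
    proof (rule mult_right_mono)
      have "?S2 \<subseteq> {1..n}" using le by auto
      then have "card ?S2 \<le> n" using card_mono[of "{1..n}" ?S2] by simp
      then show "real (card ?S2) \<le> real n" by linarith
    qed auto
    finally show ?thesis by (simp only: mult_ac)
  qed
  finally show ?thesis by (simp add: algebra_simps)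
qed

lemma sum_card_violating_le:
  assumes n: "n \<ge> 100" and K: "real K \<le> 13/40 * (2 * real n)" "13/40 * (2 * real n) < real K + 1"
  shows "(\<Sum>m | 305/1000 \<le> real m / (2 * real n) \<and> real m / (2 * real n) \<le> 3322/10000. \<Sum>c\<in>{1..10}. real (card (violating n K m c)))
     \<le> fact (10 * n) * (10 * real n * ((1 + 2 * real n) * (10 * real n + 1) ^ 3 * tight_const * exp (- (real n / 1000))))"
proof -
  let ?S = "{m. 305/1000 \<le> real m / (2 * real n) \<and> real m / (2 * real n) \<le> 3322/10000}"
  let ?b = "(1 + 2 * real n) * (10 * real n + 1) ^ 3 * tight_const * exp (- (real n / 1000))"
  have b: "0 \<le> fact (10 * n) * ?b" by (simp add: tight_const_def)
  have range: "60 \<le> m" "m < n" if "m \<in> ?S" for m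
  proof -
    have "610 * real n \<le> 1000 * real m" "10000 * real m \<le> 6644 * real n" using that n by (auto simp: field_simps)
    then show "60 \<le> m" "m < n" using n by linarith+
  qed
  have "(\<Sum>c\<in>{1..10}. real (card (violating n K m c))) \<le> 10 * (fact (10 * n) * ?b)" if m: "m \<in> ?S" for m
  proof -
    have "real (card (violating n K m c)) \<le> fact (10 * n) * ?b" if "c \<in> {1..10}" for c
    proof -
      interpret tight_bound n K m c
        by unfold_locales (use n K range[OF m] m that in auto)
      show ?thesis by (rule card_violating)
    qed
    then have "(\<Sum>c\<in>{1..10}. real (card (violating n K m c))) \<le> of_nat (card {1..10::nat}) * (fact (10 * n) * ?b)"
      by (rule sum_bounded_above)
    then show ?thesis by (simp only: card_atLeastAtMost) simp
  qed
  from sum_bounded_above[of ?S, OF this]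
  have "(\<Sum>m\<in>?S. \<Sum>c\<in>{1..10}. real (card (violating n K m c))) \<le> real (card ?S) * (10 * (fact (10 * n) * ?b))" by simp
  also have "\<dots> \<le> real n * (10 * (fact (10 * n) * ?b))"
  proof (rule mult_right_mono)
    have "?S \<subseteq> {..<n}" using range by auto
    then have "card ?S \<le> n" using card_mono[of "{..<n}" ?S] by simp
    then show "real (card ?S) \<le> real n" by linarith
  qed (use b in auto)
  finally show ?thesis by (simp only: mult_ac)
qed

section \<open>Existence of a good permutation and the theorem\<close>

lemma eventually_small:
  "eventually (\<lambda>n. (1000 / real n + 2 * real n * ((10 * real n + 1) * 20000 * exp (- (real n / 500))))
     + ((1 / real n + real n * ((10 * real n + 1) * (2 * real n) * exp (- (real n / 500))))
     + 10 * real n * ((1 + 2 * real n) * (10 * real n + 1) ^ 3 * tight_const * exp (- (real n / 1000)))) < 1) sequentially"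
proof -
  have "(\<lambda>n. (1000 / real n + 2 * real n * ((10 * real n + 1) * 20000 * exp (- (real n / 500))))) \<longlonglongrightarrow> 0"
    by real_asymp
  moreover have "(\<lambda>n. 1 / real n + real n * ((10 * real n + 1) * (2 * real n) * exp (- (real n / 500)))) \<longlonglongrightarrow> 0"
    by real_asymp
  moreover have "(\<lambda>n. 10 * real n * ((1 + 2 * real n) * (10 * real n + 1) ^ 3 * tight_const * exp (- (real n / 1000)))) \<longlonglongrightarrow> 0"
  proof -
    have "(\<lambda>n. tight_const * (10 * real n * ((1 + 2 * real n) * (10 * real n + 1) ^ 3 * exp (- (real n / 1000))))) \<longlonglongrightarrow> 0"
      by (rule tendsto_mult_right_zero) real_asymp
    then show ?thesis by (simp only: mult_ac)
  qed
  ultimately have "(\<lambda>n. (1000 / real n + 2 * real n * ((10 * real n + 1) * 20000 * exp (- (real n / 500))))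
     + ((1 / real n + real n * ((10 * real n + 1) * (2 * real n) * exp (- (real n / 500))))
     + 10 * real n * ((1 + 2 * real n) * (10 * real n + 1) ^ 3 * tight_const * exp (- (real n / 1000))))) \<longlonglongrightarrow> 0 + (0 + 0)"
    by (intro tendsto_add)
  then show ?thesis by (rule order_tendstoD(2)) simp
qed

lemma ex_notin_if_card_less: "finite X \<Longrightarrow> card X < card Y \<Longrightarrow> \<exists>y\<in>Y. y \<notin> X"
  by (meson card_mono leD subsetI)

lemma good_permutation_exists:
  "\<exists>n0. \<forall>n\<ge>n0. n \<ge> 100 \<and> (\<forall>K. real K \<le> 13/40 * (2 * real n) \<longrightarrow> 13/40 * (2 * real n) < real K + 1 \<longrightarrow>
     (\<exists>p. p permutes {..<10 * n} \<and> (\<forall>s\<in>{1..2 * n}. \<not> covered n K s (cover_size n s)  p)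
        \<and> (\<forall>m. 0 < m \<and> real m / (2 * real n) \<le> 305/1000 \<longrightarrow> \<not> crowded n m p)
        \<and> (\<forall>m c. 305/1000 \<le> real m / (2 * real n) \<and> real m / (2 * real n) \<le> 3322/10000 \<and> c \<in> {1..10} \<longrightarrow> p \<notin> violating n K m c)))"
proof -
  from eventually_conj[OF eventually_small eventually_ge_at_top[of 100]] obtain n0 where
    n0: "\<And>n. n \<ge> n0 \<Longrightarrow> (1000 / real n + 2 * real n * ((10 * real n + 1) * 20000 * exp (- (real n / 500))))
     + ((1 / real n + real n * ((10 * real n + 1) * (2 * real n) * exp (- (real n / 500))))
     + 10 * real n * ((1 + 2 * real n) * (10 * real n + 1) ^ 3 * tight_const * exp (- (real n / 1000)))) < 1 \<and> 100 \<le> n"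
    unfolding eventually_sequentially by auto
  show ?thesis
  proof (intro exI[of _ n0] allI impI conjI)
    fix n assume nn: "n \<ge> n0"
    then show n: "n \<ge> 100" using n0 by blast
    fix K assume K: "real K \<le> 13/40 * (2 * real n)" "13/40 * (2 * real n) < real K + 1"
    let ?M1 = "{m. 0 < m \<and> real m / (2 * real n) \<le> 305/1000}"
    let ?M2 = "{m. 305/1000 \<le> real m / (2 * real n) \<and> real m / (2 * real n) \<le> 3322/10000}"
    let ?A = "\<Union>s\<in>{1..2 * n}. covered_perms n K s (cover_size n s)"
    let ?B = "\<Union>m\<in>?M1. crowded_perms n m"
    let ?C = "\<Union>m\<in>?M2. \<Union>c\<in>{1..10}. violating n K m c"
    have le: "m \<le> n" if "real m / (2 * real n) \<le> 3322/10000" for m using that n by (simp add: field_simps)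
    have fin: "finite ?M1" "finite ?M2"
      using le by (auto intro!: finite_subset[of _ "{..n}"])
    have "card (?A \<union> (?B \<union> ?C)) \<le> card ?A + (card ?B + card ?C)"
      by (rule order_trans[OF card_Un_le add_left_mono[OF card_Un_le]])
    also have "\<dots> \<le> (\<Sum>s\<in>{1..2 * n}. card (covered_perms n K s (cover_size n s))) + ((\<Sum>m\<in>?M1. card (crowded_perms n m)) + (\<Sum>m\<in>?M2. \<Sum>c\<in>{1..10}. card (violating n K m c)))"
      by (intro add_mono card_UN_le fin order_trans[OF card_UN_le[OF fin(2)] sum_mono[OF card_UN_le]]) auto
    finally have "card (?A \<union> (?B \<union> ?C)) \<le> (\<Sum>s\<in>{1..2 * n}. card (covered_perms n K s (cover_size n s))) + ((\<Sum>m\<in>?M1. card (crowded_perms n m)) + (\<Sum>m\<in>?M2. \<Sum>c\<in>{1..10}. card (violating n K m c)))" .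
    from of_nat_mono[OF this, where 'a = real]
    have "real (card (?A \<union> (?B \<union> ?C))) \<le> (\<Sum>s\<in>{1..2 * n}. real (card (covered_perms n K s (cover_size n s)))) + ((\<Sum>m\<in>?M1. real (card (crowded_perms n m))) + (\<Sum>m\<in>?M2. \<Sum>c\<in>{1..10}. real (card (violating n K m c))))"
      by (simp only: of_nat_add of_nat_sum)
    also have "\<dots> \<le> fact (10 * n) * (1000 / n + 2 * real n * ((10 * real n + 1) * 20000 * exp (- (real n / 500))))
       + (fact (10 * n) * (1 / n + real n * ((10 * real n + 1) * (2 * real n) * exp (- (real n / 500))))
       + fact (10 * n) * (10 * real n * ((1 + 2 * real n) * (10 * real n + 1) ^ 3 * tight_const * exp (- (real n / 1000)))))"
      using n K by (intro add_mono sum_card_covered_le sum_card_crowded_le sum_card_violating_le) auto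
    also have "\<dots> = fact (10 * n) * ((1000 / real n + 2 * real n * ((10 * real n + 1) * 20000 * exp (- (real n / 500))))
     + ((1 / real n + real n * ((10 * real n + 1) * (2 * real n) * exp (- (real n / 500))))
     + 10 * real n * ((1 + 2 * real n) * (10 * real n + 1) ^ 3 * tight_const * exp (- (real n / 1000)))))"
      by (simp only: distrib_left)
    also have "\<dots> < fact (10 * n) * 1" using n0[OF nn] by (intro mult_strict_left_mono) auto
    also have "fact (10 * n) * 1 = real (card {p. p permutes {..<10 * n}})"
      using card_permutations[of "{..<10 * n}" "10 * n"] by (simp only: card_lessThan finite_lessThan of_nat_fact mult_1_right)
    finally have less: "card (?A \<union> (?B \<union> ?C)) < card {p. p permutes {..<10 * n}}" by (simp only: of_nat_less_iff)
    have "finite (?A \<union> (?B \<union> ?C))"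
      by (rule finite_subset[OF _ finite_permutations[of "{..<10 * n}"]]) (auto simp: violating_def)
    from ex_notin_if_card_less[OF this less] obtain p where "p permutes {..<10 * n}" "p \<notin> ?A \<union> (?B \<union> ?C)"
      by (elim bexE CollectE)
    then have p: "p permutes {..<10 * n}" "p \<notin> ?A" "p \<notin> ?B" "p \<notin> ?C" by (simp_all only: Un_iff de_Morgan_disj not_False_eq_True simp_thms)
    show "\<exists>p. p permutes {..<10 * n} \<and> (\<forall>s\<in>{1..2 * n}. \<not> covered n K s (cover_size n s)  p)
        \<and> (\<forall>m. 0 < m \<and> real m / (2 * real n) \<le> 305/1000 \<longrightarrow> \<not> crowded n m p)
        \<and> (\<forall>m c. 305/1000 \<le> real m / (2 * real n) \<and> real m / (2 * real n) \<le> 3322/10000 \<and> c \<in> {1..10} \<longrightarrow> p \<notin> violating n K m c)"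
    proof (intro exI[of _ p] conjI ballI allI impI)
      show "p permutes {..<10 * n}" by (rule p(1))
      show "\<not> covered n K s (cover_size n s) p" if "s \<in> {1..2 * n}" for s
        using p(1,2) that by blast
      show "\<not> crowded n m p" if "0 < m \<and> real m / (2 * real n) \<le> 305/1000" for m
        using p(1,3) that by blast
      show "p \<notin> violating n K m c" if "305/1000 \<le> real m / (2 * real n) \<and> real m / (2 * real n) \<le> 3322/10000 \<and> c \<in> {1..10}" for m c
        using p(4) that by blast
    qed
  qed
qed

text \<open>A violating \<open>U\<close> supplies a confining set of fewer than card U pairs, but
  the least size \<open>m\<close> of such a set may be much smaller. Below 0.305 N it is excluded by
  \<open>crowd\<close>; above, minimality makes the extremal argument available and
  \<open>viol\<close> applies.\<close>

lemma pairs_expand: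
  assumes n: "n > 0" and K: "K \<le> n" and p: "p permutes {..<10 * n}"
    and crowd: "\<And>m. 0 < m \<Longrightarrow> real m / (2 * real n) \<le> 305/1000 \<Longrightarrow> \<not> crowded n m p"
    and viol: "\<And>m c. 305/1000 \<le> real m / (2 * real n) \<Longrightarrow> real m / (2 * real n) \<le> 3322/10000 \<Longrightarrow> c \<in> {1..10} \<Longrightarrow> p \<notin> violating n K m c"
    and U: "U \<subseteq> {1..2 * n}" "real (card U) \<le> C3 * (2 * real n)"
  shows "card U \<le> card (adjacent_pairs (random_graph n K p) (half_shift_pairs (2 * n)) U)"
proof (rule ccontr)
  let ?V = "\<lambda>m. \<exists>P\<subseteq>{..<n}. card P = m \<and> m < card (confined n K p P)"
  assume "\<not> ?thesis"
  then obtain m0 where m0: "?V m0" "m0 < card U" using confining_pairs[OF n K U(1), of p] by fastforce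
  define m where "m = (LEAST m. ?V m)"
  have Vm: "?V m" unfolding m_def by (rule LeastI[of ?V]) (rule m0)
  have "m \<le> m0" unfolding m_def by (rule Least_le) (rule m0)
  then have "real m \<le> C3 * (2 * real n)" using m0 U by linarith
  then have mC: "real m / (2 * real n) \<le> 3322/10000" using n by (simp add: C3_def field_simps)
  have minimal: "card (confined n K p P) \<le> card P" if "P \<subseteq> {..<n}" "card P < m" for P
  proof -
    have "\<not> ?V (card P)" by (rule not_less_Least) (use that in \<open>simp add: m_def\<close>)
    then show ?thesis using that(1) by (metis not_less)
  qed
  obtain P where P: "P \<subseteq> {..<n}" "card P = m" "m < card (confined n K p P)" using Vm by auto
  show False
  proof (cases "real m / (2 * real n) \<le> 305/1000")
    case True
    have "m \<noteq> 0"
    proof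
      assume "m = 0"
      then have "P = {}" using P finite_subset[OF P(1)] by auto
      then have "confined n K p P = {}" using nbr_pairs_nonempty[of _ n K p] by (auto simp: confined_def)
      then show False using P by simp
    qed
    then show False using crowd[of m] True crowded_if_confined[OF P] by simp
  next
    case False
    obtain P' u where P': "P' \<subseteq> {..<n}" "card P' = m" "m < u" "u \<le> m + 10"
     "tight n K (\<lambda>_. 3) (\<lambda>_. 11) u UNIV P' p \<or>
      (\<exists>r<n. tight n K (\<lambda>i. if i < r then 3 else 2) (\<lambda>i. if i < r then 3 else 2) u UNIV P' p)"
      using minimal_violator_cases[OF p n P] minimal by blast
    define c where "c = u - m"
    have c: "u = m + c" "c \<in> {1..10}" using P' by (auto simp: c_def)
    have "p \<in> violating n K m c" using p P' unfolding c(1) violating_def by blast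
    then show False using viol[of m c] False mC c by simp
  qed
qed

theorem theorem2p3:
  "\<exists>N0 :: nat. \<forall>N \<ge> N0. even N \<longrightarrow>
     (\<exists>E :: (nat \<times> nat) set.
        E \<subseteq> {1..N} \<times> {1..N} \<and>
        real (card E) \<le> 5.325 * real N \<and>
        (\<forall>S. S \<subseteq> {1..N} \<and> S \<noteq> {} \<longrightarrow>
           int (card (E `` S)) \<ge> \<lceil>e (real (card S) / real N) * real N\<rceil>) \<and>
        (\<forall>\<alpha> \<in> {0..C3}. pair_expander N \<alpha> 1 (half_shift_pairs N) E))"
proof -
  obtain n0 where n0: "\<And>n K. n \<ge> n0 \<Longrightarrow> n \<ge> 100 \<and> (real K \<le> 13/40 * (2 * real n) \<longrightarrow> 13/40 * (2 * real n) < real K + 1 \<longrightarrow>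
     (\<exists>p. p permutes {..<10 * n} \<and> (\<forall>s\<in>{1..2 * n}. \<not> covered n K s (cover_size n s)  p)
        \<and> (\<forall>m. 0 < m \<and> real m / (2 * real n) \<le> 305/1000 \<longrightarrow> \<not> crowded n m p)
        \<and> (\<forall>m c. 305/1000 \<le> real m / (2 * real n) \<and> real m / (2 * real n) \<le> 3322/10000 \<and> c \<in> {1..10} \<longrightarrow> p \<notin> violating n K m c)))"
    using good_permutation_exists by blast
  show ?thesis
  proof (intro exI[of _ "2 * n0"] allI impI)
    fix N assume N: "2 * n0 \<le> N" "even N"
    define n where "n = N div 2"
    have N2: "N = 2 * n" using N by (simp add: n_def)
    have nn: "n \<ge> n0" using N N2 by simp
    have "n \<ge> 100" using n0[OF nn, of 0] by blast
    then have n: "n \<ge> 100" "n > 0" by auto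
    \<comment> \<open>The largest number of additional edges within the budget: 10 n + K \<le> 5.325
      N, as 10 n = 5 N and K \<le> 0.325 N.\<close>
    define K where "K = nat \<lfloor>13/40 * (2 * real n)\<rfloor>"
    have K: "real K \<le> 13/40 * (2 * real n)" "13/40 * (2 * real n) < real K + 1"
      unfolding K_def by linarith+
    have Kn: "K \<le> n" using K(1) by linarith
    obtain p where p: "p permutes {..<10 * n}" "\<And>s. s \<in> {1..2 * n} \<Longrightarrow> \<not> covered n K s (cover_size n s) p"
        "\<And>m. 0 < m \<Longrightarrow> real m / (2 * real n) \<le> 305/1000 \<Longrightarrow> \<not> crowded n m p"
        "\<And>m c. 305/1000 \<le> real m / (2 * real n) \<Longrightarrow> real m / (2 * real n) \<le> 3322/10000 \<Longrightarrow> c \<in> {1..10} \<Longrightarrow> p \<notin> violating n K m c"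
      using n0[OF nn, of K] K by metis
    let ?E = "random_graph n K p"
    show "\<exists>E. E \<subseteq> {1..N} \<times> {1..N} \<and> real (card E) \<le> 5.325 * real N \<and>
        (\<forall>S. S \<subseteq> {1..N} \<and> S \<noteq> {} \<longrightarrow> int (card (E `` S)) \<ge> \<lceil>e (real (card S) / real N) * real N\<rceil>) \<and>
        (\<forall>\<alpha> \<in> {0..C3}. pair_expander N \<alpha> 1 (half_shift_pairs N) E)"
    proof (intro exI[of _ ?E] conjI allI impI ballI)
      show "?E \<subseteq> {1..N} \<times> {1..N}" unfolding N2 by (rule random_graph_subset[OF n(2) Kn])
      have "real (card ?E) \<le> 10 * real n + real K" using card_random_graph[of n K p] by linarith
      then show "real (card ?E) \<le> 5.325 * real N" using K(1) by (simp add: N2)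
    next
      fix S assume S: "S \<subseteq> {1..N} \<and> S \<noteq> {}"
      then have finS: "finite S" using finite_subset by auto
      have s: "card S \<in> {1..2 * n}"
        using S finS card_mono[of "{1..N}" S] by (auto simp: N2 card_gt_0_iff Suc_le_eq)
      let ?v = "e (real (card S) / (2 * real n)) * (2 * real n)"
      have "real (card S) / (2 * real n) \<in> {0..1}" using s n by (auto simp: field_simps)
      then have "e (real (card S) / (2 * real n)) \<le> 1" using e_range by auto
      then have "?v \<le> 1 * (2 * real n)" by (intro mult_right_mono) auto
      then have "\<lceil>?v\<rceil> \<le> 2 * int n" by (simp add: ceiling_le_iff)
      then have t: "cover_size n (card S) \<le> 2 * n" unfolding cover_size_def by linarith
      show "\<lceil>e (real (card S) / real N) * real N\<rceil> \<le> int (card (?E `` S))"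
      proof (rule ccontr)
        assume "\<not> ?thesis"
        then have "int (card (?E `` S)) \<le> \<lceil>?v\<rceil> - 1" by (simp add: N2)
        then have "card (?E `` S) \<le> cover_size n (card S)" unfolding cover_size_def by linarith
        then have "covered n K (card S) (cover_size n (card S)) p"
          using S t by (intro covered_if_small_image n Kn) (auto simp: N2)
        then show False using p(2)[OF s] by simp
      qed
    next
      fix \<alpha> assume al: "\<alpha> \<in> {0..C3}"
      show "pair_expander N \<alpha> 1 (half_shift_pairs N) ?E"
        unfolding pair_expander_def
      proof (intro allI impI)
        fix U assume U: "U \<subseteq> {1..N}" "int (card U) = \<lfloor>\<alpha> * real N\<rfloor>"
        \<comment> \<open>The parameter \<alpha> enters only through this bound, so one argument
          serves all \<alpha> up to \<open>C3\<close>.\<close>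
        have "real (card U) \<le> \<alpha> * real N" using U(2) by linarith
        also have "\<dots> \<le> C3 * (2 * real n)" using al unfolding N2 by (intro mult_mono) auto
        finally have "card U \<le> card (adjacent_pairs ?E (half_shift_pairs (2 * n)) U)"
          using U by (intro pairs_expand n Kn p) (auto simp: N2)
        then show "\<lfloor>1 * real (card U)\<rfloor> \<le> int (card (adjacent_pairs ?E (half_shift_pairs N) U))"
          by (simp add: N2)
      qed
    qed
  qed
qed

end
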